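(* The cusp forms $C_{(r,s)}(z)$ defined in the context are expressed in terms of eta quotients as follows. $$C_{(1,2)}(z)=0,\qquad C_{(1,3)}(z)=0,\qquad C_{(1,5)}(z)=\tfrac{576}{13}\,\eta[1^4,5^4](z),$$ $$C_{(1,7)}(z)=\tfrac{576}{5}\,\eta[1^5,2^{-1},7^5,14^{-1}](z)+\tfrac{2304}{5}\,\eta[1^2,2^2,7^2,14^2](z),$$ $$\begin{aligned}C_{(1,11)}(z)=&\tfrac{17280}{61}\,\eta[1^6,2^{-2},11^6,22^{-2}](z)+\tfrac{118656}{61}\,\eta[1^4,11^4](z)\\&+\tfrac{276480}{61}\,\eta[1^2,2^2,11^2,22^2](z)+\tfrac{276480}{61}\,\eta[2^4,22^4](z),\end{aligned}$$ $$C_{(2,3)}(z)=-\tfrac{144}{5}\,\eta[1^2,2^2,3^2,6^2](z),$$ $$C_{(2,5)}(z)=\tfrac{48}{13}\,\eta[1^{-2},2^8,5^2](z)-\tfrac{6000}{13}\,\eta[1^2,5^{-2},10^8](z),$$ $$\begin{aligned}C_{(2,7)}(z)=&\tfrac{288}{5}\,\eta[1^5,2^{-1},7^5,14^{-1}](z)-\tfrac{336}{25}\,\eta[1^{-2},2^6,7^6,14^{-2}](z)\\&+\tfrac{8064}{25}\,\eta[1^2,2^2,7^2,14^2](z)-\tfrac{5136}{25}\,\eta[1^6,2^{-2},7^{-2},14^6](z),\end{aligned}$$ $$\begin{aligned}C_{(3,5)}(z)=&\tfrac{108}{13}\,\eta[1^{11},2^{-5},3^{-5},5^{-5},6^{3},10^{3},15^{11},30^{-5}](z)\\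 &-\tfrac{1584}{13}\,\eta[1^{2},2^{-3},3^{-4},5^{-3},6^{9},10^{4},15^{7},30^{-4}](z)\\ &-\tfrac{2376}{13}\,\eta[1^{4},2^{-3},3^{-2},5^{2},6^{5},10^{1},15^{0},30^{1}](z)\\ &-\tfrac{5832}{13}\,\eta[1^{1},2^{-2},3^{-3},5^{2},6^{8},10^{-1},15^{2},30^{1}](z)\\ &+\tfrac{11448}{13}\,\eta[1^{2},2^{-2},3^{0},5^{-2},6^{2},10^{6},15^{0},30^{2}](z)\\ &+\tfrac{33264}{13}\,\eta[1^{1},2^{2},3^{4},5^{3},6^{-3},10^{-2},15^{-4},30^{7}](z)\\ &+\tfrac{10080}{13}\,\eta[1^{1},2^{0},3^{-1},5^{-3},6^{0},10^{2},15^{7},30^{2}](z)\\ &+\tfrac{83520}{13}\,\eta[1^{1},2^{-1},3^{-2},5^{1},6^{4},10^{-1},15^{0},30^{6}](z)\\ &+\tfrac{145584}{13}\,\eta[1^{0},2^{1},3^{0},5^{2},6^{-1},10^{-3},15^{2},30^{7}](z)\\ &-\tfrac{117720}{13}\,\eta[1^{-2},2^{3},3^{5},5^{3},6^{-4},10^{-4},15^{-4},30^{11}](z)\\ &-1944\,\eta[1^{1},2^{0},3^{1},5^{3},6^{0},10^{-4},15^{-5},30^{12}](z)\\ &+\tfrac{158688}{13}\,\eta[1^{0},2^{1},3^{1},5^{2},6^{-2},10^{-3},15^{-3},30^{12}](z)\\ &+\tfrac{216000}{13}\,\eta[1^{-1},2^{3},3^{1},5^{3},6^{-1},10^{-5},15^{-7},30^{15}](z)\\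 &+\tfrac{316224}{13}\,\eta[1^{0},2^{1},3^{2},5^{2},6^{-3},10^{-3},15^{-8},30^{17}](z),\end{aligned}$$ $$C_{(1,6)}(z)=\tfrac{288}{5}\,\eta[1^2,2^2,3^2,6^2](z),$$ $$C_{(1,10)}(z)=\tfrac{2976}{13}\,\eta[1^{-1},2^5,5^5,10^{-1}](z)-\tfrac{480}{13}\,\eta[1^5,2^{-1},5^{-1},10^5](z),$$ $$\begin{aligned}C_{(1,14)}(z)=&\tfrac{10272}{25}\,\eta[1^{-2},2^6,7^6,14^{-2}](z)-\tfrac{4608}{25}\,\eta[1^2,2^2,7^2,14^2](z)\\&+\tfrac{672}{25}\,\eta[1^6,2^{-2},7^{-2},14^6](z),\end{aligned}$$ $$\begin{aligned}C_{(1,15)}(z)=&\tfrac{5976}{13}\,\eta[1^{11},2^{-5},3^{-5},5^{-5},6^{3},10^{3},15^{11},30^{-5}](z)\\ &+\tfrac{74592}{13}\,\eta[1^{2},2^{-3},3^{-4},5^{-3},6^{9},10^{4},15^{7},30^{-4}](z)\\ &-\tfrac{137808}{13}\,\eta[1^{4},2^{-3},3^{-2},5^{2},6^{5},10^{1},15^{0},30^{1}](z)\\ &-\tfrac{85968}{13}\,\eta[1^{1},2^{-2},3^{-3},5^{2},6^{8},10^{-1},15^{2},30^{1}](z)\\ &+\tfrac{153072}{13}\,\eta[1^{2},2^{-2},3^{0},5^{-2},6^{2},10^{6},15^{0},30^{2}](z)\\ &-\tfrac{617184}{13}\,\eta[1^{1},2^{2},3^{4},5^{3},6^{-3},10^{-2},15^{-4},30^{7}](z)\\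 &+\tfrac{1513728}{13}\,\eta[1^{1},2^{0},3^{-1},5^{-3},6^{0},10^{2},15^{7},30^{2}](z)\\ &-\tfrac{2807424}{13}\,\eta[1^{1},2^{-1},3^{-2},5^{1},6^{4},10^{-1},15^{0},30^{6}](z)\\ &-\tfrac{943200}{13}\,\eta[1^{0},2^{1},3^{0},5^{2},6^{-1},10^{-3},15^{2},30^{7}](z)\\ &+135504\,\eta[1^{-2},2^{3},3^{5},5^{3},6^{-4},10^{-4},15^{-4},30^{11}](z)\\ &+\tfrac{3255696}{13}\,\eta[1^{1},2^{0},3^{1},5^{3},6^{0},10^{-4},15^{-5},30^{12}](z)\\ &-\tfrac{3409344}{13}\,\eta[1^{0},2^{1},3^{1},5^{2},6^{-2},10^{-3},15^{-3},30^{12}](z)\\ &+\tfrac{586368}{13}\,\eta[1^{-1},2^{3},3^{1},5^{3},6^{-1},10^{-5},15^{-7},30^{15}](z)\\ &-\tfrac{10461312}{13}\,\eta[1^{0},2^{1},3^{2},5^{2},6^{-3},10^{-3},15^{-8},30^{17}](z).\end{aligned}$$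
   Context: Here $z$ lies in the upper half plane and $q=e^{2\pi i z}$. The Dedekind eta function is $\eta(z)=e^{\pi i z/12}\prod_{n=1}^{\infty}(1-e^{2\pi i n z})$. Eta quotients are written $\eta[\delta_1^{r_1},\dots,\delta_m^{r_m}](z)=\prod_{j=1}^m\eta(\delta_jz)^{r_j}$, where inside the brackets $\delta^{r}$ is formal notation (base $\delta$ a positive integer, exponent $r\in\mathbb{Z}$), not a power to be evaluated. With $\sigma_k(n)=\sum_{d\mid n}d^k$ and $\sigma=\sigma_1$, let $E_2(z)=1-24\sum_{n\ge1}\sigma(n)q^n$, $E_4(z)=1+240\sum_{n\ge1}\sigma_3(n)q^n$, and $L_d(z)=E_2(z)-d\,E_2(dz)$ for $d\in\mathbb{N}$. For $p$ prime and $p_1\neq p_2$ primes, the cusp forms $C_{(1,p)}\in S_4(\Gamma_0(p))$ and $C_{(p_1,p_2)},C_{(1,p_1p_2)}\in S_4(\Gamma_0(p_1p_2))$ (weight 4 cusp forms) are those determined by $$(L_p(z))^2=\frac{(p-1)^2}{p^2+1}E_4(z)+\frac{p^2(p-1)^2}{p^2+1}E_4(pz)+C_{(1,p)}(z),$$ $$\begin{aligned}L_{p_1}(z)L_{p_2}(z)=&\frac{(p_1^2-p_1+1)(p_2^2-p_2+1)}{(p_1^2+1)(p_2^2+1)}E_4(z)-\frac{p_1^3(p_2^2-p_2+1)}{(p_1^2+1)(p_2^2+1)}E_4(p_1z)\\&-\frac{p_2^3(p_1^2-p_1+1)}{(p_1^2+1)(p_2^2+1)}E_4(p_2z)+\frac{p_1^3p_2^3}{(p_1^2+1)(p_2^2+1)}E_4(p_1p_2z)+C_{(p_1,p_2)}(z),\end{aligned}$$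 $$\begin{aligned}(L_{p_1p_2}(z))^2=&\left(1-\frac{2p_1p_2}{(p_1^2+1)(p_2^2+1)}\right)E_4(z)-\frac{2p_1^3p_2}{(p_1^2+1)(p_2^2+1)}E_4(p_1z)\\&-\frac{2p_1p_2^3}{(p_1^2+1)(p_2^2+1)}E_4(p_2z)+\left(p_1^2p_2^2-\frac{2p_1^3p_2^3}{(p_1^2+1)(p_2^2+1)}\right)E_4(p_1p_2z)+C_{(1,p_1p_2)}(z).\end{aligned}$$ (So $C_{(1,6)},C_{(1,10)},C_{(1,14)},C_{(1,15)}$ come from the third identity with $\{p_1,p_2\}=\{2,3\},\{2,5\},\{2,7\},\{3,5\}$, respectively.) *)

theory Defs
  imports "HOL-Analysis.Analysis"
begin

(* All functions of z below are meant on the upper half plane Im z > 0,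
   where every infinite sum and product converges. *)

definition nome :: "complex \<Rightarrow> complex" where
  "nome z = exp (2 * of_real pi * \<i> * z)"

definition dedekind_eta :: "complex \<Rightarrow> complex" where
  "dedekind_eta z =
     exp (of_real pi * \<i> * z / 12) *
     (\<Prod>n. 1 - exp (2 * of_real pi * \<i> * of_nat (Suc n) * z))"

(* The list [(d1, r1), ..., (dm, rm)] stands for the formal symbol
   [d1^r1, ..., dm^rm]; entries with r = 0 are allowed and contribute 1. *)
definition eta_quotient :: "(nat \<times> int) list \<Rightarrow> complex \<Rightarrow> complex" where
  "eta_quotient drs z = (\<Prod>(d, r)\<leftarrow>drs. dedekind_eta (of_nat d * z) powi r)"

definition divisor_sigma :: "nat \<Rightarrow> nat \<Rightarrow> nat" where
  "divisor_sigma k n = (\<Sum>d | d dvd n. d ^ k)"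

definition E2 :: "complex \<Rightarrow> complex" where
  "E2 z = 1 - 24 * (\<Sum>n. of_nat (divisor_sigma 1 (Suc n)) * nome z ^ Suc n)"

definition E4 :: "complex \<Rightarrow> complex" where
  "E4 z = 1 + 240 * (\<Sum>n. of_nat (divisor_sigma 3 (Suc n)) * nome z ^ Suc n)"

definition L :: "nat \<Rightarrow> complex \<Rightarrow> complex" where
  "L d z = E2 z - of_nat d * E2 (of_nat d * z)"

(* The next three functions are the weight 4 cusp forms C_(1,p), C_(p1,p2) and
   C_(1,p1 p2), for p prime and p1, p2 distinct primes.  Each is determined by
   an identity "product of L's = combination of E4's + C", which is solved for
   C here; their modularity and cuspidality play no role in the definition. *)

definition C_1p :: "nat \<Rightarrow> complex \<Rightarrow> complex" where
  "C_1p m z = (let p = of_nat m :: complex in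
     (L m z)\<^sup>2 -
     ((p - 1)\<^sup>2 / (p\<^sup>2 + 1) * E4 z
      + p\<^sup>2 * (p - 1)\<^sup>2 / (p\<^sup>2 + 1) * E4 (p * z)))"

definition C_pp :: "nat \<Rightarrow> nat \<Rightarrow> complex \<Rightarrow> complex" where
  "C_pp m n z = (let p = of_nat m :: complex; q = of_nat n :: complex in
     L m z * L n z -
     ((p\<^sup>2 - p + 1) * (q\<^sup>2 - q + 1) / ((p\<^sup>2 + 1) * (q\<^sup>2 + 1)) * E4 z
      - p ^ 3 * (q\<^sup>2 - q + 1) / ((p\<^sup>2 + 1) * (q\<^sup>2 + 1)) * E4 (p * z)
      - q ^ 3 * (p\<^sup>2 - p + 1) / ((p\<^sup>2 + 1) * (q\<^sup>2 + 1)) * E4 (q * z)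
      + p ^ 3 * q ^ 3 / ((p\<^sup>2 + 1) * (q\<^sup>2 + 1)) * E4 (p * q * z)))"

(* C_1pp m n is C_(1,mn); it is symmetric in m and n. *)
definition C_1pp :: "nat \<Rightarrow> nat \<Rightarrow> complex \<Rightarrow> complex" where
  "C_1pp m n z = (let p = of_nat m :: complex; q = of_nat n :: complex in
     (L (m * n) z)\<^sup>2 -
     ((1 - 2 * p * q / ((p\<^sup>2 + 1) * (q\<^sup>2 + 1))) * E4 z
      - 2 * p ^ 3 * q / ((p\<^sup>2 + 1) * (q\<^sup>2 + 1)) * E4 (p * z)
      - 2 * p * q ^ 3 / ((p\<^sup>2 + 1) * (q\<^sup>2 + 1)) * E4 (q * z)
      + (p\<^sup>2 * q\<^sup>2 - 2 * p ^ 3 * q ^ 3 / ((p\<^sup>2 + 1) * (q\<^sup>2 + 1))) * E4 (p * q * z)))"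

end

theory Submission
  imports Defs "HOL-Complex_Analysis.Complex_Analysis"
begin

text \<open>
  All identities are reduced to finitely many \<open>q\<close>-coefficients by Sturm's bound, which is proved
  with a norm from \<open>\<Gamma>\<^sub>0(N)\<close> to the full modular group and the maximum modulus principle. The
  multiplier system of the eta quotients is never needed. Each eta quotient \<open>f\<close> is written as
  \<open>f = Q\<close>, or at level 22 as \<open>X f = Q\<close>, where \<open>X\<close> and \<open>Q\<close> are explicit polynomials in the
  Eisenstein series \<open>L\<^sub>d(z)\<close> and \<open>E\<^sub>4(d z)\<close>; such an equation is equivalent to equality of the
  logarithmic derivatives and of the leading coefficients, and since the logarithmic derivative of
  \<open>f\<close> is a combination of the series \<open>E\<^sub>2(d z)\<close>, it amounts to the vanishing of a modular form
  built from Eisenstein series only. What remains are the transformation laws of \<open>E\<^sub>2\<close>, of the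
  24th power of \<open>\<eta>\<close> and of \<open>E\<^sub>4\<close>.
\<close>

section \<open>\<open>q\<close>-expansions\<close>

text \<open>The obstacle is that an eta quotient \<open>f\<close> carries a character and its orders
  at all cusps would have to be controlled. Its logarithmic derivative carries no character: for
  exponent sum 8, \<open>q d/dq\<close> of \<open>log f\<close> is (8 E2 - sum of r L_d) / 24. If
  \<open>Q\<close> has weight a + 4 and \<open>X\<close> weight a, the quasimodular parts of the
  logarithmic derivatives of \<open>Q\<close> and \<open>X\<close> differ by (4/12) E2 = (8/24) E2,
  so E2 cancels and \<open>X f = Q\<close> turns into the vanishing of a form of weight 2 a + 6.
  Once the quotients are Eisenstein polynomials, each claim about a cusp form is a linear relation
  between Eisenstein polynomials, of weight 4 or, at level 22, of weight 8. Both kinds of statement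
  are settled by evaluating truncated integer series. The law of E2 comes from comparing two orders
  of summation of a conditionally convergent series, that of \<open>Delta\<close> from integrating
  it. For E4 the lattice sum gives the law up to the unknown value of zeta at 4, which is found by
  comparison with E2^2 - 12 q dE2/dq. Levels 2, 3, 5, 6, 10 and 15 are treated inside level 30,
  level 7 inside 14 and level 11 inside 22.\<close>

abbreviation uhp :: "complex set" where "uhp \<equiv> {z. Im z > 0}"

definition qexp :: "complex fps \<Rightarrow> (complex \<Rightarrow> complex) \<Rightarrow> bool" where
  "qexp F f \<longleftrightarrow> fps_conv_radius F \<ge> 1 \<and> (\<forall>z\<in>uhp. f z = eval_fps F (nome z))"

text \<open>The operator q d/dq, which multiplies the n-th coefficient of a q-expansion by
  n.\<close>

definition theta_op :: "(complex \<Rightarrow> complex) \<Rightarrow> complex \<Rightarrow> complex" where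
  "theta_op f z = deriv f z / (2 * of_real pi * \<i>)"

definition fps_dilate :: "nat \<Rightarrow> 'a::zero fps \<Rightarrow> 'a fps" where
  "fps_dilate d F = Abs_fps (\<lambda>n. if d dvd n then fps_nth F (n div d) else 0)"

lemma open_uhp: "open uhp" and convex_uhp: "convex uhp" and connected_uhp: "connected uhp"
proof -
  show "open uhp" by (rule open_halfspace_Im_gt)
  show "convex uhp" by (rule convex_halfspace_Im_gt)
  then show "connected uhp" by (rule convex_connected)
qed

lemma norm_nome: "norm (nome z) = exp (- (2 * pi * Im z))"
  by (simp add: nome_def)

lemma nome_nz [simp]: "nome z \<noteq> 0"
  by (simp add: nome_def)

lemma norm_nome_less_1: "z \<in> uhp \<Longrightarrow> norm (nome z) < 1"
  by (simp add: norm_nome)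

lemma nome_mult_nat: "nome (of_nat n * z) = nome z ^ n"
  by (simp add: nome_def exp_of_nat_mult [symmetric] mult_ac)

lemma nome_plus_1: "nome (z + 1) = nome z"
  by (simp add: nome_def ring_distribs exp_add mult_ac exp_two_pi_i')

lemma nome_has_field_derivative [derivative_intros]:
  "(nome has_field_derivative (2 * of_real pi * \<i> * nome z)) (at z within A)"
  unfolding nome_def by (auto intro!: derivative_eq_intros simp: mult_ac)

lemma nome_holomorphic [holomorphic_intros]: "nome holomorphic_on A"
  unfolding nome_def by (intro holomorphic_intros)

lemma ereal_less_if_less_1: "x < 1 \<Longrightarrow> R \<ge> 1 \<Longrightarrow> ereal x < R"
  by (rule less_le_trans[of _ 1]) simp_all

lemma norm_nome_less_radius:
  assumes "qexp F f" "z \<in> uhp"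
  shows "ereal (norm (nome z)) < fps_conv_radius F"
  using assms norm_nome_less_1 by (intro ereal_less_if_less_1) (auto simp: qexp_def)

lemma qexp_sums:
  assumes "qexp F f" "z \<in> uhp"
  shows "(\<lambda>n. fps_nth F n * nome z ^ n) sums f z"
  using sums_eval_fps[OF norm_nome_less_radius[OF assms]] assms by (simp add: qexp_def)

lemma qexp_holomorphic:
  assumes "qexp F f"
  shows "f holomorphic_on uhp"
proof -
  have "(\<lambda>z. eval_fps F (nome z)) holomorphic_on uhp"
    using norm_nome_less_radius[OF assms]
    by (intro holomorphic_on_compose_gen[of nome uhp "eval_fps F" "eball 0 (fps_conv_radius F)", unfolded o_def]
              nome_holomorphic holomorphic_on_eval_fps) auto
  then show ?thesis
    by (rule holomorphic_transform) (use assms in \<open>auto simp: qexp_def\<close>)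
qed

lemma qexp_const: "qexp (fps_const c) (\<lambda>_. c)"
  by (simp add: qexp_def)

lemma qexp_add: "qexp F f \<Longrightarrow> qexp G g \<Longrightarrow> qexp (F + G) (\<lambda>z. f z + g z)"
  using fps_conv_radius_add[of F G] norm_nome_less_radius[of F f] norm_nome_less_radius[of G g]
  by (auto simp: qexp_def eval_fps_add min_def split: if_splits)

lemma qexp_diff: "qexp F f \<Longrightarrow> qexp G g \<Longrightarrow> qexp (F - G) (\<lambda>z. f z - g z)"
  using fps_conv_radius_diff[of F G] norm_nome_less_radius[of F f] norm_nome_less_radius[of G g]
  by (auto simp: qexp_def eval_fps_diff min_def split: if_splits)

lemma qexp_mult: "qexp F f \<Longrightarrow> qexp G g \<Longrightarrow> qexp (F * G) (\<lambda>z. f z * g z)"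
  using fps_conv_radius_mult[of F G] norm_nome_less_radius[of F f] norm_nome_less_radius[of G g]
  by (auto simp: qexp_def eval_fps_mult min_def split: if_splits)

lemma qexp_cmult: "qexp F f \<Longrightarrow> qexp (fps_const c * F) (\<lambda>z. c * f z)"
  using qexp_mult[OF qexp_const] .

lemma qexp_cong: "qexp F f \<Longrightarrow> (\<And>z. z \<in> uhp \<Longrightarrow> g z = f z) \<Longrightarrow> qexp F g"
  by (auto simp: qexp_def)

lemma qexp_theta:
  assumes "qexp F f"
  shows "qexp (fps_X * fps_deriv F) (theta_op f)"
proof -
  have r: "fps_conv_radius (fps_deriv F) \<ge> 1"
    using assms by (auto simp: qexp_def intro: order.trans[OF _ fps_conv_radius_deriv])
  have "fps_conv_radius (fps_X * fps_deriv F) \<ge> 1"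
    using fps_conv_radius_mult[of fps_X "fps_deriv F"] r by auto
  moreover have "theta_op f z = eval_fps (fps_X * fps_deriv F) (nome z)" if z: "z \<in> uhp" for z
  proof -
    have n: "ereal (norm (nome z)) < fps_conv_radius F"
      by (rule norm_nome_less_radius[OF assms z])
    have n': "ereal (norm (nome z)) < fps_conv_radius (fps_deriv F)"
      using n fps_conv_radius_deriv[of F] by order
    have ev: "\<forall>\<^sub>F w in nhds z. eval_fps F (nome w) = f w"
      using eventually_nhds_in_open[OF open_uhp z] assms
      by (auto elim!: eventually_mono simp: qexp_def)
    have d1: "(eval_fps F has_field_derivative eval_fps (fps_deriv F) (nome z)) (at (nome z))"
      using has_field_derivative_eval_fps[OF n] by simp
    have "((\<lambda>w. eval_fps F (nome w)) has_field_derivative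
            eval_fps (fps_deriv F) (nome z) * (2 * of_real pi * \<i> * nome z)) (at z)"
      using DERIV_chain2[OF d1 nome_has_field_derivative] by blast
    with ev have "(f has_field_derivative
            eval_fps (fps_deriv F) (nome z) * (2 * of_real pi * \<i> * nome z)) (at z)"
      by (subst (asm) DERIV_cong_ev) auto
    then have "deriv f z = eval_fps (fps_deriv F) (nome z) * (2 * of_real pi * \<i> * nome z)"
      by (rule DERIV_imp_deriv)
    then show ?thesis
      using n' by (simp add: theta_op_def eval_fps_mult mult_ac[of _ "\<i>"] flip: mult.assoc)
  qed
  ultimately show ?thesis
    by (auto simp: qexp_def)
qed

lemma eval_fps_dilate:
  assumes "d > 0"
  shows "eval_fps (fps_dilate d F) x = eval_fps F (x ^ d)"
proof -
  have "(\<Sum>n. fps_nth F n * (x ^ d) ^ n) = (\<Sum>n. fps_nth (fps_dilate d F) (d * n) * x ^ (d * n))"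
    using assms by (simp add: fps_dilate_def power_mult)
  also have "\<dots> = (\<Sum>n. fps_nth (fps_dilate d F) n * x ^ n)"
    by (rule suminf_mono_reindex)
       (use assms in \<open>auto simp: fps_dilate_def strict_mono_def\<close>)
  finally show ?thesis by (simp add: eval_fps_def)
qed

lemma fps_conv_radius_dilate:
  assumes "d > 0" "fps_conv_radius F \<ge> 1"
  shows "fps_conv_radius (fps_dilate d F) \<ge> 1"
  unfolding fps_conv_radius_def
proof (rule conv_radius_geI_ex')
  fix r :: real assume r: "0 < r" "ereal r < 1"
  have "norm (of_real (r ^ d) :: 'a) < 1"
    using r assms(1) by (simp add: norm_power power_less_one_iff)
  from ereal_less_if_less_1[OF this assms(2)] have "summable (\<lambda>n. fps_nth F n * of_real (r ^ d) ^ n)"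
    by (rule summable_fps)
  then have "summable (\<lambda>n. fps_nth (fps_dilate d F) (d * n) * of_real r ^ (d * n))"
    using assms(1) by (simp add: fps_dilate_def power_mult)
  then show "summable (\<lambda>n. fps_nth (fps_dilate d F) n * of_real r ^ n)"
    by (subst (asm) summable_mono_reindex)
       (use assms(1) in \<open>auto simp: fps_dilate_def strict_mono_def\<close>)
qed

lemma qexp_dilate:
  assumes "qexp F f" "d > 0"
  shows "qexp (fps_dilate d F) (\<lambda>z. f (of_nat d * z))"
  using assms by (auto simp: qexp_def fps_conv_radius_dilate eval_fps_dilate nome_mult_nat)

text \<open>The power q^n splits off, and the cofactor is continuous on the compact disc of radius
  exp (-2 pi y) < 1, hence bounded there. The case n = 0 is plain boundedness on half planes Im z
  \<ge> y.\<close>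

lemma qexp_order_bound:
  assumes F: "qexp F f" and n: "\<And>i. i < n \<Longrightarrow> fps_nth F i = 0" and y: "y > 0"
  obtains B where "B > 0" "\<And>z. Im z \<ge> y \<Longrightarrow> norm (f z) \<le> B * norm (nome z) ^ n"
proof -
  define r where "r = exp (- (2 * pi * y))"
  have r: "0 < r" "r < 1" using y by (auto simp: r_def)
  define G where "G = fps_shift n F"
  have G: "fps_conv_radius G \<ge> 1"
    using F by (simp add: G_def qexp_def)
  have FG: "F = G * fps_X ^ n"
    by (rule fps_ext) (auto simp: G_def fps_X_power_mult_right_nth n)
  have "continuous_on (cball 0 r) (eval_fps G)"
  proof (rule continuous_on_subset[OF continuous_on_eval_fps])
    show "(cball 0 r :: complex set) \<subseteq> eball 0 (fps_conv_radius G)"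
    proof
      fix x :: complex assume "x \<in> cball 0 r"
      then have "norm x < 1" using r by simp
      from ereal_less_if_less_1[OF this G] show "x \<in> eball 0 (fps_conv_radius G)"
        by simp
    qed
  qed
  then have "compact (eval_fps G ` cball 0 r)"
    by (rule compact_continuous_image) auto
  then have "bounded (eval_fps G ` cball 0 r)" by (rule compact_imp_bounded)
  then obtain B where B: "B > 0" "\<And>x. x \<in> cball 0 r \<Longrightarrow> norm (eval_fps G x) \<le> B"
    by (auto simp: bounded_pos)
  show ?thesis
  proof (rule that[OF B(1)])
    fix z assume z: "Im z \<ge> y"
    have zu: "z \<in> uhp" using z y by simp
    have lt: "ereal (norm (nome z)) < fps_conv_radius G"
      by (rule ereal_less_if_less_1[OF norm_nome_less_1[OF zu] G])
    have "f z = eval_fps G (nome z) * nome z ^ n"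
      using F zu lt by (simp add: qexp_def FG eval_fps_mult)
    moreover have "nome z \<in> cball 0 r"
      using z by (simp add: norm_nome r_def)
    ultimately show "norm (f z) \<le> B * norm (nome z) ^ n"
      using B(2) by (simp add: norm_mult norm_power mult_right_mono)
  qed
qed

section \<open>Divisor sums\<close>

lemma divisor_sigma_le: "divisor_sigma k n \<le> n ^ Suc k"
proof (cases "n = 0")
  case False
  have "divisor_sigma k n \<le> (\<Sum>d | d dvd n. n ^ k)"
    unfolding divisor_sigma_def using False by (intro sum_mono power_mono) (auto intro: dvd_imp_le)
  also have "\<dots> \<le> n ^ Suc k"
  proof -
    have "{d. d dvd n} \<subseteq> {1..n}"
      using False by (auto simp: Suc_le_eq intro: dvd_imp_le Nat.gr0I)
    from card_mono[OF _ this] have "card {d. d dvd n} \<le> n" by simp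
    then show ?thesis by simp
  qed
  finally show ?thesis .
qed (simp add: divisor_sigma_def)

definition sigma_fps :: "nat \<Rightarrow> complex fps" where
  "sigma_fps k = Abs_fps (\<lambda>n. if n = 0 then 0 else of_nat (divisor_sigma k n))"

lemma summable_power_times_geometric:
  fixes r :: real
  assumes "0 \<le> r" "r < 1"
  shows "summable (\<lambda>n. real n ^ k * r ^ n)"
proof (cases "r = 0")
  case True
  then show ?thesis by (intro summable_finite[of "{0}"]) auto
next
  case False
  have "conv_radius (\<lambda>n. real n ^ k) = 1"
  proof (rule conv_radius_ratio_limit_nonzero)
    show "(\<lambda>n. norm (real n ^ k) / norm (real (Suc n) ^ k)) \<longlonglongrightarrow> 1"
    proof -
      have "(\<lambda>n. (real n / real (Suc n)) ^ k) \<longlonglongrightarrow> 1 ^ k"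
        by (intro tendsto_intros LIMSEQ_n_over_Suc_n)
      then show ?thesis by (simp add: power_divide del: of_nat_Suc)
    qed
  qed auto
  then show ?thesis
    using assms by (intro summable_in_conv_radius) auto
qed

lemma fps_conv_radius_sigma: "fps_conv_radius (sigma_fps k) \<ge> 1"
  unfolding fps_conv_radius_def
proof (rule conv_radius_geI_ex')
  fix r :: real assume r: "0 < r" "ereal r < 1"
  show "summable (\<lambda>n. fps_nth (sigma_fps k) n * of_real r ^ n)"
  proof (rule summable_comparison_test)
    show "\<exists>N. \<forall>n\<ge>N. norm (fps_nth (sigma_fps k) n * of_real r ^ n) \<le> real n ^ Suc k * r ^ n"
    proof (intro exI allI impI)
      fix n
      have "real (divisor_sigma k n) \<le> real n ^ Suc k"
        using divisor_sigma_le[of k n] by (metis of_nat_le_iff of_nat_power)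
      then show "norm (fps_nth (sigma_fps k) n * of_real r ^ n) \<le> real n ^ Suc k * r ^ n"
        using r by (auto simp: sigma_fps_def norm_mult norm_power intro!: mult_right_mono)
    qed
    show "summable (\<lambda>n. real n ^ Suc k * r ^ n)"
      using r by (intro summable_power_times_geometric) auto
  qed
qed

lemma sums_sigma:
  assumes "norm q < 1"
  shows "(\<lambda>n. of_nat (divisor_sigma k (Suc n)) * q ^ Suc n) sums eval_fps (sigma_fps k) q"
proof -
  have "ereal (norm q) < fps_conv_radius (sigma_fps k)"
    by (rule ereal_less_if_less_1[OF assms fps_conv_radius_sigma])
  from sums_eval_fps[OF this] show ?thesis
    using sums_Suc_iff[of "\<lambda>n. fps_nth (sigma_fps k) n * q ^ n" "eval_fps (sigma_fps k) q"]
    by (simp add: sigma_fps_def)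
qed

lemma qexp_E2: "qexp (1 - fps_const 24 * sigma_fps 1) E2"
  and qexp_E4: "qexp (1 + fps_const 240 * sigma_fps 3) E4"
proof -
  have *: "qexp (sigma_fps k) (\<lambda>z. \<Sum>n. of_nat (divisor_sigma k (Suc n)) * nome z ^ Suc n)" for k
    using fps_conv_radius_sigma sums_sigma[OF norm_nome_less_1]
    by (auto simp: qexp_def sums_iff)
  show "qexp (1 - fps_const 24 * sigma_fps 1) E2"
    using qexp_diff[OF qexp_const[of 1] qexp_cmult[OF *, of 24 1]]
    unfolding E2_def by (simp add: fps_const_1_eq_1)
  show "qexp (1 + fps_const 240 * sigma_fps 3) E4"
    using qexp_add[OF qexp_const[of 1] qexp_cmult[OF *, of 240 3]]
    unfolding E4_def by (simp add: fps_const_1_eq_1)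
qed

text \<open>The coefficient sum over divisors r of n is regrouped by n = m r. Stating it as an
  unordered double sum allows either index to be summed first: r first gives the rows in Lipschitz'
  formula, m first gives the logarithmic derivative of the eta product.\<close>

lemma lambert_has_sum:
  assumes q: "norm q < 1"
  shows "((\<lambda>(m, r). of_nat r ^ k * q ^ (m * r)) has_sum eval_fps (sigma_fps k) q) ({1..} \<times> {1..})"
proof -
  define f where "f = (\<lambda>(n, r::nat). of_nat r ^ k * q ^ n)"
  have in_iff: "finite {r. r dvd n}" if "n \<in> {1..}" for n :: nat
    using that by auto
  have norm_sum: "(\<Sum>r | r dvd n. norm (f (n, r))) = real (divisor_sigma k n) * norm q ^ n" for n :: nat
    by (simp add: f_def divisor_sigma_def norm_mult norm_power sum_distrib_right)
  have "summable (\<lambda>n. norm (of_nat (divisor_sigma k (Suc n)) * of_real (norm q) ^ Suc n :: complex))"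
  proof -
    have "ereal (norm (of_real (norm q)::complex)) < fps_conv_radius (sigma_fps k)"
      by (rule ereal_less_if_less_1[OF _ fps_conv_radius_sigma]) (use q in simp)
    from norm_summable_fps[OF this]
    have "summable (\<lambda>n. norm (fps_nth (sigma_fps k) n * of_real (norm q) ^ n :: complex))" .
    then show ?thesis
      by (subst (asm) summable_Suc_iff[symmetric]) (simp add: sigma_fps_def)
  qed
  then have sm: "summable (\<lambda>n. real (divisor_sigma k (Suc n)) * norm q ^ Suc n)"
    by (simp add: norm_mult norm_power)
  then have "(\<lambda>n. real (divisor_sigma k (Suc n)) * norm q ^ Suc n) summable_on UNIV"
    by (intro summable_nonneg_imp_summable_on) auto
  then have s1: "(\<lambda>n. real (divisor_sigma k n) * norm q ^ n) summable_on {1..}"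
    by (subst (asm) summable_on_reindex_bij_witness[where j = Suc and i = "\<lambda>n. n - 1" and T = "{1..}"
          and h = "\<lambda>n. real (divisor_sigma k n) * norm q ^ n"]) auto
  have "(\<lambda>n. \<bar>\<Sum>\<^sub>\<infinity>r\<in>{r. r dvd n}. norm (f (n, r))\<bar>) summable_on {1..}"
    using s1 by (rule summable_on_cong[THEN iffD1, rotated]) (simp add: infsum_finite in_iff norm_sum)
  then have "(\<lambda>x. norm (f x)) summable_on (SIGMA n:{1..}. {r. r dvd n})"
    unfolding Infinite_Sum.abs_summable_on_Sigma_iff by (simp add: summable_on_finite in_iff)
  then have sf: "f summable_on (SIGMA n:{1..}. {r. r dvd n})"
    by (rule Infinite_Sum.abs_summable_summable)
  have "((\<lambda>n. of_nat (divisor_sigma k (Suc n)) * q ^ Suc n) has_sum eval_fps (sigma_fps k) q) UNIV"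
    by (rule norm_summable_imp_has_sum[OF _ sums_sigma[OF q]])
       (use sm in \<open>simp add: norm_mult norm_power\<close>)
  then have "((\<lambda>n. of_nat (divisor_sigma k n) * q ^ n) has_sum eval_fps (sigma_fps k) q) {1..}"
    by (subst (asm) has_sum_reindex_bij_witness[where j = Suc and i = "\<lambda>n. n - 1" and T = "{1..}"
          and h = "\<lambda>n. of_nat (divisor_sigma k n) * q ^ n" and s' = "eval_fps (sigma_fps k) q"]) auto
  then have "(f has_sum eval_fps (sigma_fps k) q) (SIGMA n:{1..}. {r. r dvd n})"
    by (intro has_sum_SigmaI[OF _ _ sf])
       (auto simp: f_def divisor_sigma_def sum_distrib_right in_iff intro!: has_sum_finiteI)
  then show ?thesis
    by (rule has_sum_reindex_bij_witness[where i = "\<lambda>(m, r). (m * r, r)" and j = "\<lambda>(n, r). (n div r, r)",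
          THEN iffD1, rotated -1])
       (auto simp: f_def dvd_div_mult_self intro!: Suc_leI Nat.gr0I)
qed

section \<open>Partial fractions and Lipschitz' formula\<close>

lemma uhp_not_Ints: "w \<in> uhp \<Longrightarrow> w \<notin> \<int>"
  by (auto elim!: Ints_cases)

lemma DERIV_unique_ev:
  assumes "(f has_field_derivative D) (at z)" "(g has_field_derivative E) (at z)"
    "\<forall>\<^sub>F w in nhds z. f w = g w"
  shows "D = E"
  using DERIV_cong_ev[OF refl assms(3) refl] assms(1,2) DERIV_unique by blast

text \<open>Differentiation of the reflection formula Gamma z * Gamma (1 - z) = pi / sin (pi
  z).\<close>

lemma Digamma_reflection:
  fixes z :: complex
  assumes "z \<notin> \<int>"
  shows "Digamma (1 - z) - Digamma z = of_real pi * cot (of_real pi * z)"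
proof -
  have nz: "z \<notin> \<int>\<^sub>\<le>\<^sub>0" "1 - z \<notin> \<int>\<^sub>\<le>\<^sub>0"
    using assms nonpos_Ints_subset_Ints Ints_diff[of 1 "1 - z"] by auto
  have sn: "sin (of_real pi * z) \<noteq> 0"
    using assms by (auto simp: sin_eq_0 mult_ac)
  have "((\<lambda>w. Gamma w * Gamma (1 - w)) has_field_derivative
          Gamma z * Gamma (1 - z) * (Digamma z - Digamma (1 - z))) (at z)"
    using nz by (auto intro!: derivative_eq_intros simp: algebra_simps)
  moreover have "((\<lambda>w. of_real pi / sin (of_real pi * w)) has_field_derivative
          - (of_real pi)\<^sup>2 * cos (of_real pi * z) / (sin (of_real pi * z))\<^sup>2) (at z)"
    using sn by (auto intro!: derivative_eq_intros simp: power2_eq_square)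
  ultimately have "Gamma z * Gamma (1 - z) * (Digamma z - Digamma (1 - z)) =
      - (of_real pi)\<^sup>2 * cos (of_real pi * z) / (sin (of_real pi * z))\<^sup>2"
    unfolding Gamma_reflection_complex by (rule DERIV_unique)
  then have "of_real pi / sin (of_real pi * z) * (Digamma z - Digamma (1 - z)) =
      of_real pi / sin (of_real pi * z) * (- of_real pi * cot (of_real pi * z))"
    unfolding Gamma_reflection_complex by (simp add: cot_def power2_eq_square field_simps)
  then have "Digamma z - Digamma (1 - z) = - of_real pi * cot (of_real pi * z)"
    by (subst (asm) mult_cancel_left) (use sn in auto)
  then show ?thesis by (simp add: algebra_simps)
qed

lemma cot_nome:
  assumes "nome z \<noteq> 1"
  shows "cot (of_real pi * z) = \<i> * (nome z + 1) / (nome z - 1)"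
proof -
  define e where "e = exp (\<i> * (of_real pi * z))"
  have e: "e \<noteq> 0" "nome z = e * e"
    by (auto simp: e_def nome_def exp_add [symmetric] mult_ac algebra_simps)
  have c: "cos (of_real pi * z) = (e + inverse e) / 2"
    unfolding cos_exp_eq e_def exp_minus ..
  have s: "sin (of_real pi * z) = (e - inverse e) / (2 * \<i>)"
    unfolding sin_exp_eq e_def exp_minus ..
  have e1: "e * e \<noteq> 1" using assms e by simp
  have "cot (of_real pi * z) = \<i> * ((e + inverse e) / (e - inverse e))"
    unfolding cot_def c s by (simp add: divide_simps)
  also have "(e + inverse e) / (e - inverse e) = (e * (e + inverse e)) / (e * (e - inverse e))"
    using e(1) by simp
  also have "\<dots> = (nome z + 1) / (nome z - 1)"
    using e by (simp add: algebra_simps)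
  finally show ?thesis by simp
qed

lemma Digamma_reflection_fps:
  assumes "w \<in> uhp"
  shows "Digamma (1 - w) - Digamma w =
     - of_real pi * \<i> - 2 * of_real pi * \<i> * (\<Sum>r. nome w ^ Suc r)"
proof -
  have n: "norm (nome w) < 1" by (rule norm_nome_less_1[OF assms])
  then have n1: "nome w \<noteq> 1" by auto
  have hS: "(\<Sum>r. nome w ^ Suc r) = nome w / (1 - nome w)"
    using suminf_geometric[OF n] suminf_mult[OF summable_geometric[OF n], of "nome w"] by simp
  show ?thesis
    unfolding Digamma_reflection[OF uhp_not_Ints[OF assms]] cot_nome[OF n1] hS
    using n1 by (simp add: divide_simps) (simp add: algebra_simps)
qed

text \<open>The series of r^k q^r over r \<ge> 1, that is (q d/dq)^k applied to q / (1 - q). The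
  constant term is set to 0 explicitly because 0 ^ 0 = 1 would enter for k = 0.\<close>

definition power_fps :: "nat \<Rightarrow> complex fps" where
  "power_fps k = Abs_fps (\<lambda>r. if r = 0 then 0 else of_nat r ^ k)"

lemma fps_conv_radius_power_fps: "fps_conv_radius (power_fps k) \<ge> 1"
  unfolding fps_conv_radius_def
proof (rule conv_radius_geI_ex')
  fix r :: real assume r: "0 < r" "ereal r < 1"
  show "summable (\<lambda>n. fps_nth (power_fps k) n * of_real r ^ n)"
    by (rule summable_comparison_test[OF _ summable_power_times_geometric[of r k]])
       (use r in \<open>auto simp: power_fps_def norm_mult norm_power\<close>)
qed

lemma qexp_power_fps_derivative:
  assumes "qexp (power_fps k) f" "w \<in> uhp"
  shows "(f has_field_derivative 2 * of_real pi * \<i> * eval_fps (power_fps (Suc k)) (nome w)) (at w)"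
proof -
  have "fps_X * fps_deriv (power_fps k) = power_fps (Suc k)"
    by (rule fps_ext) (auto simp: power_fps_def)
  with qexp_theta[OF assms(1)] have "theta_op f w = eval_fps (power_fps (Suc k)) (nome w)"
    using assms(2) by (simp add: qexp_def)
  then have "deriv f w = 2 * of_real pi * \<i> * eval_fps (power_fps (Suc k)) (nome w)"
    by (simp add: theta_op_def field_simps)
  moreover have "(f has_field_derivative deriv f w) (at w)"
    by (rule holomorphic_derivI[OF qexp_holomorphic[OF assms(1)] open_uhp assms(2)])
  ultimately show ?thesis by simp
qed

lemma qexp_power_fps: "qexp (power_fps k) (\<lambda>w. eval_fps (power_fps k) (nome w))"
  using fps_conv_radius_power_fps by (simp add: qexp_def)

text \<open>The q-expansion of pi cot (pi w), differentiated repeatedly: each step brings a sign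
  from the argument 1 - w on the left, and a factor 2 pi i with one more power of r on the
  right.\<close>

lemma Polygamma_reflection_fps:
  assumes "w \<in> uhp"
  shows "Polygamma (Suc n) (1 - w) * (-1) ^ Suc n - Polygamma (Suc n) w =
     - ((2 * of_real pi * \<i>) ^ Suc (Suc n)) * eval_fps (power_fps (Suc n)) (nome w)"
  using assms
proof (induction n arbitrary: w)
  case 0
  have nz: "w \<notin> \<int>\<^sub>\<le>\<^sub>0" "1 - w \<notin> \<int>\<^sub>\<le>\<^sub>0"
    using uhp_not_Ints[OF 0] nonpos_Ints_subset_Ints Ints_diff[of 1 "1 - w"] by auto
  have eq: "(\<Sum>r. nome w ^ Suc r) = eval_fps (power_fps 0) (nome w)" if "w \<in> uhp" for w
  proof -
    have "(\<lambda>n. fps_nth (power_fps 0) n * nome w ^ n) sums eval_fps (power_fps 0) (nome w)"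
      by (rule qexp_sums[OF qexp_power_fps that])
    then have "(\<lambda>r. nome w ^ Suc r) sums eval_fps (power_fps 0) (nome w)"
      using sums_Suc_iff[of "\<lambda>n. fps_nth (power_fps 0) n * nome w ^ n" "eval_fps (power_fps 0) (nome w)"]
      by (simp add: power_fps_def)
    then show ?thesis by (simp add: sums_iff)
  qed
  have "((\<lambda>w. Digamma (1 - w) - Digamma w) has_field_derivative
          (- Polygamma 1 (1 - w) - Polygamma 1 w)) (at w)"
    using nz by (auto intro!: derivative_eq_intros)
  moreover have "((\<lambda>w. - of_real pi * \<i> - 2 * of_real pi * \<i> * eval_fps (power_fps 0) (nome w)) has_field_derivative
      (- 2 * of_real pi * \<i> * (2 * of_real pi * \<i> * eval_fps (power_fps 1) (nome w)))) (at w)"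
    using DERIV_diff[OF DERIV_const[of "- of_real pi * \<i>"]
        DERIV_cmult[OF qexp_power_fps_derivative[OF qexp_power_fps 0, of 0], of "2 * of_real pi * \<i>"]]
    by simp
  moreover have "\<forall>\<^sub>F w in nhds w. Digamma (1 - w) - Digamma w =
      - of_real pi * \<i> - 2 * of_real pi * \<i> * eval_fps (power_fps 0) (nome w)"
    using eventually_nhds_in_open[OF open_uhp 0]
    by eventually_elim (simp add: Digamma_reflection_fps eq[unfolded power_Suc])
  ultimately have "- Polygamma 1 (1 - w) - Polygamma 1 w =
      - 2 * of_real pi * \<i> * (2 * of_real pi * \<i> * eval_fps (power_fps 1) (nome w))"
    by (rule DERIV_unique_ev)
  then show ?case by (simp add: power2_eq_square)
next
  case (Suc n)
  have nz: "w \<notin> \<int>\<^sub>\<le>\<^sub>0" "1 - w \<notin> \<int>\<^sub>\<le>\<^sub>0"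
    using uhp_not_Ints[OF Suc.prems] nonpos_Ints_subset_Ints Ints_diff[of 1 "1 - w"] by auto
  have "((\<lambda>w. Polygamma (Suc n) (1 - w) * (-1) ^ Suc n - Polygamma (Suc n) w) has_field_derivative
          (Polygamma (Suc (Suc n)) (1 - w) * (-1) ^ Suc (Suc n) - Polygamma (Suc (Suc n)) w)) (at w)"
    using nz by (auto intro!: derivative_eq_intros)
  moreover have "((\<lambda>w. - ((2 * of_real pi * \<i>) ^ Suc (Suc n)) * eval_fps (power_fps (Suc n)) (nome w)) has_field_derivative
      (- ((2 * of_real pi * \<i>) ^ Suc (Suc n)) * (2 * of_real pi * \<i> * eval_fps (power_fps (Suc (Suc n))) (nome w)))) (at w)"
    by (rule DERIV_cmult[OF qexp_power_fps_derivative[OF qexp_power_fps Suc.prems, of "Suc n"]])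
  moreover have "\<forall>\<^sub>F w in nhds w. Polygamma (Suc n) (1 - w) * (-1) ^ Suc n - Polygamma (Suc n) w =
      - ((2 * of_real pi * \<i>) ^ Suc (Suc n)) * eval_fps (power_fps (Suc n)) (nome w)"
    using eventually_nhds_in_open[OF open_uhp Suc.prems]
    by eventually_elim (rule Suc.IH)
  ultimately have "Polygamma (Suc (Suc n)) (1 - w) * (-1) ^ Suc (Suc n) - Polygamma (Suc (Suc n)) w =
      - ((2 * of_real pi * \<i>) ^ Suc (Suc n)) * (2 * of_real pi * \<i> * eval_fps (power_fps (Suc (Suc n))) (nome w))"
    by (rule DERIV_unique_ev)
  then show ?case
    unfolding power_Suc2[of "2 * of_real pi * \<i>" "Suc (Suc n)"]
    by (simp only: mult.assoc mult_minus_left)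
qed

text \<open>Up to a factorial, the polygamma values at w and at 1 - w are the sums of (w + m)^(-n)
  over m \<ge> 0 and over m < 0; for even n their signs agree. Their sum is therefore given by the
  reflection formula, and the term m = 0 is moved to the right.\<close>

lemma lipschitz_sums:
  assumes w: "w \<in> uhp" and n: "even n" "n > 0"
  shows "(\<lambda>m. 1 / (w + of_nat (Suc m)) ^ n + 1 / (w - of_nat (Suc m)) ^ n) sums
     ((2 * of_real pi * \<i>) ^ n / fact (n - 1) * eval_fps (power_fps (n - 1)) (nome w) - 1 / w ^ n)"
proof -
  obtain k where k: "n = Suc (Suc k)" "even k" using n
    by (metis even_Suc gr0_conv_Suc odd_pos)
  have sgn: "(-1 :: complex) ^ Suc (Suc (Suc k)) = -1" "(-1 :: complex) ^ Suc (Suc k) = 1"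
            "(-1 :: complex) ^ Suc k = -1" using k by auto
  have wz: "w \<noteq> 0" "1 - w \<noteq> 0" using w by (auto simp: complex_eq_iff)
  have s1: "(\<lambda>m. inverse ((w + of_nat m) ^ n)) sums (Polygamma (Suc k) w / fact (Suc k))"
  proof -
    have "Polygamma (Suc k) w = fact (Suc k) * (\<Sum>m. inverse ((w + of_nat m) ^ n))"
      by (simp add: Polygamma_def sgn k(1) del: fact_Suc power_Suc)
    then show ?thesis
      using Polygamma_converges'[OF wz(1), of n] k(1) by (simp add: sums_iff del: fact_Suc power_Suc)
  qed
  have s2: "(\<lambda>m. inverse ((1 - w + of_nat m) ^ n)) sums (Polygamma (Suc k) (1 - w) / fact (Suc k))"
  proof -
    have "Polygamma (Suc k) (1 - w) = fact (Suc k) * (\<Sum>m. inverse ((1 - w + of_nat m) ^ n))"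
      by (simp add: Polygamma_def sgn k(1) del: fact_Suc power_Suc)
    then show ?thesis
      using Polygamma_converges'[OF wz(2), of n] k(1) by (simp add: sums_iff del: fact_Suc power_Suc)
  qed
  have s1': "(\<lambda>m. inverse ((w + of_nat (Suc m)) ^ n)) sums (Polygamma (Suc k) w / fact (Suc k) - 1 / w ^ n)"
    using sums_Suc_iff[of "\<lambda>m. inverse ((w + of_nat m) ^ n)"  "Polygamma (Suc k) w / fact (Suc k) - 1 / w ^ n"] s1
    by (simp add: inverse_eq_divide)
  have flip: "inverse ((1 - w + of_nat m) ^ n) = 1 / (w - of_nat (Suc m)) ^ n" for m
  proof -
    have "(1 - w + of_nat m) ^ n = (- (w - of_nat (Suc m))) ^ n" by (simp add: algebra_simps)
    also have "\<dots> = (w - of_nat (Suc m)) ^ n" using n by (simp only: power_minus_even)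
    finally show ?thesis by (simp add: inverse_eq_divide)
  qed
  have "Polygamma (Suc k) w + Polygamma (Suc k) (1 - w) =
      (2 * of_real pi * \<i>) ^ n * eval_fps (power_fps (n - 1)) (nome w)"
  proof -
    have *: "- x - y = - c \<Longrightarrow> y + x = c" for x y c :: complex
      by algebra
    show ?thesis
      using Polygamma_reflection_fps[OF w, of k] unfolding sgn
      by (intro *) (simp add: k(1) del: power_Suc)
  qed
  then have "Polygamma (Suc k) w / fact (Suc k) + Polygamma (Suc k) (1 - w) / fact (Suc k) =
      (2 * of_real pi * \<i>) ^ n / fact (n - 1) * eval_fps (power_fps (n - 1)) (nome w)"
    by (simp add: k(1) add_divide_distrib [symmetric] del: fact_Suc)
  moreover have "(\<lambda>m. 1 / (w + of_nat (Suc m)) ^ n + 1 / (w - of_nat (Suc m)) ^ n) sums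
      (Polygamma (Suc k) w / fact (Suc k) - 1 / w ^ n + Polygamma (Suc k) (1 - w) / fact (Suc k))"
    using sums_add[OF s1' s2[unfolded flip]] by (simp only: inverse_eq_divide)
  ultimately show ?thesis
    by (simp only: diff_add_eq)
qed

text \<open>The Digamma series for the reflection formula pairs 1/(x + k) with 1/(x - (k + 1)).
  Adding the telescoping series of 1/(x + k + 1) - 1/(x + k), whose sum is -1/x, makes the pairs
  symmetric.\<close>

lemma cot_partial_fractions_sums:
  fixes x :: complex
  assumes "x \<notin> \<int>"
  shows "(\<lambda>n. 2 * x / (x\<^sup>2 - of_nat (Suc n) ^ 2)) sums (of_real pi * cot (of_real pi * x) - 1 / x)"
proof -
  have xz: "x \<noteq> 0" "1 - x \<noteq> 0" using assms by auto
  have nz: "x + of_nat n \<noteq> 0" "x - of_nat n \<noteq> 0" for n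
    using assms Ints_of_nat[of n, where 'a = complex] by (metis Ints_minus add.inverse_unique add.commute, metis eq_iff_diff_eq_0)
  have "(\<lambda>k. (inverse (of_nat (Suc k)) - inverse (1 - x + of_nat k)) -
             (inverse (of_nat (Suc k)) - inverse (x + of_nat k))) sums
          ((Digamma (1 - x) + euler_mascheroni) - (Digamma x + euler_mascheroni))"
    unfolding Digamma_def using summable_Digamma[OF xz(1)] summable_Digamma[OF xz(2)]
    by (intro sums_diff) (auto simp: sums_iff)
  then have A: "(\<lambda>k. inverse (x + of_nat k) - inverse (1 - x + of_nat k)) sums (of_real pi * cot (of_real pi * x))"
    using Digamma_reflection[OF assms] by (simp add: algebra_simps)
  have B: "(\<lambda>k. inverse (x + of_nat (Suc k)) - inverse (x + of_nat k)) sums (0 - inverse (x + of_nat 0))"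
    by (intro telescope_sums filterlim_compose[OF tendsto_inverse_0]
              tendsto_add_filterlim_at_infinity[OF tendsto_const] tendsto_of_nat)
  have "2 * x / (x\<^sup>2 - of_nat (Suc k) ^ 2) = (inverse (x + of_nat k) - inverse (1 - x + of_nat k)) +
     (inverse (x + of_nat (Suc k)) - inverse (x + of_nat k))" for k
  proof -
    have "1 - x + of_nat k = - (x - of_nat (Suc k))" by simp
    then have "(inverse (x + of_nat k) - inverse (1 - x + of_nat k)) +
     (inverse (x + of_nat (Suc k)) - inverse (x + of_nat k)) = inverse (x + of_nat (Suc k)) + inverse (x - of_nat (Suc k))"
      by (simp only: inverse_minus_eq) simp
    also have "\<dots> = 2 * x / ((x + of_nat (Suc k)) * (x - of_nat (Suc k)))"
      using nz[of "Suc k"] by (simp add: field_simps del: of_nat_Suc)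
    finally show ?thesis by (simp add: power2_eq_square algebra_simps del: of_nat_Suc)
  qed
  with sums_add[OF A B] show ?thesis by (simp add: inverse_eq_divide del: of_nat_Suc)
qed

section \<open>Interchanging double series\<close>

text \<open>A product majorant makes the family absolutely summable over pairs, so both iterated
  sums equal its unordered sum.\<close>

lemma double_series_swap:
  fixes D :: "nat \<Rightarrow> nat \<Rightarrow> complex" and g :: "nat \<Rightarrow> real"
  assumes D: "\<And>n m. norm (D n m) \<le> g n * g m" and g: "summable g" "\<And>n. g n \<ge> 0"
  shows "\<And>n. summable (D n)" "\<And>m. summable (\<lambda>n. D n m)"
    "\<exists>S. (\<lambda>n. \<Sum>m. D n m) sums S \<and> (\<lambda>m. \<Sum>n. D n m) sums S"
proof -
  have sn: "summable (\<lambda>m. norm (D n m))" for n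
    by (rule summable_comparison_test[OF _ summable_mult[OF g(1), of "g n"]]) (use D in auto)
  have sm: "summable (\<lambda>n. norm (D n m))" for m
    by (rule summable_comparison_test[OF _ summable_mult2[OF g(1), of "g m"]]) (use D in auto)
  show sn': "summable (D n)" for n using sn by (rule summable_norm_cancel)
  show sm': "summable (\<lambda>n. D n m)" for m using sm by (rule summable_norm_cancel)
  have gs: "g summable_on UNIV"
    using g by (rule summable_nonneg_imp_summable_on)
  have "(\<lambda>(n, m). g n * g m) summable_on UNIV \<times> UNIV"
  proof (rule summable_on_SigmaI)
    fix n
    show "((\<lambda>m. case (n, m) of (n, m) \<Rightarrow> g n * g m) has_sum g n * infsum g UNIV) UNIV"
      using has_sum_cmult_right[OF has_sum_infsum[OF gs], of "g n"] by simp
  qed (use g gs in \<open>auto intro: summable_on_cmult_left\<close>)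
  then have "(\<lambda>x. norm (case x of (n, m) \<Rightarrow> D n m)) summable_on UNIV \<times> UNIV"
    by (rule summable_on_comparison_test) (use D in auto)
  then have DS: "(\<lambda>(n, m). D n m) summable_on UNIV \<times> UNIV"
    by (rule Infinite_Sum.abs_summable_summable)
  then obtain S where S: "((\<lambda>(n, m). D n m) has_sum S) (UNIV \<times> UNIV)"
    by (auto simp: summable_on_def)
  have "((\<lambda>n. \<Sum>m. D n m) has_sum S) UNIV"
  proof (rule has_sum_SigmaD[OF S])
    show "((\<lambda>m. case (n, m) of (n, m) \<Rightarrow> D n m) has_sum (\<Sum>m. D n m)) UNIV" for n
      using norm_summable_imp_has_sum[OF sn summable_sums[OF sn']] by simp
  qed
  moreover have "((\<lambda>m. \<Sum>n. D n m) has_sum S) UNIV"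
  proof (rule has_sum_SigmaD)
    show "((\<lambda>(m, n). D n m) has_sum S) (UNIV \<times> UNIV)"
      using S by (subst (asm) has_sum_swap) simp
    show "((\<lambda>n. case (m, n) of (m, n) \<Rightarrow> D n m) has_sum (\<Sum>n. D n m)) UNIV" for m
      using norm_summable_imp_has_sum[OF sm summable_sums[OF sm']] by simp
  qed
  ultimately show "\<exists>S. (\<lambda>n. \<Sum>m. D n m) sums S \<and> (\<lambda>m. \<Sum>n. D n m) sums S"
    by (auto dest: has_sum_imp_sums)
qed

text \<open>With N the norm on the right, the imaginary part gives t \<le> N / Im z, and the
  triangle inequality gives |x| \<le> N + t |z|. The constant K in the proof is the factor of N in
  the sum of both bounds.\<close>

lemma lattice_lower_bound:
  assumes z: "z \<in> uhp"
  obtains c :: real where "c > 0" "\<And>t x :: real. t \<ge> 0 \<Longrightarrow> c * (t + \<bar>x\<bar>) \<le> norm (of_real t * z + of_real x)"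
proof -
  define y where "y = Im z"
  have y: "y > 0" using z by (simp add: y_def)
  define K where "K = 1 + (norm z + 1) / y"
  have K: "K > 0" using y by (auto simp: K_def intro!: add_pos_nonneg)
  show ?thesis
  proof (rule that[of "1 / K"])
    fix t x :: real assume t: "t \<ge> 0"
    let ?N = "norm (of_real t * z + of_real x)"
    have "t * y \<le> ?N"
      using abs_Im_le_cmod[of "of_real t * z + of_real x"] t by (simp add: y_def)
    then have t_le: "t \<le> ?N / y" using y by (simp add: field_simps)
    have "\<bar>x\<bar> = norm ((of_real t * z + of_real x) - of_real t * z)" by simp
    also have "\<dots> \<le> ?N + t * norm z"
      using norm_triangle_ineq4[of "of_real t * z + of_real x" "of_real t * z"] t
      by (simp add: norm_mult)
    also have "\<dots> \<le> ?N + ?N / y * norm z"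
      using t_le by (intro add_left_mono mult_right_mono) auto
    also have "?N + ?N / y * norm z = K * ?N - ?N / y"
      using y by (simp add: K_def field_simps)
    finally have "t + \<bar>x\<bar> \<le> K * ?N"
      using t_le by linarith
    then show "1 / K * (t + \<bar>x\<bar>) \<le> ?N" using K by (simp add: field_simps)
  qed (use K in simp)
qed

lemma summable_Suc_powr: "summable (\<lambda>n. real (Suc n) powr (- 3 / 2))"
  using summable_real_powr_iff[of "- 3 / 2"] summable_Suc_iff[of "\<lambda>n. real n powr (- 3 / 2)"] by simp

text \<open>From x y \<le> (x + y)^2, raised to the power 3/2. It turns cubic decay in the sum of
  two indices into the product majorant that \<open>double_series_swap\<close> asks for.\<close>

lemma inverse_cube_le:
  assumes "x > 0" "y > 0"
  shows "1 / (x + y) ^ 3 \<le> x powr (- 3 / 2) * y powr (- 3 / 2 :: real)"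
proof -
  have "x * y \<le> (x + y)\<^sup>2" using assms by (simp add: power2_eq_square algebra_simps)
  then have "(x * y) powr (3 / 2) \<le> ((x + y)\<^sup>2) powr (3 / 2)"
    using assms by (intro powr_mono2) auto
  also have "((x + y)\<^sup>2) powr (3 / 2) = (x + y) ^ 3"
  proof -
    have "((x + y)\<^sup>2) powr (3 / 2) = ((x + y) powr 2) powr (3 / 2)"
      using assms by (simp add: powr_numeral)
    also have "\<dots> = (x + y) powr 3" by (simp add: powr_powr)
    also have "\<dots> = (x + y) ^ 3" using assms by (simp add: powr_numeral)
    finally show ?thesis .
  qed
  finally have "1 / (x + y) ^ 3 \<le> 1 / (x * y) powr (3 / 2)"
    using assms by (intro divide_left_mono) auto
  also have "\<dots> = x powr (- 3 / 2) * y powr (- 3 / 2)"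
    using assms by (simp add: powr_mult powr_minus_divide)
  finally show ?thesis .
qed

section \<open>The inversion formula for \<open>E2\<close>\<close>

lemma uhp_scale: "z \<in> uhp \<Longrightarrow> of_nat (Suc n) * z \<in> uhp"
  by simp

lemma power_fps_lambert:
  assumes "z \<in> uhp"
  shows "(\<lambda>n. eval_fps (power_fps k) (nome (of_nat (Suc n) * z))) sums eval_fps (sigma_fps k) (nome z)"
proof -
  define q where "q = nome z"
  have q: "norm q < 1" using norm_nome_less_1[OF assms] by (simp add: q_def)
  have inner: "((\<lambda>r. of_nat r ^ k * q ^ (m * r)) has_sum eval_fps (power_fps k) (q ^ m)) {1..}"
    if m: "m \<in> {1..}" for m
  proof -
    have qm: "norm (q ^ m) < 1" using q m by (simp add: norm_power power_less_one_iff)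
    have "(\<lambda>r. fps_nth (power_fps k) r * (q ^ m) ^ r) sums eval_fps (power_fps k) (q ^ m)"
         "summable (\<lambda>r. norm (fps_nth (power_fps k) r * (q ^ m) ^ r))"
      using ereal_less_if_less_1[OF qm fps_conv_radius_power_fps]
      by (auto intro: sums_eval_fps norm_summable_fps)
    then have "((\<lambda>r. fps_nth (power_fps k) r * (q ^ m) ^ r) has_sum eval_fps (power_fps k) (q ^ m)) UNIV"
      by (intro norm_summable_imp_has_sum)
    then show ?thesis
      by (rule has_sum_cong_neutral[THEN iffD1, rotated -1]) (auto simp: power_fps_def power_mult)
  qed
  have "((\<lambda>m. eval_fps (power_fps k) (q ^ m)) has_sum eval_fps (sigma_fps k) q) {1..}"
    by (rule has_sum_SigmaD[OF lambert_has_sum[OF q]]) (use inner in auto)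
  then have "((\<lambda>n. eval_fps (power_fps k) (q ^ Suc n)) has_sum eval_fps (sigma_fps k) q) UNIV"
    by (rule has_sum_reindex_bij_witness[where i = Suc and j = "\<lambda>n. n - 1", THEN iffD1, rotated -1]) auto
  then show ?thesis
    unfolding nome_mult_nat q_def by (rule has_sum_imp_sums)
qed

text \<open>The two lattice points (n + 1, +-(m + 1)) in the Eisenstein sum of weight k. Points with
  a zero coordinate are left out; they account for the zeta terms below.\<close>

definition quad_term :: "nat \<Rightarrow> complex \<Rightarrow> nat \<Rightarrow> nat \<Rightarrow> complex" where
  "quad_term k z n m = 1 / (of_nat (Suc n) * z + of_nat (Suc m)) ^ k
                     + 1 / (of_nat (Suc n) * z - of_nat (Suc m)) ^ k"

lemma quad_term_sums:
  assumes "z \<in> uhp" "even k" "k > 0"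
  shows "(\<lambda>m. quad_term k z n m) sums
    ((2 * of_real pi * \<i>) ^ k / fact (k - 1) * eval_fps (power_fps (k - 1)) (nome (of_nat (Suc n) * z))
      - 1 / (of_nat (Suc n) * z) ^ k)"
  unfolding quad_term_def by (rule lipschitz_sums[OF uhp_scale[OF assms(1)] assms(2,3)])

lemma zeta_sums:
  assumes "k \<ge> 2"
  obtains \<zeta> :: complex where "(\<lambda>n. 1 / of_nat (Suc n) ^ k) sums \<zeta>"
proof -
  have "summable (\<lambda>n. 1 / real (Suc n) ^ k)"
    using inverse_power_summable[OF assms, where 'a = real] 
      summable_Suc_iff[of "\<lambda>n. inverse (real n ^ k)"] by (simp add: inverse_eq_divide)
  then have "summable (\<lambda>n. of_real (1 / real (Suc n) ^ k) :: complex)"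
    by (rule summable_of_real)
  then show ?thesis using that by (auto simp: summable_def)
qed

lemma quad_term_rows:
  assumes "z \<in> uhp" "even k" "k > 0" and \<zeta>: "(\<lambda>n. 1 / of_nat (Suc n) ^ k) sums \<zeta>"
  shows "(\<lambda>n. \<Sum>m. quad_term k z n m) sums
    ((2 * of_real pi * \<i>) ^ k / fact (k - 1) * eval_fps (sigma_fps (k - 1)) (nome z) - \<zeta> / z ^ k)"
proof -
  have "(\<lambda>n. (2 * of_real pi * \<i>) ^ k / fact (k - 1) * eval_fps (power_fps (k - 1)) (nome (of_nat (Suc n) * z))
      - 1 / of_nat (Suc n) ^ k / z ^ k) sums
    ((2 * of_real pi * \<i>) ^ k / fact (k - 1) * eval_fps (sigma_fps (k - 1)) (nome z) - \<zeta> / z ^ k)"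
    by (intro sums_diff sums_mult sums_divide power_fps_lambert assms)
  moreover have "(\<Sum>m. quad_term k z n m) = (2 * of_real pi * \<i>) ^ k / fact (k - 1) * eval_fps (power_fps (k - 1)) (nome (of_nat (Suc n) * z))
      - 1 / of_nat (Suc n) ^ k / z ^ k" for n
    using quad_term_sums[OF assms(1-3), of n] by (simp add: sums_iff power_mult_distrib)
  ultimately show ?thesis by simp
qed

text \<open>Under z -> -1/z the two lattice coordinates trade places, so column sums at z are row
  sums at -1/z up to the factor z^k.\<close>

lemma quad_term_inversion:
  assumes "z \<in> uhp" "even k"
  shows "quad_term k (- 1 / z) m n = z ^ k * quad_term k z n m"
proof -
  have z: "z \<noteq> 0" using assms by auto
  have eqs: "(of_nat (Suc m) * (- 1 / z) + of_nat (Suc n)) = (of_nat (Suc n) * z - of_nat (Suc m)) / z"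
       "(of_nat (Suc m) * (- 1 / z) - of_nat (Suc n)) = - ((of_nat (Suc n) * z + of_nat (Suc m)) / z)"
    using z by (simp_all add: field_simps)
  show ?thesis
    unfolding quad_term_def eqs power_minus_even[OF assms(2)] power_divide
    by (simp add: algebra_simps)
qed

lemma inversion_uhp: "z \<in> uhp \<Longrightarrow> - 1 / z \<in> uhp"
  by (auto simp: Im_divide power2_eq_square complex_eq_iff intro!: divide_pos_pos add_nonneg_pos)

lemma quad_term_columns:
  assumes "z \<in> uhp" "even k" "k > 0" and \<zeta>: "(\<lambda>n. 1 / of_nat (Suc n) ^ k) sums \<zeta>"
  shows "(\<lambda>m. \<Sum>n. quad_term k z n m) sums
    ((2 * of_real pi * \<i>) ^ k / fact (k - 1) * eval_fps (sigma_fps (k - 1)) (nome (- 1 / z)) / z ^ k - \<zeta>)"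
proof -
  have z: "z \<noteq> 0" using assms by auto
  have "(\<lambda>m. (\<Sum>n. quad_term k (- 1 / z) m n) / z ^ k) sums
    (((2 * of_real pi * \<i>) ^ k / fact (k - 1) * eval_fps (sigma_fps (k - 1)) (nome (- 1 / z)) - \<zeta> / (- 1 / z) ^ k) / z ^ k)"
    by (intro sums_divide quad_term_rows inversion_uhp assms)
  moreover have "(\<Sum>n. quad_term k (- 1 / z) m n) / z ^ k = (\<Sum>n. quad_term k z n m)" for m
  proof -
    have "summable (\<lambda>n. quad_term k (- 1 / z) m n)"
      using quad_term_sums[OF inversion_uhp[OF assms(1)] assms(2,3)] by (auto simp: sums_iff)
    then have "(\<Sum>n. quad_term k (- 1 / z) m n) / z ^ k = (\<Sum>n. quad_term k (- 1 / z) m n / z ^ k)"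
      by (rule suminf_divide[symmetric])
    then show ?thesis
      using z by (simp only: quad_term_inversion[OF assms(1,2)]) simp
  qed
  moreover have "\<zeta> / (- 1 / z) ^ k / z ^ k = \<zeta>"
    using z assms(2) by (simp add: power_divide)
  ultimately show ?thesis by (simp add: diff_divide_distrib)
qed

lemma quad_term_summand_bound:
  assumes "c > 0" "\<And>t x :: real. t \<ge> 0 \<Longrightarrow> c * (t + \<bar>x\<bar>) \<le> norm (of_real t * z + of_real x)"
  shows "norm (quad_term 4 z n m) \<le>
    2 / c ^ 4 * (real (Suc n) powr (- 3 / 2) * real (Suc m) powr (- 3 / 2))"
proof -
  let ?s = "real (Suc n) + real (Suc m)"
  have "norm (1 / (of_nat (Suc n) * z + of_real e * of_nat (Suc m)) ^ 4) \<le> 1 / c ^ 4 * (1 / ?s ^ 3)"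
    if "e = 1 \<or> e = -1" for e :: real
  proof -
    have le: "c * ?s \<le> norm (of_nat (Suc n) * z + of_real e * of_nat (Suc m))"
      using assms(2)[of "real (Suc n)" "e * real (Suc m)"] that by (auto simp: of_real_mult simp del: of_nat_Suc)
    have pos: "0 < c * ?s" using assms(1) by simp
    have "norm (1 / (of_nat (Suc n) * z + of_real e * of_nat (Suc m)) ^ 4) \<le> 1 / (c * ?s) ^ 4"
      unfolding norm_divide norm_power norm_one
      by (intro divide_left_mono power_mono mult_pos_pos zero_less_power less_imp_le[OF pos] pos
                less_le_trans[OF pos le] le zero_le_one)
    also have "\<dots> = 1 / c ^ 4 * (1 / ?s ^ 4)" by (simp add: power_mult_distrib)
    \<comment> \<open>One power of ?s \<ge> 1 is given away so that the cubic estimate serves weight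
      4 as well.\<close>
    also have "\<dots> \<le> 1 / c ^ 4 * (1 / ?s ^ 3)"
      using assms(1) by (intro mult_left_mono divide_left_mono power_increasing) auto
    finally show ?thesis .
  qed
  from this[of 1] this[of "-1"]
  have "norm (quad_term 4 z n m) \<le> 1 / c ^ 4 * (1 / ?s ^ 3) + 1 / c ^ 4 * (1 / ?s ^ 3)"
    unfolding quad_term_def by (intro norm_triangle_le add_mono) (simp_all del: of_nat_Suc)
  also have "\<dots> = 2 / c ^ 4 * (1 / ?s ^ 3)" by simp
  also have "\<dots> \<le> 2 / c ^ 4 * (real (Suc n) powr (- 3 / 2) * real (Suc m) powr (- 3 / 2))"
    using assms(1) by (intro mult_left_mono inverse_cube_le) auto
  finally show ?thesis .
qed

text \<open>In weight 4 the double series converges absolutely, so row sums and column sums agree,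
  and equating their closed forms is the inversion law. The value of \<zeta> stays open here;
  \<open>mform_E4\<close> determines it.\<close>

lemma sigma3_inversion:
  assumes z: "z \<in> uhp" and \<zeta>: "(\<lambda>n. 1 / of_nat (Suc n) ^ 4) sums \<zeta>"
  defines "G \<equiv> \<lambda>z. \<zeta> + (2 * of_real pi * \<i>) ^ 4 / fact 3 * eval_fps (sigma_fps 3) (nome z)"
  shows "G (- 1 / z) = z ^ 4 * G z"
proof -
  have zz: "z \<noteq> 0" using z by auto
  obtain c where c: "c > 0" "\<And>t x :: real. t \<ge> 0 \<Longrightarrow> c * (t + \<bar>x\<bar>) \<le> norm (of_real t * z + of_real x)"
    using lattice_lower_bound[OF z] by metis
  define g where "g = (\<lambda>n. sqrt (2 / c ^ 4) * real (Suc n) powr (- 3 / 2))"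
  have "norm (quad_term 4 z n m) \<le> g n * g m" for n m
  proof -
    have "g n * g m = sqrt (2 / c ^ 4) ^ 2 * (real (Suc n) powr (- 3 / 2) * real (Suc m) powr (- 3 / 2))"
      unfolding g_def power2_eq_square by (simp only: mult_ac)
    also have "sqrt (2 / c ^ 4) ^ 2 = 2 / c ^ 4" using c(1) by (intro real_sqrt_pow2) auto
    finally show ?thesis using quad_term_summand_bound[OF c, of n m] by simp
  qed
  moreover have "summable g" unfolding g_def by (intro summable_mult summable_Suc_powr)
  moreover have "g n \<ge> 0" for n using c(1) by (simp add: g_def)
  ultimately obtain S where S: "(\<lambda>n. \<Sum>m. quad_term 4 z n m) sums S" "(\<lambda>m. \<Sum>n. quad_term 4 z n m) sums S"
    using double_series_swap(3)[of "quad_term 4 z" g] by blast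
  have "S = (2 * of_real pi * \<i>) ^ 4 / fact 3 * eval_fps (sigma_fps 3) (nome z) - \<zeta> / z ^ 4"
    using sums_unique2[OF S(1) quad_term_rows[OF z _ _ \<zeta>]] by simp
  moreover have "S = (2 * of_real pi * \<i>) ^ 4 / fact 3 * eval_fps (sigma_fps 3) (nome (- 1 / z)) / z ^ 4 - \<zeta>"
    using sums_unique2[OF S(2) quad_term_columns[OF z _ _ \<zeta>]] by simp
  ultimately show ?thesis
    using zz unfolding G_def by (simp add: field_simps)
qed


section \<open>The telescoping correction in weight 2\<close>

context
  fixes z :: complex
  assumes z: "z \<in> uhp"
begin

text \<open>With a = m + w or a = m - w, where w = (n + 1) z, its differences in m consist of 1/a -
  1/(a + 1) = 1/(a (a + 1)), which agrees with the term 1/(a + 1)^2 of \<open>quad_term 2\<close> up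
  to an error of third order.\<close>

definition telescope_term :: "nat \<Rightarrow> nat \<Rightarrow> complex" where
  "telescope_term n m = 1 / (of_nat m + of_nat (Suc n) * z) + 1 / (of_nat m - of_nat (Suc n) * z)"

lemma lattice_nonzero:
  "of_nat m + of_nat (Suc n) * z \<noteq> 0" "of_nat m - of_nat (Suc n) * z \<noteq> 0"
proof -
  have "Im (of_nat m + of_nat (Suc n) * z) > 0" "Im (of_nat m - of_nat (Suc n) * z) < 0"
    using z by auto
  then show "of_nat m + of_nat (Suc n) * z \<noteq> 0" "of_nat m - of_nat (Suc n) * z \<noteq> 0"
    by (metis less_irrefl zero_complex.sel(2))+
qed

text \<open>The starting value at m = 0 is 1/w - 1/w = 0, and the terms tend to 0.\<close>

lemma telescope_rows:
  "(\<lambda>m. telescope_term n m - telescope_term n (Suc m)) sums 0"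
proof -
  have "(\<lambda>m. telescope_term n m) \<longlonglongrightarrow> 0 + 0"
    unfolding telescope_term_def
  proof (intro tendsto_add tendsto_divide_0[OF tendsto_const])
    show "filterlim (\<lambda>m. of_nat m + of_nat (Suc n) * z) at_infinity sequentially"
      using tendsto_add_filterlim_at_infinity'[OF tendsto_of_nat tendsto_const] by simp
    show "filterlim (\<lambda>m. of_nat m - of_nat (Suc n) * z) at_infinity sequentially"
      using tendsto_add_filterlim_at_infinity'[OF tendsto_of_nat tendsto_const, of "- (of_nat (Suc n) * z)"] by (simp del: of_nat_Suc)
  qed
  from telescope_sums'[OF this] show ?thesis
    by (simp add: telescope_term_def)
qed

text \<open>Summed over n, the terms are the partial fractions of the cotangent at X = (m + 1)/z,
  which lies in the lower half plane and hence is not an integer.\<close>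

lemma telescope_column_sum:
  "(\<lambda>n. telescope_term n (Suc m)) sums
     (1 / z * (of_real pi * cot (of_real pi * (of_nat (Suc m) / z)) - z / of_nat (Suc m)))"
proof -
  have zz: "z \<noteq> 0" using z by auto
  define X where "X = of_nat (Suc m) / z"
  have "Im X = - (real (Suc m) * Im z / (norm z)\<^sup>2)"
    by (simp add: X_def Im_divide cmod_power2)
  then have "Im X < 0" using z zz by simp
  then have X: "X \<notin> \<int>" by (auto elim!: Ints_cases)
  have "(\<lambda>n. 1 / z * (2 * X / (X\<^sup>2 - of_nat (Suc n) ^ 2))) sums
      (1 / z * (of_real pi * cot (of_real pi * X) - 1 / X))"
    by (intro sums_mult cot_partial_fractions_sums X)
  moreover have "1 / z * (2 * X / (X\<^sup>2 - of_nat (Suc n) ^ 2)) = telescope_term n (Suc m)" for n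
  proof -
    let ?x = "of_nat (Suc m) :: complex" and ?w = "of_nat (Suc n) * z"
    have "telescope_term n (Suc m) = 2 * ?x / ((?x + ?w) * (?x - ?w))"
      using lattice_nonzero[of "Suc m" n] by (simp add: telescope_term_def field_simps del: of_nat_Suc)
    also have "(?x + ?w) * (?x - ?w) = z\<^sup>2 * (X\<^sup>2 - of_nat (Suc n) ^ 2)"
      using zz by (simp add: X_def power2_eq_square field_simps del: of_nat_Suc)
    also have "2 * ?x / \<dots> = 1 / z * (2 * X / (X\<^sup>2 - of_nat (Suc n) ^ 2))"
      using zz by (simp add: X_def power2_eq_square del: of_nat_Suc)
    finally show ?thesis ..
  qed
  ultimately show ?thesis by (simp add: X_def)
qed

text \<open>The columns telescope through values of the cotangent at m/z, which tends to i because
  Im (m/z) tends to minus infinity. So the total is nonzero, unlike the total by rows; this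
  difference is the source of the additional term in \<open>E2_inversion\<close>.\<close>

lemma telescope_columns:
  "(\<lambda>m. \<Sum>n. telescope_term n m - telescope_term n (Suc m)) sums (- of_real pi * \<i> / z)"
    "summable (\<lambda>n. telescope_term n m - telescope_term n (Suc m))"
proof -
  have zz: "z \<noteq> 0" using z by auto
  define \<tau> where "\<tau> m = (if m = 0 then 0 else
     1 / z * (of_real pi * cot (of_real pi * (of_nat m / z)) - z / of_nat m))" for m :: nat
  have \<tau>: "(\<lambda>n. telescope_term n m) sums \<tau> m" for m
  proof (cases m)
    case 0
    then show ?thesis by (simp add: telescope_term_def \<tau>_def)
  next
    case (Suc k)
    then show ?thesis using telescope_column_sum[of k] by (simp add: \<tau>_def del: of_nat_Suc)
  qed
  have d: "(\<lambda>n. telescope_term n m - telescope_term n (Suc m)) sums (\<tau> m - \<tau> (Suc m))" for m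
    by (intro sums_diff \<tau>)
  then show "summable (\<lambda>n. telescope_term n m - telescope_term n (Suc m))"
    by (auto simp: sums_iff)
  define p where "p = nome (- 1 / z)"
  have p: "norm p < 1" using norm_nome_less_1[OF inversion_uhp[OF z]] by (simp add: p_def)
  have cot: "cot (of_real pi * (of_nat m / z)) = - (\<i> * (p ^ m + 1) / (p ^ m - 1))" if "m > 0" for m
  proof -
    have "norm (p ^ m) < 1" using p that by (simp add: norm_power power_less_one_iff)
    then have "p ^ m \<noteq> 1" by auto
    moreover have "nome (of_nat m * (- 1 / z)) = p ^ m" by (simp only: nome_mult_nat p_def)
    ultimately have "cot (of_real pi * (of_nat m * (- 1 / z))) = \<i> * (p ^ m + 1) / (p ^ m - 1)"
      using cot_nome[of "of_nat m * (- 1 / z)"] by simp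
    moreover have "of_real pi * (of_nat m / z) = - (of_real pi * (of_nat m * (- 1 / z)))" by simp
    ultimately show ?thesis by (simp only: cot_minus)
  qed
  have "(\<lambda>m. 1 / z * (of_real pi * (- (\<i> * (p ^ m + 1) / (p ^ m - 1))) - z / of_nat m)) \<longlonglongrightarrow>
      1 / z * (of_real pi * (- (\<i> * (0 + 1) / (0 - 1))) - 0)"
    using p by (intro tendsto_intros LIMSEQ_power_zero tendsto_divide_0[OF tendsto_const] tendsto_of_nat) auto
  then have "(\<lambda>m. 1 / z * (of_real pi * (- (\<i> * (p ^ m + 1) / (p ^ m - 1))) - z / of_nat m)) \<longlonglongrightarrow> of_real pi * \<i> / z"
    by simp
  then have "\<tau> \<longlonglongrightarrow> of_real pi * \<i> / z"
    by (rule Lim_transform_eventually)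
       (use eventually_gt_at_top[of 0] in \<open>eventually_elim, simp add: \<tau>_def cot[unfolded times_divide_eq_right]\<close>)
  from telescope_sums'[OF this] d show "(\<lambda>m. \<Sum>n. telescope_term n m - telescope_term n (Suc m)) sums (- of_real pi * \<i> / z)"
    by (simp add: sums_iff \<tau>_def)
qed

text \<open>The identity 1/(a + 1)^2 - (1/a - 1/(a + 1)) = -1/((a + 1)^2 a) leaves a cubic error.
  The unshifted factor a costs a factor 2, since n + m + 1 is at least half of n + m + 2.\<close>

lemma telescope_error_bound:
  assumes c: "c > 0" "\<And>t x :: real. t \<ge> 0 \<Longrightarrow> c * (t + \<bar>x\<bar>) \<le> norm (of_real t * z + of_real x)"
  shows "norm (quad_term 2 z n m - (telescope_term n m - telescope_term n (Suc m))) \<le>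
    4 / c ^ 3 * (real (Suc n) powr (- 3 / 2) * real (Suc m) powr (- 3 / 2))"
proof -
  let ?s = "real (Suc n) + real (Suc m)" and ?w = "of_nat (Suc n) * z"
  let ?x = "of_nat (Suc m) :: complex" and ?x' = "of_nat m :: complex"
  have pos: "0 < c * ?s" "0 < c * ?s / 2" using c(1) by simp_all
  have lower: "c * (real (Suc n) + real k) \<le> norm (of_nat k + ?w)"
              "c * (real (Suc n) + real k) \<le> norm (of_nat k - ?w)" for k
    using c(2)[of "real (Suc n)" "real k"] c(2)[of "real (Suc n)" "- real k"]
    by (simp_all add: add.commute norm_minus_commute del: of_nat_Suc)
  have half: "c * ?s / 2 \<le> c * (real (Suc n) + real m)" using c(1) by simp
  have est: "norm (- 1 / (a\<^sup>2 * b)) \<le> 2 / c ^ 3 * (1 / ?s ^ 3)"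
    if "c * ?s \<le> norm a" "c * ?s / 2 \<le> norm b" for a b :: complex
  proof -
    have "norm (- 1 / (a\<^sup>2 * b)) \<le> 1 / ((c * ?s)\<^sup>2 * (c * ?s / 2))"
      unfolding norm_divide norm_mult norm_power norm_minus_cancel norm_one
      by (intro divide_left_mono mult_mono power_mono mult_pos_pos zero_less_power zero_le_power
          less_imp_le[OF pos(1)] less_imp_le[OF pos(2)] pos norm_ge_zero
                less_le_trans[OF pos(1) that(1)] less_le_trans[OF pos(2) that(2)] that zero_le_one)
    also have "\<dots> = 2 / c ^ 3 * (1 / ?s ^ 3)" by (simp add: power2_eq_square power3_eq_cube del: of_nat_Suc)
    finally show ?thesis .
  qed
  have id: "1 / (a + 1)\<^sup>2 - (1 / a - 1 / (a + 1)) = - 1 / ((a + 1)\<^sup>2 * a)"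
    if "a \<noteq> 0" "a + 1 \<noteq> 0" for a :: complex
    using that by (simp add: divide_simps power2_eq_square)
  have sq: "(?w + ?x)\<^sup>2 = (?x' + ?w + 1)\<^sup>2" "(?w - ?x)\<^sup>2 = (?x' - ?w + 1)\<^sup>2"
    by (simp_all add: power2_eq_square algebra_simps)
  have S: "?x + ?w = ?x' + ?w + 1" "?x - ?w = ?x' - ?w + 1" by simp_all
  have "quad_term 2 z n m - (telescope_term n m - telescope_term n (Suc m)) =
      (1 / (?x' + ?w + 1)\<^sup>2 - (1 / (?x' + ?w) - 1 / (?x' + ?w + 1))) +
      (1 / (?x' - ?w + 1)\<^sup>2 - (1 / (?x' - ?w) - 1 / (?x' - ?w + 1)))"
    unfolding quad_term_def telescope_term_def sq S by (simp only: algebra_simps)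
  also have "\<dots> = - 1 / ((?x + ?w)\<^sup>2 * (?x' + ?w)) + - 1 / ((?x - ?w)\<^sup>2 * (?x' - ?w))"
    unfolding S using lattice_nonzero[of m n] lattice_nonzero[of "Suc m" n] unfolding S
    by (intro arg_cong2[of _ _ _ _ "(+)"] id)
  also have "norm \<dots> \<le> 2 / c ^ 3 * (1 / ?s ^ 3) + 2 / c ^ 3 * (1 / ?s ^ 3)"
    by (intro norm_triangle_mono est lower order.trans[OF half])
  also have "\<dots> = 4 / c ^ 3 * (1 / ?s ^ 3)" by simp
  also have "\<dots> \<le> 4 / c ^ 3 * (real (Suc n) powr (- 3 / 2) * real (Suc m) powr (- 3 / 2))"
    using c(1) by (intro mult_left_mono inverse_cube_le) auto
  finally show ?thesis .
qed

text \<open>The two orders of summation of the conditionally convergent double series of the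
  \<^term>\<open>quad_term 2 z\<close> differ; subtracting a telescoping series with known sums in both orders
  makes it absolutely convergent.\<close>

lemma E2_inversion: "E2 (- 1 / z) = z\<^sup>2 * E2 z + 6 / (of_real pi * \<i>) * z"
proof -
  have zz: "z \<noteq> 0" using z by auto
  obtain c where c: "c > 0" "\<And>t x :: real. t \<ge> 0 \<Longrightarrow> c * (t + \<bar>x\<bar>) \<le> norm (of_real t * z + of_real x)"
    using lattice_lower_bound[OF z] by metis
  define D where "D n m = quad_term 2 z n m - (telescope_term n m - telescope_term n (Suc m))" for n m
  define g where "g = (\<lambda>n. sqrt (4 / c ^ 3) * real (Suc n) powr (- 3 / 2))"
  have "norm (D n m) \<le> g n * g m" for n m
  proof -
    have "g n * g m = sqrt (4 / c ^ 3) ^ 2 * (real (Suc n) powr (- 3 / 2) * real (Suc m) powr (- 3 / 2))"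
      unfolding g_def power2_eq_square by (simp only: mult_ac)
    also have "sqrt (4 / c ^ 3) ^ 2 = 4 / c ^ 3" using c(1) by (intro real_sqrt_pow2) auto
    finally show ?thesis using telescope_error_bound[OF c, of n m] by (simp add: D_def)
  qed
  moreover have "summable g" unfolding g_def by (intro summable_mult summable_Suc_powr)
  moreover have "g n \<ge> 0" for n using c(1) by (simp add: g_def)
  ultimately have sD: "\<And>n. summable (D n)" "\<And>m. summable (\<lambda>n. D n m)"
    and "\<exists>S. (\<lambda>n. \<Sum>m. D n m) sums S \<and> (\<lambda>m. \<Sum>n. D n m) sums S"
    using double_series_swap[of D g] by blast+
  then obtain S where S: "(\<lambda>n. \<Sum>m. D n m) sums S" "(\<lambda>m. \<Sum>n. D n m) sums S" by blast
  have \<zeta>: "(\<lambda>n. 1 / of_nat (Suc n) ^ 2) sums (of_real (pi\<^sup>2 / 6) :: complex)"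
    using sums_of_real[OF inverse_squares_sums, where 'a = complex] by (simp add: add.commute)
  have rows: "(\<Sum>m. quad_term 2 z n m) = (\<Sum>m. D n m)" for n
  proof -
    have "(\<lambda>m. D n m + (telescope_term n m - telescope_term n (Suc m))) sums ((\<Sum>m. D n m) + 0)"
      by (intro sums_add telescope_rows summable_sums sD)
    then show ?thesis by (simp add: D_def sums_iff)
  qed
  have cols: "(\<Sum>n. quad_term 2 z n m) = (\<Sum>n. D n m) + (\<Sum>n. telescope_term n m - telescope_term n (Suc m))" for m
  proof -
    have "(\<lambda>n. D n m + (telescope_term n m - telescope_term n (Suc m))) sums
       ((\<Sum>n. D n m) + (\<Sum>n. telescope_term n m - telescope_term n (Suc m)))"
      by (intro sums_add summable_sums sD telescope_columns(2))
    then show ?thesis by (simp add: D_def sums_iff)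
  qed
  have sig: "eval_fps (sigma_fps (2 - 1)) (nome w) = (1 - E2 w) / 24" if "w \<in> uhp" for w
    using that norm_nome_less_1[OF that] sums_sigma[of "nome w" 1] by (simp add: E2_def sums_iff)
  have "S = (2 * of_real pi * \<i>)\<^sup>2 * ((1 - E2 z) / 24) - of_real (pi\<^sup>2 / 6) / z\<^sup>2"
    using sums_unique2[OF S(1)[folded rows] quad_term_rows[OF z _ _ \<zeta>], unfolded sig[OF z]] by simp
  moreover have "S + (- of_real pi * \<i> / z) =
      (2 * of_real pi * \<i>)\<^sup>2 * ((1 - E2 (- 1 / z)) / 24) / z\<^sup>2 - of_real (pi\<^sup>2 / 6)"
    using sums_unique2[OF sums_add[OF S(2) telescope_columns(1), folded cols] quad_term_columns[OF z _ _ \<zeta>],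
        unfolded sig[OF inversion_uhp[OF z]]]
    by simp
  ultimately have "(2 * of_real pi * \<i>)\<^sup>2 * ((1 - E2 z) / 24) - of_real (pi\<^sup>2 / 6) / z\<^sup>2 + (- of_real pi * \<i> / z)
      = (2 * of_real pi * \<i>)\<^sup>2 * ((1 - E2 (- 1 / z)) / 24) / z\<^sup>2 - of_real (pi\<^sup>2 / 6)"
    by simp
  \<comment> \<open>Since (2 pi i)^2 / 24 = -pi^2/6, the zeta term of each order of summation
    cancels the constant term contributed by the other.\<close>
  then have "z * (z * (E2 z * (of_real pi * (of_real pi * 6)))) =
      \<i> * (z * (of_real pi * 36)) + of_real pi * (of_real pi * (6 * E2 (- 1 / z)))"
    using zz by (simp add: divide_simps power2_eq_square) (simp add: algebra_simps)
  then have "6 * of_real pi * (of_real pi * (z\<^sup>2 * E2 z - E2 (- 1 / z))) = 6 * of_real pi * (6 * \<i> * z)"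
    by algebra
  then have eq: "of_real pi * (z\<^sup>2 * E2 z - E2 (- 1 / z)) = 6 * \<i> * z"
    by (subst (asm) mult_cancel_left) auto
  have "E2 (- 1 / z) = z\<^sup>2 * E2 z - of_real pi * (z\<^sup>2 * E2 z - E2 (- 1 / z)) / of_real pi"
    by simp
  also have "\<dots> = z\<^sup>2 * E2 z + 6 / (of_real pi * \<i>) * z"
    unfolding eq by (simp add: field_simps)
  finally show ?thesis .
qed

end

section \<open>The eta function\<close>

text \<open>On the ball of radius Im z / 2 the imaginary part is at least Im z / 2, so |q| \<le> exp
  (-pi Im z) and a geometric series dominates. Locally uniform convergence is what termwise
  logarithmic differentiation requires.\<close>

lemma eta_product_uniform:
  assumes z: "z \<in> uhp"
  shows "uniform_limit (cball z (Im z / 2)) (\<lambda>N w. \<Prod>n<N. 1 - nome w ^ Suc n)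
           (\<lambda>w. \<Prod>n. 1 - nome w ^ Suc n) sequentially"
    and "(\<Prod>n. 1 - nome z ^ Suc n) \<noteq> 0"
proof -
  have conv: "convergent_prod (\<lambda>n. 1 - nome w ^ Suc n)" and nz: "1 - nome w ^ Suc n \<noteq> 0"
    if w: "w \<in> uhp" for w n
  proof -
    have n: "norm (nome w) < 1" by (rule norm_nome_less_1[OF w])
    have lt: "norm (nome w ^ Suc n) < 1" for n
      unfolding norm_power using n by (simp add: power_less_one_iff del: power_Suc)
    then have ne: "nome w ^ Suc n \<noteq> 1" for n by (metis less_irrefl norm_one)
    have "summable (\<lambda>n. norm (- (nome w ^ Suc n)))"
      using summable_mult[OF summable_geometric[of "norm (nome w)"], of "norm (nome w)"] n
      by (simp add: norm_power norm_mult)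
    then have "convergent_prod (\<lambda>n. 1 + - (nome w ^ Suc n))"
      by (rule summable_imp_convergent_prod_complex) (use ne in \<open>simp del: power_Suc\<close>)
    then show "convergent_prod (\<lambda>n. 1 - nome w ^ Suc n)" by simp
    show "1 - nome w ^ Suc n \<noteq> 0" using ne[of n] by auto
  qed
  define r where "r = exp (- (pi * Im z))"
  have r: "0 \<le> r" "r < 1" using z by (auto simp: r_def)
  have in_uhp: "w \<in> uhp" and le_r: "norm (nome w) \<le> r" if "w \<in> cball z (Im z / 2)" for w
  proof -
    have "Im z - Im w \<le> Im z / 2"
      using that abs_Im_le_cmod[of "z - w"] by (simp add: dist_norm)
    then show "w \<in> uhp" "norm (nome w) \<le> r"
      using z by (auto simp: norm_nome r_def)
  qed
  have "uniformly_convergent_on (cball z (Im z / 2)) (\<lambda>N w. \<Prod>n<N. 1 - nome w ^ Suc n)"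
  proof (rule uniformly_convergent_on_prod')
    show "uniformly_convergent_on (cball z (Im z / 2)) (\<lambda>N x. \<Sum>n<N. norm (1 - nome x ^ Suc n - 1))"
    proof (rule Weierstrass_m_test')
      show "norm (norm (1 - nome w ^ Suc n - 1)) \<le> r ^ Suc n" if "w \<in> cball z (Im z / 2)" for n w
      proof -
        have "norm (norm (1 - nome w ^ Suc n - 1)) = norm (nome w) ^ Suc n"
          by (simp add: norm_power norm_mult)
        also have "\<dots> \<le> r ^ Suc n" by (rule power_mono[OF le_r[OF that]]) simp
        finally show ?thesis .
      qed
      show "summable (\<lambda>n. r ^ Suc n)" using r by (simp add: summable_geometric summable_mult)
    qed
    show "continuous_on (cball z (Im z / 2)) (\<lambda>w. 1 - nome w ^ Suc n)" for n
      by (intro continuous_intros holomorphic_on_imp_continuous_on nome_holomorphic)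
  qed auto
  then have "uniform_limit (cball z (Im z / 2)) (\<lambda>N w. \<Prod>n<N. 1 - nome w ^ Suc n)
           (\<lambda>w. lim (\<lambda>N. \<Prod>n<N. 1 - nome w ^ Suc n)) sequentially"
    by (simp add: uniformly_convergent_uniform_limit_iff)
  moreover have "lim (\<lambda>N. \<Prod>n<N. 1 - nome w ^ Suc n) = (\<Prod>n. 1 - nome w ^ Suc n)"
    if "w \<in> cball z (Im z / 2)" for w
  proof (rule limI)
    have "(\<lambda>N. \<Prod>n\<le>N. 1 - nome w ^ Suc n) \<longlonglongrightarrow> (\<Prod>n. 1 - nome w ^ Suc n)"
      by (rule convergent_prod_LIMSEQ[OF conv[OF in_uhp[OF that]]])
    then have "(\<lambda>N. \<Prod>n<Suc N. 1 - nome w ^ Suc n) \<longlonglongrightarrow> (\<Prod>n. 1 - nome w ^ Suc n)"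
      by (simp only: lessThan_Suc_atMost)
    then show "(\<lambda>N. \<Prod>n<N. 1 - nome w ^ Suc n) \<longlonglongrightarrow> (\<Prod>n. 1 - nome w ^ Suc n)"
      by (rule LIMSEQ_imp_Suc)
  qed
  ultimately show "uniform_limit (cball z (Im z / 2)) (\<lambda>N w. \<Prod>n<N. 1 - nome w ^ Suc n)
           (\<lambda>w. \<Prod>n. 1 - nome w ^ Suc n) sequentially"
    by (subst (asm) uniform_limit_cong') auto
  show "(\<Prod>n. 1 - nome z ^ Suc n) \<noteq> 0"
    by (rule prodinf_nonzero[OF conv[OF z] nz[OF z]])
qed

text \<open>The Lambert double series with the geometric index m summed first, the shape produced by
  the logarithmic derivative of the eta product.\<close>

lemma lambert_sums_sigma_1:
  assumes q: "norm q < 1"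
  shows "(\<lambda>n. of_nat (Suc n) * q ^ Suc n / (1 - q ^ Suc n)) sums eval_fps (sigma_fps 1) q"
proof -
  have sw: "((\<lambda>(r, m). of_nat r ^ 1 * q ^ (m * r)) has_sum eval_fps (sigma_fps 1) q) ({1..} \<times> {1..})"
    using lambert_has_sum[OF q, of 1] by (subst (asm) has_sum_swap) simp
  have inner: "((\<lambda>m. of_nat r * q ^ (m * r)) has_sum of_nat r * q ^ r / (1 - q ^ r)) {1..}"
    if r: "r \<in> {1..}" for r
  proof -
    have qr: "norm (q ^ r) < 1" using q r by (simp add: norm_power power_less_one_iff)
    have "(\<lambda>m. (q ^ r) ^ m) sums (1 / (1 - q ^ r))" by (rule geometric_sums[OF qr])
    then have "((\<lambda>m. (q ^ r) ^ m) has_sum (1 / (1 - q ^ r))) UNIV"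
      using qr by (intro norm_summable_imp_has_sum) (simp add: norm_power summable_geometric)
    then have "((\<lambda>m. of_nat r * q ^ r * (q ^ r) ^ m) has_sum of_nat r * q ^ r * (1 / (1 - q ^ r))) UNIV"
      by (rule has_sum_cmult_right)
    then show ?thesis
      by (rule has_sum_reindex_bij_witness[where i = "\<lambda>m. m - 1" and j = Suc, THEN iffD1, rotated -1])
         (auto simp: power_add power_mult mult.commute[of _ r])
  qed
  have "((\<lambda>r. of_nat r * q ^ r / (1 - q ^ r)) has_sum eval_fps (sigma_fps 1) q) {1..}"
    by (rule has_sum_SigmaD[OF sw]) (use inner in auto)
  then have "((\<lambda>n. of_nat (Suc n) * q ^ Suc n / (1 - q ^ Suc n)) has_sum eval_fps (sigma_fps 1) q) UNIV"
    by (rule has_sum_reindex_bij_witness[where i = Suc and j = "\<lambda>n. n - 1", THEN iffD1, rotated -1]) auto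
  then show ?thesis by (rule has_sum_imp_sums)
qed

lemma dedekind_eta_nome:
  "dedekind_eta z = exp (of_real pi * \<i> * z / 12) * (\<Prod>n. 1 - nome z ^ Suc n)"
proof -
  have "exp (2 * of_real pi * \<i> * of_nat (Suc n) * z) = nome z ^ Suc n" for n
    unfolding nome_def exp_of_nat_mult[symmetric] by (simp only: mult_ac)
  then show ?thesis by (simp add: dedekind_eta_def del: of_nat_Suc power_Suc)
qed

lemma dedekind_eta_nonzero: "z \<in> uhp \<Longrightarrow> dedekind_eta z \<noteq> 0"
  using eta_product_uniform(2) by (simp add: dedekind_eta_nome)

text \<open>Termwise logarithmic differentiation turns the product into the Lambert series of
  \<sigma>, and the factor exp (pi i z / 12) supplies the constant term of E2.\<close>

lemma dedekind_eta_derivative: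
  assumes z: "z \<in> uhp"
  shows "(dedekind_eta has_field_derivative (of_real pi * \<i> / 12 * E2 z * dedekind_eta z)) (at z)"
proof -
  define P where "P w = (\<Prod>n. 1 - nome w ^ Suc n)" for w
  let ?A = "ball z (Im z / 2)"
  have zA: "z \<in> ?A" using z by simp
  have ul: "uniform_limit ?A (\<lambda>N w. \<Prod>n<N. 1 - nome w ^ Suc n) P sequentially"
    unfolding P_def by (rule uniform_limit_on_subset[OF eta_product_uniform(1)[OF z]]) auto
  have hol: "(\<lambda>w. 1 - nome w ^ Suc n) holomorphic_on S" for n S
    by (intro holomorphic_intros)
  have Pnz: "P z \<noteq> 0" using eta_product_uniform(2)[OF z] by (simp add: P_def)
  have "P holomorphic_on ?A"
  proof (rule holomorphic_uniform_sequence[OF open_ball])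
    show "(\<lambda>w. \<Prod>n<N. 1 - nome w ^ Suc n) holomorphic_on ?A" for N
      by (intro holomorphic_intros)
    fix x assume "x \<in> ?A"
    then obtain d where d: "d > 0" "cball x d \<subseteq> ?A"
      using open_contains_cball[of ?A] open_ball by blast
    then show "\<exists>d>0. cball x d \<subseteq> ?A \<and>
        uniform_limit (cball x d) (\<lambda>N w. \<Prod>n<N. 1 - nome w ^ Suc n) P sequentially"
      using uniform_limit_on_subset[OF ul d(2)] by blast
  qed
  then have dP: "(P has_field_derivative deriv P z) (at z)"
    by (rule holomorphic_derivI[OF _ open_ball zA])
  have "(\<lambda>n. deriv (\<lambda>w. 1 - nome w ^ Suc n) z / (1 - nome z ^ Suc n)) sums (deriv P z / P z)"
    by (rule logderiv_prodinf_complex_uniform_limit[OF ul hol Pnz open_ball zA])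
  moreover have "deriv (\<lambda>w. 1 - nome w ^ Suc n) z = - 2 * of_real pi * \<i> * (of_nat (Suc n) * nome z ^ Suc n)" for n
  proof (rule DERIV_imp_deriv)
    have "((\<lambda>w. 1 - nome w ^ Suc n) has_field_derivative
        0 - of_nat (Suc n) * (2 * of_real pi * \<i> * nome z * nome z ^ (Suc n - Suc 0))) (at z)"
      by (intro DERIV_diff DERIV_const DERIV_power nome_has_field_derivative)
    then show "((\<lambda>w. 1 - nome w ^ Suc n) has_field_derivative
        - 2 * of_real pi * \<i> * (of_nat (Suc n) * nome z ^ Suc n)) (at z)"
      by (simp add: mult_ac del: of_nat_Suc)
  qed
  ultimately have "(\<lambda>n. - 2 * of_real pi * \<i> * (of_nat (Suc n) * nome z ^ Suc n / (1 - nome z ^ Suc n))) sums (deriv P z / P z)"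
    by (simp only: times_divide_eq_right)
  moreover have "(\<lambda>n. - 2 * of_real pi * \<i> * (of_nat (Suc n) * nome z ^ Suc n / (1 - nome z ^ Suc n))) sums
      (- 2 * of_real pi * \<i> * eval_fps (sigma_fps 1) (nome z))"
    by (intro sums_mult lambert_sums_sigma_1 norm_nome_less_1 z)
  ultimately have "deriv P z / P z = - 2 * of_real pi * \<i> * eval_fps (sigma_fps 1) (nome z)"
    by (rule sums_unique2)
  moreover have "E2 z = 1 - 24 * eval_fps (sigma_fps 1) (nome z)"
    using sums_sigma[OF norm_nome_less_1[OF z], of 1] by (simp add: E2_def sums_iff)
  ultimately have dP': "deriv P z = of_real pi * \<i> / 12 * (E2 z - 1) * P z"
    using Pnz by (simp add: nonzero_divide_eq_eq)
  have eta: "dedekind_eta = (\<lambda>w. exp (of_real pi * \<i> * w / 12) * P w)"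
    by (rule ext) (simp add: dedekind_eta_nome P_def)
  have dE: "((\<lambda>w. exp (of_real pi * \<i> * w / 12)) has_field_derivative
      exp (of_real pi * \<i> * z / 12) * (of_real pi * \<i> / 12)) (at z)"
    by (auto intro!: derivative_eq_intros)
  have "((\<lambda>w. exp (of_real pi * \<i> * w / 12) * P w) has_field_derivative
      exp (of_real pi * \<i> * z / 12) * (of_real pi * \<i> / 12) * P z + deriv P z * exp (of_real pi * \<i> * z / 12)) (at z)"
    by (rule DERIV_mult[OF dE dP])
  moreover have "exp (of_real pi * \<i> * z / 12) * (of_real pi * \<i> / 12) * P z +
      of_real pi * \<i> / 12 * (E2 z - 1) * P z * exp (of_real pi * \<i> * z / 12) =
      of_real pi * \<i> / 12 * E2 z * (exp (of_real pi * \<i> * z / 12) * P z)"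
    by (simp add: field_simps)
  ultimately show ?thesis
    unfolding eta dP' by (simp only:)
qed

section \<open>The modular group\<close>

type_synonym mat2 = "int \<times> int \<times> int \<times> int"

fun mat_mult :: "mat2 \<Rightarrow> mat2 \<Rightarrow> mat2" where
  "mat_mult (a, b, c, d) (a', b', c', d') = (a * a' + b * c', a * b' + b * d', c * a' + d * c', c * b' + d * d')"

fun mat_adj :: "mat2 \<Rightarrow> mat2" where
  "mat_adj (a, b, c, d) = (d, - b, - c, a)"

fun mat_det :: "mat2 \<Rightarrow> int" where
  "mat_det (a, b, c, d) = a * d - b * c"

fun moebius :: "mat2 \<Rightarrow> complex \<Rightarrow> complex" where
  "moebius (a, b, c, d) z = (of_int a * z + of_int b) / (of_int c * z + of_int d)"

text \<open>The automorphy factor.\<close>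

fun jfac :: "mat2 \<Rightarrow> complex \<Rightarrow> complex" where
  "jfac (a, b, c, d) z = of_int c * z + of_int d"

definition SL2 :: "mat2 set" where "SL2 = {g. mat_det g = 1}"

lemma mat_det_mult: "mat_det (mat_mult g h) = mat_det g * mat_det h"
  by (cases g; cases h) (simp add: algebra_simps)

lemma mat_mult_assoc: "mat_mult (mat_mult g h) k = mat_mult g (mat_mult h k)"
  by (cases g; cases h; cases k) (simp add: algebra_simps)

lemma SL2_mult: "g \<in> SL2 \<Longrightarrow> h \<in> SL2 \<Longrightarrow> mat_mult g h \<in> SL2"
  by (simp add: SL2_def mat_det_mult)

lemma SL2_adj: "g \<in> SL2 \<Longrightarrow> mat_adj g \<in> SL2"
  by (cases g) (simp add: SL2_def algebra_simps)

lemma mat_adj_mult: "g \<in> SL2 \<Longrightarrow> mat_mult (mat_adj g) g = (1, 0, 0, 1)"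
  "g \<in> SL2 \<Longrightarrow> mat_mult g (mat_adj g) = (1, 0, 0, 1)"
  by (cases g; simp add: SL2_def algebra_simps)+

lemma mat_mult_one [simp]: "mat_mult (1, 0, 0, 1) g = g" "mat_mult g (1, 0, 0, 1) = g"
  by (cases g; simp)+

lemma jfac_nonzero:
  assumes "mat_det g > 0" "z \<in> uhp"
  shows "jfac g z \<noteq> 0"
proof (cases g)
  case (fields a b c d)
  show ?thesis
  proof
    assume "jfac g z = 0"
    then have "of_int c * Im z = 0" "of_int c * Re z + of_int d = 0"
      using fields by (auto simp: complex_eq_iff)
    then have "c = 0" "d = 0" using assms(2) by auto
    then show False using assms(1) fields by simp
  qed
qed

lemma Im_moebius:
  assumes "mat_det g > 0" "z \<in> uhp"
  shows "Im (moebius g z) = of_int (mat_det g) * Im z / (norm (jfac g z))\<^sup>2"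
proof (cases g)
  case (fields a b c d)
  have "Im (moebius g z) = Im ((of_int a * z + of_int b) * cnj (of_int c * z + of_int d)) / (norm (jfac g z))\<^sup>2"
    using fields by (simp add: Im_complex_div_eq_0 complex_div_cnj[of "of_int a * z + of_int b"] Im_divide_of_real
        flip: of_real_power)
  also have "Im ((of_int a * z + of_int b) * cnj (of_int c * z + of_int d)) = of_int (mat_det g) * Im z"
    using fields by (simp add: algebra_simps)
  finally show ?thesis .
qed

lemma moebius_uhp:
  assumes "mat_det g > 0" "z \<in> uhp"
  shows "moebius g z \<in> uhp"
  using assms jfac_nonzero[OF assms] by (simp add: Im_moebius)

lemma jfac_mult:
  assumes "mat_det h > 0" "z \<in> uhp"
  shows "jfac (mat_mult g h) z = jfac g (moebius h z) * jfac h z"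
  using jfac_nonzero[OF assms] by (cases g; cases h) (simp add: field_simps)

lemma moebius_mult:
  assumes "mat_det h > 0" "z \<in> uhp"
  shows "moebius (mat_mult g h) z = moebius g (moebius h z)"
proof (cases g; cases h)
  fix a b c d a' b' c' d' assume g: "g = (a, b, c, d)" and h: "h = (a', b', c', d')"
  have nz: "of_int c' * z + of_int d' \<noteq> 0" using jfac_nonzero[OF assms] h by simp
  have MJ: "moebius h z * jfac h z = of_int a' * z + of_int b'" using nz by (simp add: h)
  have "moebius g (moebius h z) = ((of_int a * moebius h z + of_int b) * jfac h z) / ((of_int c * moebius h z + of_int d) * jfac h z)"
    using nz by (simp add: g h del: moebius.simps(1)) (simp add: g)
  also have "(of_int a * moebius h z + of_int b) * jfac h z = of_int a * (of_int a' * z + of_int b') + of_int b * (of_int c' * z + of_int d')"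
    by (simp only: ring_distribs(2) mult.assoc MJ) (simp add: h)
  also have "(of_int c * moebius h z + of_int d) * jfac h z = of_int c * (of_int a' * z + of_int b') + of_int d * (of_int c' * z + of_int d')"
    by (simp only: ring_distribs(2) mult.assoc MJ) (simp add: h)
  also have "(of_int a * (of_int a' * z + of_int b') + of_int b * (of_int c' * z + of_int d')) /
      (of_int c * (of_int a' * z + of_int b') + of_int d * (of_int c' * z + of_int d')) = moebius (mat_mult g h) z"
    by (simp add: g h algebra_simps)
  finally show "moebius (mat_mult g h) z = moebius g (moebius h z)" ..
qed

lemma SL2_det: "g \<in> SL2 \<Longrightarrow> mat_det g > 0"
  by (simp add: SL2_def)

text \<open>The Euclidean algorithm on the left column. Closure is assumed for products only, so the
  inverse translation is a base case of its own, while the inverse of S is obtained as -S =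
  S^3.\<close>

lemma SL2_induct:
  assumes S: "P (0, -1, 1, 0)" and T: "P (1, 1, 0, 1)" and T': "P (1, -1, 0, 1)"
    and mult: "\<And>g h. g \<in> SL2 \<Longrightarrow> h \<in> SL2 \<Longrightarrow> P g \<Longrightarrow> P h \<Longrightarrow> P (mat_mult g h)"
    and g: "g \<in> SL2"
  shows "P g"
proof -
  have SS: "(0, -1, 1, 0) \<in> SL2" "(1, 1, 0, 1) \<in> SL2" "(1, -1, 0, 1) \<in> SL2"
    by (auto simp: SL2_def)
  have m1: "P (-1, 0, 0, -1)" and m1S: "(-1, 0, 0, -1) \<in> SL2"
    using mult[OF SS(1) SS(1) S S] by (simp_all add: SL2_def)
  have one: "P (1, 0, 0, 1)"
    using mult[OF m1S m1S m1 m1] by simp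
  have S3: "P (0, 1, -1, 0)" and S3S: "(0, 1, -1, 0) \<in> SL2"
    using mult[OF m1S SS(1) m1 S] by (simp_all add: SL2_def)
  have Tb: "P (1, b, 0, 1)" and TbS: "(1, b, 0, 1) \<in> SL2" for b
  proof -
    show "(1, b, 0, 1) \<in> SL2" by (simp add: SL2_def)
    show "P (1, b, 0, 1)"
    proof (induction b rule: int_induct[where k = 0])
      case (step1 i)
      then show ?case using mult[of "(1, i, 0, 1)" "(1, 1, 0, 1)"] T SS by (simp add: SL2_def add.commute)
    next
      case (step2 i)
      then show ?case using mult[of "(1, i, 0, 1)" "(1, -1, 0, 1)"] T' SS by (simp add: SL2_def)
    qed (use one in simp)
  qed
  have main: "P (a, b, c, d)" if "a * d - b * c = 1" for a b c d
    using that
  proof (induction "nat \<bar>c\<bar>" arbitrary: a b c d rule: less_induct)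
    case less
    show ?case
    proof (cases "c = 0")
      case True
      then have "a * d = 1" using less.prems by simp
      then consider "a = 1" "d = 1" | "a = -1" "d = -1"
        by (auto simp: zmult_eq_1_iff)
      then show ?thesis
      proof cases
        case 1
        then show ?thesis using Tb True by simp
      next
        case 2
        then show ?thesis using mult[OF m1S TbS m1 Tb, of "- b"] True by simp
      qed
    next
      case False
      define q where "q = a div c"
      have lt: "nat \<bar>a - q * c\<bar> < nat \<bar>c\<bar>"
        using False abs_mod_less[of c a] by (simp add: q_def minus_div_mult_eq_mod)
      have det: "(- c) * (b - q * d) - (- d) * (a - q * c) = 1"
        using less.prems by (simp add: algebra_simps)
      have IH: "P (- c, - d, a - q * c, b - q * d)"
        by (rule less.hyps[OF lt det])
      \<comment> \<open>The matrix is T^q S^(-1) g', where g' has lower left entry a - q c = a mod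
        c.\<close>
      have "P (mat_mult (1, q, 0, 1) (mat_mult (0, 1, -1, 0) (- c, - d, a - q * c, b - q * d)))"
        using det by (intro mult IH TbS Tb S3 S3S SL2_mult) (simp_all add: SL2_def)
      then show ?thesis by simp
    qed
  qed
  show ?thesis using main g by (cases g) (auto simp: SL2_def)
qed

section \<open>Transformation laws\<close>

definition Delta :: "complex \<Rightarrow> complex" where "Delta z = dedekind_eta z ^ 24"

lemma Delta_nonzero: "z \<in> uhp \<Longrightarrow> Delta z \<noteq> 0"
  by (simp add: Delta_def dedekind_eta_nonzero)

lemma Delta_nome: "Delta z = nome z * (\<Prod>n. 1 - nome z ^ Suc n) ^ 24"
proof -
  have "exp (of_real pi * \<i> * z / 12) ^ 24 = nome z"
    unfolding nome_def exp_of_nat_mult[symmetric] by (simp add: mult_ac)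
  then show ?thesis by (simp add: Delta_def dedekind_eta_nome power_mult_distrib)
qed

lemma Delta_derivative:
  assumes "z \<in> uhp"
  shows "(Delta has_field_derivative (2 * of_real pi * \<i> * E2 z * Delta z)) (at z)"
proof -
  have "((\<lambda>w. dedekind_eta w ^ 24) has_field_derivative
     (of_nat 24 * (of_real pi * \<i> / 12 * E2 z * dedekind_eta z * dedekind_eta z ^ (24 - Suc 0)))) (at z)"
    by (rule DERIV_power[OF dedekind_eta_derivative[OF assms]])
  moreover have "of_nat 24 * (of_real pi * \<i> / 12 * E2 z * dedekind_eta z * dedekind_eta z ^ (24 - Suc 0))
     = 2 * of_real pi * \<i> * E2 z * Delta z"
  proof -
    have "dedekind_eta z * dedekind_eta z ^ (24 - Suc 0) = Delta z"
      by (simp add: Delta_def flip: power_Suc)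
    then show ?thesis by (simp add: mult.assoc)
  qed
  ultimately show ?thesis unfolding Delta_def[abs_def] by (simp only:)
qed

lemma Delta_holomorphic: "Delta holomorphic_on uhp"
  using Delta_derivative by (auto simp: holomorphic_on_def field_differentiable_def intro: has_field_derivative_at_within)

text \<open>The quotient of both sides has derivative 0: the additional term of
  \<open>E2_inversion\<close> contributes 12/w to its logarithmic derivative, which is exactly the
  contribution of w^12.\<close>

lemma Delta_inversion:
  assumes z: "z \<in> uhp"
  shows "Delta (- 1 / z) = z ^ 12 * Delta z"
proof -
  define R where "R w = Delta (- 1 / w) / (w ^ 12 * Delta w)" for w
  have "(R has_field_derivative 0) (at w within uhp)" if w: "w \<in> uhp" for w
  proof -
    have wz: "w \<noteq> 0" using w by auto
    have d1: "((\<lambda>w. Delta (- 1 / w)) has_field_derivative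
        (2 * of_real pi * \<i> * E2 (- 1 / w) * Delta (- 1 / w) * (1 / w\<^sup>2))) (at w)"
      by (rule DERIV_chain2[where f = Delta and g = "\<lambda>w. - 1 / w", OF Delta_derivative[OF inversion_uhp[OF w]]])
         (use wz in \<open>auto intro!: derivative_eq_intros simp: power2_eq_square\<close>)
    have d2: "((\<lambda>w. w ^ 12 * Delta w) has_field_derivative
        (12 * w ^ 11 * Delta w + w ^ 12 * (2 * of_real pi * \<i> * E2 w * Delta w))) (at w)"
      by (rule derivative_eq_intros Delta_derivative w refl | simp)+
    have e: "2 * of_real pi * \<i> * E2 (- 1 / w) * (1 / w\<^sup>2) = 2 * of_real pi * \<i> * E2 w + 12 / w"
      unfolding E2_inversion[OF w] using wz by (simp add: field_simps power2_eq_square)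
    have "(R has_field_derivative
        ((2 * of_real pi * \<i> * E2 (- 1 / w) * Delta (- 1 / w) * (1 / w\<^sup>2)) * (w ^ 12 * Delta w) -
          Delta (- 1 / w) * (12 * w ^ 11 * Delta w + w ^ 12 * (2 * of_real pi * \<i> * E2 w * Delta w)))
        / ((w ^ 12 * Delta w) * (w ^ 12 * Delta w))) (at w)"
      unfolding R_def using wz Delta_nonzero[OF w] by (intro DERIV_divide d1 d2) auto
    moreover have "(2 * of_real pi * \<i> * E2 (- 1 / w) * Delta (- 1 / w) * (1 / w\<^sup>2)) * (w ^ 12 * Delta w) -
          Delta (- 1 / w) * (12 * w ^ 11 * Delta w + w ^ 12 * (2 * of_real pi * \<i> * E2 w * Delta w)) =
        Delta (- 1 / w) * Delta w * (w ^ 12 * (2 * of_real pi * \<i> * E2 (- 1 / w) * (1 / w\<^sup>2)) -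
          (12 * w ^ 11 + w ^ 12 * (2 * of_real pi * \<i> * E2 w)))"
      by (simp only: ring_distribs mult_ac)
    moreover have "w ^ 12 * (2 * of_real pi * \<i> * E2 (- 1 / w) * (1 / w\<^sup>2)) -
          (12 * w ^ 11 + w ^ 12 * (2 * of_real pi * \<i> * E2 w)) = 0"
    proof -
      have "w ^ 12 = w ^ 11 * w" by (simp flip: power_Suc2)
      then have "w ^ 12 * (12 / w) = 12 * w ^ 11" using wz by simp
      then show ?thesis unfolding e by (simp only: ring_distribs) simp
    qed
    ultimately have "(R has_field_derivative 0) (at w)" by simp
    then show ?thesis by (rule has_field_derivative_at_within)
  qed
  from has_field_derivative_zero_constant[OF convex_uhp this] obtain c where c: "\<And>w. w \<in> uhp \<Longrightarrow> R w = c"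
    by metis
  \<comment> \<open>The constant is read off at the fixed point i of the inversion, where i^12 =
    1.\<close>
  have "R \<i> = 1"
  proof -
    have "(\<i> :: complex) ^ 12 = 1" by (simp add: power_mult[of \<i> 2 6, simplified])
    moreover have "- 1 / \<i> = \<i>" by (simp add: field_simps)
    ultimately show ?thesis using Delta_nonzero[of \<i>] by (simp add: R_def)
  qed
  then have "R z = 1" using c[of \<i>] c[OF z] by simp
  then show ?thesis by (simp add: R_def divide_eq_1_iff)
qed

lemma Delta_SL2:
  assumes g: "g \<in> SL2" and z: "z \<in> uhp"
  shows "Delta (moebius g z) = jfac g z ^ 12 * Delta z"
proof -
  have per: "Delta (z + 1) = Delta z" for z by (simp add: Delta_nome nome_plus_1)
  then have per': "Delta (z - 1) = Delta z" for z by (metis diff_add_cancel)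
  have "\<forall>z\<in>uhp. Delta (moebius g z) = jfac g z ^ 12 * Delta z"
    using g
  proof (induction g rule: SL2_induct[rotated -1, consumes 1])
    fix g h assume *: "g \<in> SL2" "h \<in> SL2" "\<forall>z\<in>uhp. Delta (moebius g z) = jfac g z ^ 12 * Delta z"
      "\<forall>z\<in>uhp. Delta (moebius h z) = jfac h z ^ 12 * Delta z"
    show "\<forall>z\<in>uhp. Delta (moebius (mat_mult g h) z) = jfac (mat_mult g h) z ^ 12 * Delta z"
    proof
      fix z assume z: "z \<in> uhp"
      note h = SL2_det[OF *(2)]
      have "Delta (moebius (mat_mult g h) z) = jfac g (moebius h z) ^ 12 * (jfac h z ^ 12 * Delta z)"
        using moebius_mult[OF h z] *(3,4) moebius_uhp[OF h z] z by simp
      then show "Delta (moebius (mat_mult g h) z) = jfac (mat_mult g h) z ^ 12 * Delta z"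
        by (simp add: jfac_mult[OF h z] power_mult_distrib)
    qed
  qed (use Delta_inversion per per' in auto)
  with z show ?thesis by blast
qed

text \<open>The chain rule, as the Moebius map has derivative j^(-2). A function F different from f
  is allowed: for g outside the group, F is f slashed by g.\<close>

lemma deriv_transform:
  assumes f: "f holomorphic_on uhp" and g: "g \<in> SL2"
    and tr: "\<And>z. z \<in> uhp \<Longrightarrow> f (moebius g z) = jfac g z ^ k * F z"
    and F: "F holomorphic_on uhp" and z: "z \<in> uhp"
  shows "deriv f (moebius g z) = jfac g z ^ (k + 2) * deriv F z
       + of_nat k * of_int (fst (snd (snd g))) * jfac g z ^ (k + 1) * F z"
proof (cases g)
  case (fields a b c d)
  define j where "j = jfac g z"
  have j: "j \<noteq> 0" using jfac_nonzero[OF SL2_det[OF g] z] by (simp add: j_def)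
  have j': "j = of_int c * z + of_int d" by (simp add: j_def fields)
  have det: "of_int a * of_int d - of_int b * of_int c = (1 :: complex)"
    using g by (simp add: SL2_def fields flip: of_int_mult of_int_diff)
  have "(moebius g has_field_derivative (of_int a * j - (of_int a * z + of_int b) * of_int c) / (j * j)) (at z)"
    using j unfolding fields j' by (auto intro!: derivative_eq_intros ext simp: moebius.simps[abs_def])
  moreover have "of_int a * j - (of_int a * z + of_int b) * of_int c = 1"
    using det by (simp add: j' algebra_simps)
  ultimately have dm: "(moebius g has_field_derivative 1 / (j * j)) (at z)" by simp
  have dj: "(jfac g has_field_derivative of_int c) (at z)"
    unfolding fields by (auto intro!: derivative_eq_intros simp: jfac.simps[abs_def])
  have "((\<lambda>w. f (moebius g w)) has_field_derivative deriv f (moebius g z) * (1 / (j * j))) (at z)"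
    by (rule DERIV_chain2[OF holomorphic_derivI[OF f open_uhp moebius_uhp[OF SL2_det[OF g] z]] dm])
  moreover have "((\<lambda>w. jfac g w ^ k * F w) has_field_derivative
      of_nat k * (of_int c * j ^ (k - Suc 0)) * F z + deriv F z * j ^ k) (at z)"
    unfolding j_def by (rule DERIV_mult[OF DERIV_power[OF dj] holomorphic_derivI[OF F open_uhp z]])
  moreover have "\<forall>\<^sub>F w in nhds z. f (moebius g w) = jfac g w ^ k * F w"
    using eventually_nhds_in_open[OF open_uhp z] by eventually_elim (rule tr)
  ultimately have "deriv f (moebius g z) * (1 / (j * j)) =
      of_nat k * (of_int c * j ^ (k - Suc 0)) * F z + deriv F z * j ^ k"
    by (rule DERIV_unique_ev)
  then have "deriv f (moebius g z) = (of_nat k * (of_int c * j ^ (k - Suc 0)) * F z + deriv F z * j ^ k) * (j * j)"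
    using j by (simp add: field_simps)
  then show ?thesis
    unfolding j_def[symmetric] by (cases k) (simp_all add: fields algebra_simps)
qed

text \<open>E2 is the logarithmic derivative of \<open>Delta\<close> up to 2 pi i, so its law
  follows by differentiating that of \<open>Delta\<close> in weight 12.\<close>

lemma E2_SL2:
  assumes g: "g \<in> SL2" and z: "z \<in> uhp"
  shows "E2 (moebius g z) = (jfac g z)\<^sup>2 * E2 z + 6 / (of_real pi * \<i>) * of_int (fst (snd (snd g))) * jfac g z"
proof -
  let ?c = "of_int (fst (snd (snd g))) :: complex" and ?j = "jfac g z" and ?p = "2 * of_real pi * \<i> :: complex"
  note gz = moebius_uhp[OF SL2_det[OF g] z]
  have j: "?j \<noteq> 0" by (rule jfac_nonzero[OF SL2_det[OF g] z])
  have D: "deriv Delta w = ?p * E2 w * Delta w" if "w \<in> uhp" for w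
    by (rule DERIV_imp_deriv[OF Delta_derivative[OF that]])
  have "?p * E2 (moebius g z) * (?j ^ 12 * Delta z) =
      ?j ^ (12 + 2) * (?p * E2 z * Delta z) + of_nat 12 * ?c * ?j ^ (12 + 1) * Delta z"
    using deriv_transform[OF Delta_holomorphic g Delta_SL2[OF g] Delta_holomorphic z]
    unfolding D[OF gz] D[OF z] Delta_SL2[OF g z] .
  then have "(?j ^ 12 * Delta z) * (?p * E2 (moebius g z)) =
      (?j ^ 12 * Delta z) * (?p * (?j\<^sup>2 * E2 z) + 12 * ?c * ?j)"
    unfolding power_add power_one_right of_nat_numeral by (simp only: ring_distribs mult_ac)
  then have "?p * E2 (moebius g z) = ?p * (?j\<^sup>2 * E2 z) + 12 * ?c * ?j"
    by (subst (asm) mult_cancel_left) (use j Delta_nonzero[OF z] in auto)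
  then have "E2 (moebius g z) = (?p * (?j\<^sup>2 * E2 z) + 12 * ?c * ?j) / ?p"
    by (simp add: nonzero_eq_divide_eq mult.commute)
  also have "\<dots> = ?j\<^sup>2 * E2 z + 12 * ?c * ?j / ?p"
    by (simp only: add_divide_distrib) simp
  finally show ?thesis by (simp add: mult_ac)
qed

section \<open>Modular forms\<close>

definition Gamma0 :: "nat \<Rightarrow> mat2 set" where
  "Gamma0 N = {g \<in> SL2. int N dvd fst (snd (snd g))}"

text \<open>Holomorphy at the cusps is expressed by boundedness of every slashed function on every
  half plane Im z \<ge> y. This form passes to sums and products at once and requires no expansions
  at cusps other than infinity.\<close>

definition mform :: "nat \<Rightarrow> nat \<Rightarrow> (complex \<Rightarrow> complex) \<Rightarrow> bool" where
  "mform k N f \<longleftrightarrow> f holomorphic_on uhp \<and>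
     (\<forall>g\<in>Gamma0 N. \<forall>z\<in>uhp. f (moebius g z) = jfac g z ^ k * f z) \<and>
     (\<forall>g\<in>SL2. \<forall>y>0. \<exists>B. \<forall>z. Im z \<ge> y \<longrightarrow> norm (f (moebius g z)) \<le> B * norm (jfac g z) ^ k)"

lemma mformD:
  assumes "mform k N f"
  shows "f holomorphic_on uhp"
    and "g \<in> Gamma0 N \<Longrightarrow> z \<in> uhp \<Longrightarrow> f (moebius g z) = jfac g z ^ k * f z"
  using assms by (auto simp: mform_def)

lemma mform_bound:
  assumes "mform k N f" "g \<in> SL2" "y > 0"
  obtains B where "B > 0" "\<And>z. Im z \<ge> y \<Longrightarrow> norm (f (moebius g z)) \<le> B * norm (jfac g z) ^ k"
proof -
  from assms obtain B where B: "\<And>z. Im z \<ge> y \<Longrightarrow> norm (f (moebius g z)) \<le> B * norm (jfac g z) ^ k"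
    unfolding mform_def by blast
  show ?thesis
  proof (rule that[of "max B 1"])
    fix z assume "Im z \<ge> y"
    from B[OF this] show "norm (f (moebius g z)) \<le> max B 1 * norm (jfac g z) ^ k"
      by (rule order.trans) (intro mult_right_mono, auto)
  qed simp
qed

lemma mformI:
  assumes "f holomorphic_on uhp"
    "\<And>g z. g \<in> Gamma0 N \<Longrightarrow> z \<in> uhp \<Longrightarrow> f (moebius g z) = jfac g z ^ k * f z"
    "\<And>g y. g \<in> SL2 \<Longrightarrow> y > 0 \<Longrightarrow> \<exists>B. \<forall>z. Im z \<ge> y \<longrightarrow> norm (f (moebius g z)) \<le> B * norm (jfac g z) ^ k"
  shows "mform k N f"
  using assms by (simp add: mform_def)

lemma Gamma0_SL2: "g \<in> Gamma0 N \<Longrightarrow> g \<in> SL2"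
  by (simp add: Gamma0_def)

lemma mform_level:
  assumes "mform k N f" "N dvd M"
  shows "mform k M f"
proof -
  have "Gamma0 M \<subseteq> Gamma0 N"
    using assms(2) by (auto simp: Gamma0_def intro: dvd_trans[of "int N" "int M"])
  then show ?thesis using assms(1) by (auto simp: mform_def)
qed

lemma mform_const: "mform 0 N (\<lambda>_. c)"
  by (rule mformI) (auto intro: exI[of _ "norm c"])

lemma mform_add:
  assumes "mform k N f" "mform k N g"
  shows "mform k N (\<lambda>z. f z + g z)"
proof (rule mformI)
  fix \<gamma> y assume *: "\<gamma> \<in> SL2" "y > (0::real)"
  obtain B1 where B1: "\<And>z. Im z \<ge> y \<Longrightarrow> norm (f (moebius \<gamma> z)) \<le> B1 * norm (jfac \<gamma> z) ^ k"
    using mform_bound[OF assms(1) *] by metis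
  obtain B2 where B2: "\<And>z. Im z \<ge> y \<Longrightarrow> norm (g (moebius \<gamma> z)) \<le> B2 * norm (jfac \<gamma> z) ^ k"
    using mform_bound[OF assms(2) *] by metis
  show "\<exists>B. \<forall>z. Im z \<ge> y \<longrightarrow> norm (f (moebius \<gamma> z) + g (moebius \<gamma> z)) \<le> B * norm (jfac \<gamma> z) ^ k"
    using norm_triangle_mono[OF B1 B2] by (intro exI[of _ "B1 + B2"]) (simp add: distrib_right)
qed (use mformD[OF assms(1)] mformD[OF assms(2)] in \<open>auto intro!: holomorphic_intros simp: ring_distribs\<close>)

lemma mform_mult:
  assumes "mform k N f" "mform l N g"
  shows "mform (k + l) N (\<lambda>z. f z * g z)"
proof (rule mformI)
  fix \<gamma> y assume *: "\<gamma> \<in> SL2" "y > (0::real)"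
  obtain B1 where B1: "B1 > 0" "\<And>z. Im z \<ge> y \<Longrightarrow> norm (f (moebius \<gamma> z)) \<le> B1 * norm (jfac \<gamma> z) ^ k"
    using mform_bound[OF assms(1) *] by metis
  obtain B2 where B2: "B2 > 0" "\<And>z. Im z \<ge> y \<Longrightarrow> norm (g (moebius \<gamma> z)) \<le> B2 * norm (jfac \<gamma> z) ^ l"
    using mform_bound[OF assms(2) *] by metis
  have "norm (f (moebius \<gamma> z) * g (moebius \<gamma> z)) \<le> B1 * B2 * norm (jfac \<gamma> z) ^ (k + l)" if "Im z \<ge> y" for z
  proof -
    have "norm (f (moebius \<gamma> z) * g (moebius \<gamma> z)) \<le> (B1 * norm (jfac \<gamma> z) ^ k) * (B2 * norm (jfac \<gamma> z) ^ l)"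
      unfolding norm_mult using B1(1) by (intro mult_mono B1 B2 that) auto
    then show ?thesis by (simp add: power_add mult_ac)
  qed
  then show "\<exists>B. \<forall>z. Im z \<ge> y \<longrightarrow> norm (f (moebius \<gamma> z) * g (moebius \<gamma> z)) \<le> B * norm (jfac \<gamma> z) ^ (k + l)"
    by blast
qed (use mformD[OF assms(1)] mformD[OF assms(2)] in \<open>auto intro!: holomorphic_intros simp: power_add\<close>)

lemma mform_cmult: "mform k N f \<Longrightarrow> mform k N (\<lambda>z. c * f z)"
  using mform_mult[OF mform_const] by fastforce

lemma mform_diff: "mform k N f \<Longrightarrow> mform k N g \<Longrightarrow> mform k N (\<lambda>z. f z - g z)"
  using mform_add[OF _ mform_cmult[of k N g "-1"]] by simp

lemma mform_cong:
  assumes "mform k N f" "\<And>z. z \<in> uhp \<Longrightarrow> g z = f z"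
  shows "mform k N g"
proof (rule mformI)
  fix \<gamma> y assume *: "\<gamma> \<in> SL2" "y > (0::real)"
  obtain B where B: "\<And>z. Im z \<ge> y \<Longrightarrow> norm (f (moebius \<gamma> z)) \<le> B * norm (jfac \<gamma> z) ^ k"
    using mform_bound[OF assms(1) *] by metis
  have "norm (g (moebius \<gamma> z)) \<le> B * norm (jfac \<gamma> z) ^ k" if "Im z \<ge> y" for z
    using B[OF that] assms(2)[OF moebius_uhp[OF SL2_det[OF *(1)]]] that * by simp
  then show "\<exists>B. \<forall>z. Im z \<ge> y \<longrightarrow> norm (g (moebius \<gamma> z)) \<le> B * norm (jfac \<gamma> z) ^ k" by blast
next
  show "g holomorphic_on uhp"
    using mformD(1)[OF assms(1)] by (rule holomorphic_transform) (simp add: assms(2))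
  show "g (moebius \<gamma> z) = jfac \<gamma> z ^ k * g z" if "\<gamma> \<in> Gamma0 N" "z \<in> uhp" for \<gamma> z
    using mformD(2)[OF assms(1) that] assms(2)[OF that(2)]
      assms(2)[OF moebius_uhp[OF SL2_det[OF Gamma0_SL2[OF that(1)]] that(2)]] by simp
qed

lemma qexp_bounded:
  assumes "qexp F f" "y > 0"
  obtains B where "B > 0" "\<And>z. Im z \<ge> y \<Longrightarrow> norm (f z) \<le> B"
  using qexp_order_bound[OF assms(1) _ assms(2), of 0] by auto

text \<open>Periodicity comes from the q-expansion, and inversion and translation generate the
  group. As every g then satisfies the transformation law, boundedness at all cusps reduces to
  boundedness near infinity.\<close>

lemma mform_level_1I:
  assumes q: "qexp F f" and inv: "\<And>z. z \<in> uhp \<Longrightarrow> f (- 1 / z) = z ^ k * f z"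
  shows "mform k 1 f"
proof -
  have per: "f (z + 1) = f z" if "z \<in> uhp" for z
    using q that nome_plus_1[of z] by (simp add: qexp_def)
  have per': "f (z - 1) = f z" if "z \<in> uhp" for z
    using per[of "z - 1"] that by simp
  have SL2: "\<forall>z\<in>uhp. f (moebius g z) = jfac g z ^ k * f z" if "g \<in> SL2" for g
    using that
  proof (induction g rule: SL2_induct[rotated -1, consumes 1])
    fix g h assume *: "g \<in> SL2" "h \<in> SL2" "\<forall>z\<in>uhp. f (moebius g z) = jfac g z ^ k * f z"
      "\<forall>z\<in>uhp. f (moebius h z) = jfac h z ^ k * f z"
    show "\<forall>z\<in>uhp. f (moebius (mat_mult g h) z) = jfac (mat_mult g h) z ^ k * f z"
    proof
      fix z assume z: "z \<in> uhp"
      note h = SL2_det[OF *(2)]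
      have "f (moebius (mat_mult g h) z) = jfac g (moebius h z) ^ k * (jfac h z ^ k * f z)"
        using moebius_mult[OF h z] *(3,4) moebius_uhp[OF h z] z by simp
      then show "f (moebius (mat_mult g h) z) = jfac (mat_mult g h) z ^ k * f z"
        by (simp add: jfac_mult[OF h z] power_mult_distrib)
    qed
  qed (use inv per per' in auto)
  show ?thesis
  proof (rule mformI)
    fix g y assume *: "g \<in> SL2" "y > (0::real)"
    obtain B where B: "\<And>z. Im z \<ge> y \<Longrightarrow> norm (f z) \<le> B"
      using qexp_bounded[OF q *(2)] by metis
    have "norm (f (moebius g z)) \<le> B * norm (jfac g z) ^ k" if "Im z \<ge> y" for z
      using SL2[OF *(1)] that * B[OF that]
      by (simp add: norm_mult norm_power mult.commute mult_right_mono)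
    then show "\<exists>B. \<forall>z. Im z \<ge> y \<longrightarrow> norm (f (moebius g z)) \<le> B * norm (jfac g z) ^ k" by blast
  qed (use SL2 qexp_holomorphic[OF q] in \<open>auto simp: Gamma0_def\<close>)
qed

section \<open>The Serre derivative\<close>

definition serre :: "nat \<Rightarrow> (complex \<Rightarrow> complex) \<Rightarrow> complex \<Rightarrow> complex" where
  "serre k f z = theta_op f z - of_nat k / 12 * E2 z * f z"

text \<open>The term with the lower left entry c in \<open>deriv_transform\<close> cancels against
  the one in \<open>E2_SL2\<close>. For the cusps, Cauchy's inequality bounds the derivative of the
  slashed function by the function itself.\<close>

lemma mform_serre:
  assumes f: "mform k N f"
  shows "mform (k + 2) N (serre k f)"
proof -
  let ?p = "2 * of_real pi * \<i> :: complex"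
  have key: "serre k f (moebius g z) = jfac g z ^ (k + 2) * (deriv F z / ?p - of_nat k / 12 * E2 z * F z)"
    if g: "g \<in> SL2" and z: "z \<in> uhp" and F: "F holomorphic_on uhp"
      and tr: "\<And>z. z \<in> uhp \<Longrightarrow> f (moebius g z) = jfac g z ^ k * F z" for g z F
  proof -
    let ?c = "of_int (fst (snd (snd g))) :: complex" and ?j = "jfac g z"
    have dt: "deriv f (moebius g z) = ?j ^ (k + 2) * deriv F z + of_nat k * ?c * ?j ^ (k + 1) * F z"
      by (rule deriv_transform[OF mformD(1)[OF f] g tr F z])
    have "serre k f (moebius g z) =
       (?j ^ (k + 2) * deriv F z + of_nat k * ?c * ?j ^ (k + 1) * F z) / ?p
       - of_nat k / 12 * (?j\<^sup>2 * E2 z + 6 / (of_real pi * \<i>) * ?c * ?j) * (?j ^ k * F z)"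
      unfolding serre_def theta_op_def dt E2_SL2[OF g z] tr[OF z] ..
    also have "\<dots> = ?j ^ (k + 2) * (deriv F z / ?p - of_nat k / 12 * E2 z * F z)
       + of_nat k * ?c * ?j ^ (k + 1) * F z * (1 / ?p - 6 / (12 * (of_real pi * \<i>)))"
      by (simp only: power_add power_one_right ring_distribs add_divide_distrib) (simp add: field_simps)
    also have "1 / ?p - 6 / (12 * (of_real pi * \<i>)) = 0" by (simp add: field_simps)
    finally show ?thesis by simp
  qed
  show ?thesis
  proof (rule mformI)
    show "serre k f holomorphic_on uhp"
      unfolding serre_def theta_op_def
      by (intro holomorphic_intros holomorphic_deriv mformD(1)[OF f] open_uhp qexp_holomorphic[OF qexp_E2]) auto
    show "serre k f (moebius g z) = jfac g z ^ (k + 2) * serre k f z" if "g \<in> Gamma0 N" "z \<in> uhp" for g z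
      using key[OF Gamma0_SL2[OF that(1)] that(2) mformD(1)[OF f] mformD(2)[OF f that(1)]]
      by (simp add: serre_def theta_op_def)
  next
    fix g y assume g: "g \<in> SL2" and y: "y > (0::real)"
    \<comment> \<open>This is f slashed by g; the cancellation in \<open>key\<close> holds for it as
      well.\<close>
    define F where "F z = f (moebius g z) / jfac g z ^ k" for z
    have mob: "moebius g holomorphic_on uhp" "jfac g holomorphic_on uhp"
      using jfac_nonzero[OF SL2_det[OF g]]
      by (cases g; auto intro!: holomorphic_intros simp: moebius.simps[abs_def] jfac.simps[abs_def])+
    have Fh: "F holomorphic_on uhp"
      unfolding F_def using jfac_nonzero[OF SL2_det[OF g]] moebius_uhp[OF SL2_det[OF g]]
      by (intro holomorphic_intros mob holomorphic_on_compose_gen[OF mob(1) mformD(1)[OF f], unfolded o_def]) auto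
    have tr: "f (moebius g z) = jfac g z ^ k * F z" if "z \<in> uhp" for z
      using jfac_nonzero[OF SL2_det[OF g] that] by (simp add: F_def)
    \<comment> \<open>The bound is taken from height y / 2 on, so that discs of radius y / 2 around
      points of height at least y stay in its range.\<close>
    obtain B where B: "B > 0" "\<And>z. Im z \<ge> y / 2 \<Longrightarrow> norm (f (moebius g z)) \<le> B * norm (jfac g z) ^ k"
      using mform_bound[OF f g] y by (metis half_gt_zero)
    have FB: "norm (F z) \<le> B" if "Im z \<ge> y / 2" for z
      using B(2)[OF that] jfac_nonzero[OF SL2_det[OF g], of z] that y
      by (simp add: F_def norm_divide norm_power field_simps)
    obtain B2 where B2: "B2 > 0" "\<And>z. Im z \<ge> y \<Longrightarrow> norm (E2 z) \<le> B2"
      using qexp_bounded[OF qexp_E2 y] by metis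
    have dF: "norm (deriv F z) \<le> B / (y / 2)" if z: "Im z \<ge> y" for z
    proof -
      have sub: "Im w \<ge> y / 2" if "w \<in> cball z (y / 2)" for w
        using that z abs_Im_le_cmod[of "z - w"] by (simp add: dist_norm)
      then have sub': "cball z (y / 2) \<subseteq> uhp" using y by force
      have "norm ((deriv ^^ 1) F z) \<le> fact 1 * B / (y / 2) ^ 1"
      proof (rule Cauchy_inequality)
        show "F holomorphic_on ball z (y / 2)"
          by (rule holomorphic_on_subset[OF Fh]) (use sub' ball_subset_cball in blast)
        show "continuous_on (cball z (y / 2)) F"
          by (rule holomorphic_on_imp_continuous_on[OF holomorphic_on_subset[OF Fh sub']])
        show "norm (F w) \<le> B" if "norm (z - w) = y / 2" for w
          by (rule FB, rule sub) (simp add: dist_norm that)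
      qed (use y in auto)
      then show ?thesis by simp
    qed
    have "norm (serre k f (moebius g z)) \<le> (B / (y / 2) / (2 * pi) + k / 12 * B2 * B) * norm (jfac g z) ^ (k + 2)"
      if z: "Im z \<ge> y" for z
    proof -
      have zu: "z \<in> uhp" using z y by simp
      have "norm (deriv F z / ?p - of_nat k / 12 * E2 z * F z) \<le> norm (deriv F z / ?p) + norm (of_nat k / 12 * E2 z * F z)"
        by (rule norm_triangle_ineq4)
      also have "\<dots> \<le> B / (y / 2) / (2 * pi) + k / 12 * B2 * B"
      proof (rule add_mono)
        show "norm (deriv F z / ?p) \<le> B / (y / 2) / (2 * pi)"
          using divide_right_mono[OF dF[OF z], of "2 * pi"] by (simp add: norm_divide norm_mult)
        show "norm (of_nat k / 12 * E2 z * F z) \<le> k / 12 * B2 * B"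
          unfolding norm_mult using B(1) B2(1) y z
          by (intro mult_mono FB B2) auto
      qed
      finally have le: "norm (deriv F z / ?p - of_nat k / 12 * E2 z * F z) \<le> B / (y / 2) / (2 * pi) + k / 12 * B2 * B" .
      have eq: "serre k f (moebius g z) = jfac g z ^ (k + 2) * (deriv F z / ?p - of_nat k / 12 * E2 z * F z)"
        by (rule key[OF g zu Fh tr])
      show ?thesis
        unfolding eq norm_mult[of "jfac g z ^ (k + 2)"] norm_power
        by (subst mult.commute) (intro mult_right_mono le zero_le_power norm_ge_zero)
    qed
    then show "\<exists>B. \<forall>z. Im z \<ge> y \<longrightarrow> norm (serre k f (moebius g z)) \<le> B * norm (jfac g z) ^ (k + 2)" by blast
  qed
qed

section \<open>Modularity of f (\<delta> z) and of the Eisenstein series of weight 2\<close>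

lemma SL2_complete_column:
  fixes a c :: int
  assumes "coprime a c"
  obtains b d where "(a, b, c, d) \<in> SL2"
proof -
  obtain u v where "u * a + v * c = gcd a c" using bezout_int by blast
  then have "(a, - v, c, u) \<in> SL2" using assms by (simp add: SL2_def mult.commute)
  then show ?thesis by (rule that)
qed

text \<open>The Hermite normal form of the integral matrix of \<open>z \<mapsto> \<delta> g z\<close>.\<close>

lemma scaled_moebius:
  assumes g: "g \<in> SL2" and \<delta>: "\<delta> > 0"
  obtains h A B D where "h \<in> SL2" "A > 0" "D > 0" "A * D = int \<delta>"
    "fst (snd (snd h)) * A = fst (snd (snd g))"
    "\<And>z. z \<in> uhp \<Longrightarrow> moebius (A, B, 0, D) z \<in> uhp"
    "\<And>z. z \<in> uhp \<Longrightarrow> of_nat \<delta> * moebius g z = moebius h (moebius (A, B, 0, D) z)"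
    "\<And>z. z \<in> uhp \<Longrightarrow> jfac h (moebius (A, B, 0, D) z) * of_int D = jfac g z"
proof (cases g)
  case (fields a b c d)
  define M where "M = (int \<delta> * a, int \<delta> * b, c, d)"
  have det: "mat_det M = int \<delta>" 
  proof -
    have "int \<delta> * a * d - int \<delta> * b * c = int \<delta> * (a * d - b * c)" by (simp add: algebra_simps)
    then show ?thesis using g by (simp add: M_def SL2_def fields)
  qed
  define A where "A = gcd (int \<delta> * a) c"
  have "int \<delta> * a \<noteq> 0 \<or> c \<noteq> 0" using det \<delta> by (auto simp: M_def)
  then have A: "A > 0" by (auto simp: A_def)
  obtain a' c' where ac: "int \<delta> * a = a' * A" "c = c' * A" "coprime a' c'"
    using gcd_coprime_exists[of "int \<delta> * a" c] A unfolding A_def by auto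
  obtain x w where h: "(a', x, c', w) \<in> SL2" by (rule SL2_complete_column[OF ac(3)])
  \<comment> \<open>B and D form the right column of the inverse of (a', x, c', w) times M; its left
    column is (A, 0).\<close>
  define B where "B = w * (int \<delta> * b) - x * d"
  define D where "D = - c' * (int \<delta> * b) + a' * d"
  have hd: "a' * w - x * c' = 1" using h by (simp add: SL2_def)
  have Meq: "M = mat_mult (a', x, c', w) (A, B, 0, D)"
  proof -
    have "a' * B + x * D = (a' * w - x * c') * (int \<delta> * b)" "c' * B + w * D = (a' * w - x * c') * d"
      by (simp_all add: B_def D_def algebra_simps)
    then show ?thesis using ac hd by (simp add: M_def)
  qed
  have AD: "A * D = int \<delta>" using det h unfolding Meq mat_det_mult by (simp add: SL2_def)
  have D: "D > 0" using AD A \<delta> by (metis of_nat_0_less_iff zero_less_mult_pos)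
  have detT: "mat_det (A, B, 0, D) > 0" using A D by simp
  show ?thesis
  proof (rule that[OF h A D AD])
    show "fst (snd (snd (a', x, c', w))) * A = fst (snd (snd g))" using ac by (simp add: fields)
    fix z assume z: "z \<in> uhp"
    show "moebius (A, B, 0, D) z \<in> uhp" by (rule moebius_uhp[OF detT z])
    have "of_nat \<delta> * moebius g z = moebius M z"
      by (simp add: fields M_def algebra_simps)
    then show "of_nat \<delta> * moebius g z = moebius (a', x, c', w) (moebius (A, B, 0, D) z)"
      unfolding Meq moebius_mult[OF detT z] .
    have "jfac M z = jfac g z" by (simp add: fields M_def)
    then show "jfac (a', x, c', w) (moebius (A, B, 0, D) z) * of_int D = jfac g z"
      using jfac_mult[OF detT z, of "(a', x, c', w)"] by (simp add: Meq)
  qed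
qed

text \<open>Conjugation by diag (\<delta>, 1) multiplies b by \<delta> and divides c by it, so it
  keeps the entries integral when \<delta> divides c.\<close>

lemma Gamma0_scaled:
  assumes g: "g \<in> Gamma0 \<delta>" and \<delta>: "\<delta> > 0"
  obtains h where "h \<in> SL2" "fst (snd (snd h)) * int \<delta> = fst (snd (snd g))"
    "\<And>z. of_nat \<delta> * moebius g z = moebius h (of_nat \<delta> * z)" "\<And>z. jfac h (of_nat \<delta> * z) = jfac g z"
proof (cases g)
  case (fields a b c d)
  then obtain e where e: "c = int \<delta> * e" using g by (auto simp: Gamma0_def)
  show ?thesis
    by (rule that[of "(a, int \<delta> * b, e, d)"])
       (use g in \<open>auto simp: Gamma0_def SL2_def fields e algebra_simps\<close>)
qed

text \<open>From A \<ge> 1 follows A / D \<ge> 1 / (A D) = 1 / \<delta>.\<close>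

lemma Im_upper_triangular:
  assumes "A > 0" "D > 0" "A * D = int \<delta>" "Im z \<ge> y" "y > 0"
  shows "Im (moebius (A, B, 0, D) z) \<ge> y / real \<delta>"
proof -
  have "1 / real \<delta> = (1 / of_int A) / of_int D"
    using assms(3) by (metis divide_divide_eq_left of_int_mult of_int_of_nat_eq)
  also have "\<dots> \<le> of_int A / of_int D"
  proof (rule divide_right_mono)
    have "1 / real_of_int A \<le> 1" using assms(1) by simp
    also have "1 \<le> real_of_int A" using assms(1) by linarith
    finally show "1 / real_of_int A \<le> real_of_int A" .
  qed (use assms(2) in simp)
  finally have "1 / real \<delta> * y \<le> of_int A / of_int D * Im z"
    using assms by (intro mult_mono) auto
  moreover have "Im (moebius (A, B, 0, D) z) = of_int A / of_int D * Im z"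
  proof -
    have "Im (w / of_int D) = Im w / of_int D" for w
      using Im_divide_of_real[of w "of_int D"] by (simp only: of_real_of_int_eq)
    then show ?thesis by simp
  qed
  ultimately show ?thesis by simp
qed

text \<open>At a cusp given by g, the point \<delta> g z is h applied to an upper triangular image
  of z. The automorphy factors differ only by D \<ge> 1, and the height drops at most by the factor
  \<delta>, so a bound of f near infinity is enough.\<close>

lemma mform_dilate:
  assumes f: "mform k 1 f" and \<delta>: "\<delta> > 0"
  shows "mform k \<delta> (\<lambda>z. f (of_nat \<delta> * z))"
proof -
  have SL2: "f (moebius h w) = jfac h w ^ k * f w" if "h \<in> SL2" "w \<in> uhp" for h w
    using mformD(2)[OF f, of h w] that by (simp add: Gamma0_def)
  show ?thesis
  proof (rule mformI)
    show "(\<lambda>z. f (of_nat \<delta> * z)) holomorphic_on uhp"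
      by (rule holomorphic_on_compose_gen[OF _ mformD(1)[OF f], unfolded o_def])
         (use \<delta> in \<open>auto intro!: holomorphic_intros\<close>)
    fix g z assume g: "g \<in> Gamma0 \<delta>" and z: "z \<in> uhp"
    obtain h where h: "h \<in> SL2" "\<And>z. of_nat \<delta> * moebius g z = moebius h (of_nat \<delta> * z)"
      "\<And>z. jfac h (of_nat \<delta> * z) = jfac g z"
      using Gamma0_scaled[OF g \<delta>] by metis
    show "f (of_nat \<delta> * moebius g z) = jfac g z ^ k * f (of_nat \<delta> * z)"
      using SL2[OF h(1), of "of_nat \<delta> * z"] z \<delta> by (simp add: h)
  next
    fix g y assume g: "g \<in> SL2" and y: "y > (0::real)"
    obtain h A B D where h: "h \<in> SL2" "A > 0" "D > 0" "A * D = int \<delta>"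
      "\<And>z. z \<in> uhp \<Longrightarrow> moebius (A, B, 0, D) z \<in> uhp"
      "\<And>z. z \<in> uhp \<Longrightarrow> of_nat \<delta> * moebius g z = moebius h (moebius (A, B, 0, D) z)"
      "\<And>z. z \<in> uhp \<Longrightarrow> jfac h (moebius (A, B, 0, D) z) * of_int D = jfac g z"
      using scaled_moebius[OF g \<delta>] by metis
    have "(1, 0, 0, 1) \<in> SL2" by (simp add: SL2_def)
    from mform_bound[OF f this, of "y / real \<delta>"] obtain K where
      K: "K > 0" "\<And>z. Im z \<ge> y / real \<delta> \<Longrightarrow> norm (f z) \<le> K"
      using y \<delta> by auto
    have "norm (f (of_nat \<delta> * moebius g z)) \<le> K * norm (jfac g z) ^ k" if z: "Im z \<ge> y" for z
    proof -
      have zu: "z \<in> uhp" using z y by simp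
      let ?w = "moebius (A, B, 0, D) z"
      have "norm (f (of_nat \<delta> * moebius g z)) = norm (jfac h ?w) ^ k * norm (f ?w)"
        unfolding h(6)[OF zu] SL2[OF h(1) h(5)[OF zu]] norm_mult norm_power ..
      also have "\<dots> \<le> norm (jfac g z) ^ k * K"
      proof (intro mult_mono power_mono)
        have "norm (jfac h ?w) * 1 \<le> norm (jfac h ?w) * of_int D"
          using h(3) by (intro mult_left_mono) auto
        also have "\<dots> = norm (jfac h ?w * of_int D)" using h(3) by (simp add: norm_mult)
        finally show "norm (jfac h ?w) \<le> norm (jfac g z)" unfolding h(7)[OF zu] by simp
        show "norm (f ?w) \<le> K" by (rule K(2)[OF Im_upper_triangular[OF h(2-4) z y]])
      qed auto
      finally show ?thesis by (simp add: mult.commute)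
    qed
    then show "\<exists>B. \<forall>z. Im z \<ge> y \<longrightarrow> norm (f (of_nat \<delta> * moebius g z)) \<le> B * norm (jfac g z) ^ k" by blast
  qed
qed

lemma qexp_L:
  assumes "d > 0"
  shows "qexp ((1 - fps_const 24 * sigma_fps 1) - fps_const (of_nat d) * fps_dilate d (1 - fps_const 24 * sigma_fps 1)) (L d)"
  using qexp_diff[OF qexp_E2 qexp_cmult[OF qexp_dilate[OF qexp_E2 assms], of "of_nat d"]]
  by (simp add: L_def[abs_def])

text \<open>The non-modular terms of E2 z and of \<delta> E2 (\<delta> z) coincide, since the lower
  left entries satisfy c_h A = c_g and A D = \<delta>. The same cancellation yields the
  transformation law on the group and the bound at every cusp.\<close>

lemma mform_L:
  assumes \<delta>: "\<delta> > 0"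
  shows "mform 2 \<delta> (L \<delta>)"
proof (rule mformI)
  let ?\<kappa> = "6 / (of_real pi * \<i>) :: complex"
  show "L \<delta> holomorphic_on uhp" by (rule qexp_holomorphic[OF qexp_L[OF \<delta>]])
  {
    fix g z assume g: "g \<in> Gamma0 \<delta>" and z: "z \<in> uhp"
    obtain h where h: "h \<in> SL2" "fst (snd (snd h)) * int \<delta> = fst (snd (snd g))"
      "\<And>z. of_nat \<delta> * moebius g z = moebius h (of_nat \<delta> * z)" "\<And>z. jfac h (of_nat \<delta> * z) = jfac g z"
      using Gamma0_scaled[OF g \<delta>] by metis
    have c: "of_int (fst (snd (snd h))) * of_nat \<delta> = (of_int (fst (snd (snd g))) :: complex)"
      by (metis h(2) of_int_mult of_int_of_nat_eq)
    have dz: "of_nat \<delta> * z \<in> uhp" using z \<delta> by simp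
    have "L \<delta> (moebius g z) = (jfac g z)\<^sup>2 * L \<delta> z +
        ?\<kappa> * jfac g z * (of_int (fst (snd (snd g))) - of_int (fst (snd (snd h))) * of_nat \<delta>)"
      unfolding L_def E2_SL2[OF Gamma0_SL2[OF g] z] h(3) E2_SL2[OF h(1) dz] h(4) by (simp add: ring_distribs mult_ac)
    then show "L \<delta> (moebius g z) = jfac g z ^ 2 * L \<delta> z" by (simp add: c)
  }
  fix g y assume g: "g \<in> SL2" and y: "y > (0::real)"
  obtain h A B D where h: "h \<in> SL2" "A > 0" "D > 0" "A * D = int \<delta>"
    "\<And>z. z \<in> uhp \<Longrightarrow> moebius (A, B, 0, D) z \<in> uhp"
    "\<And>z. z \<in> uhp \<Longrightarrow> of_nat \<delta> * moebius g z = moebius h (moebius (A, B, 0, D) z)"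
    "\<And>z. z \<in> uhp \<Longrightarrow> jfac h (moebius (A, B, 0, D) z) * of_int D = jfac g z"
    and hc: "fst (snd (snd h)) * A = fst (snd (snd g))"
    using scaled_moebius[OF g \<delta>] by metis
  obtain K where K: "K > 0" "\<And>z. Im z \<ge> y / real \<delta> \<Longrightarrow> norm (E2 z) \<le> K"
    using qexp_bounded[OF qexp_E2, of "y / real \<delta>"] y \<delta> by auto
  obtain K' where K': "K' > 0" "\<And>z. Im z \<ge> y \<Longrightarrow> norm (E2 z) \<le> K'"
    using qexp_bounded[OF qexp_E2 y] by auto
  have "norm (L \<delta> (moebius g z)) \<le> (K' + real \<delta> * K) * norm (jfac g z) ^ 2" if z: "Im z \<ge> y" for z
  proof -
    have zu: "z \<in> uhp" using z y by simp
    let ?w = "moebius (A, B, 0, D) z" and ?j = "jfac g z"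
    let ?c = "of_int (fst (snd (snd h))) :: complex"
    have D0: "of_int D \<noteq> (0 :: complex)" using h(3) by simp
    have jh: "jfac h ?w = ?j / of_int D" using h(7)[OF zu] D0 by (simp add: field_simps)
    have \<delta>': "of_nat \<delta> = (of_int A * of_int D :: complex)" by (metis h(4) of_int_mult of_int_of_nat_eq)
    have c: "of_int (fst (snd (snd g))) = ?c * of_int A" by (metis hc of_int_mult)
    have "L \<delta> (moebius g z) = (?j\<^sup>2 * E2 z + ?\<kappa> * (?c * of_int A) * ?j) -
        of_nat \<delta> * ((?j / of_int D)\<^sup>2 * E2 ?w + ?\<kappa> * ?c * (?j / of_int D))"
      unfolding L_def E2_SL2[OF g zu] h(6)[OF zu] E2_SL2[OF h(1) h(5)[OF zu]] jh c ..
    also have "of_nat \<delta> * ((?j / of_int D)\<^sup>2 * E2 ?w + ?\<kappa> * ?c * (?j / of_int D)) =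
        ?j\<^sup>2 * (of_nat \<delta> / (of_int D)\<^sup>2 * E2 ?w) + ?\<kappa> * (?c * of_int A) * ?j"
    proof -
      have "A * D * ((j / D)\<^sup>2 * E + c / \<kappa> * c' * (j / D)) = j\<^sup>2 * (A * D / D\<^sup>2 * E) + c / \<kappa> * (c' * A) * j"
        if "D \<noteq> 0" for A D j E \<kappa> c c' :: complex
        using that by (simp add: power2_eq_square algebra_simps)
      from this[OF D0] show ?thesis unfolding \<delta>' .
    qed
    also have "(?j\<^sup>2 * E2 z + ?\<kappa> * (?c * of_int A) * ?j) -
        (?j\<^sup>2 * (of_nat \<delta> / (of_int D)\<^sup>2 * E2 ?w) + ?\<kappa> * (?c * of_int A) * ?j) =
        ?j\<^sup>2 * (E2 z - of_nat \<delta> / (of_int D)\<^sup>2 * E2 ?w)"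
      by (simp add: algebra_simps)
    finally have eq: "L \<delta> (moebius g z) = ?j\<^sup>2 * (E2 z - of_nat \<delta> / (of_int D)\<^sup>2 * E2 ?w)" .
    have "norm (E2 z - of_nat \<delta> / (of_int D)\<^sup>2 * E2 ?w) \<le> norm (E2 z) + norm (of_nat \<delta> / (of_int D)\<^sup>2 * E2 ?w)"
      by (rule norm_triangle_ineq4)
    also have "\<dots> \<le> K' + real \<delta> * K"
    proof (intro add_mono K' z)
      have "norm (of_nat \<delta> / (of_int D)\<^sup>2 :: complex) \<le> real \<delta> / 1"
        unfolding norm_divide norm_power norm_of_nat norm_of_int
        using h(3) by (intro divide_left_mono) (auto intro: one_le_power)
      then show "norm (of_nat \<delta> / (of_int D)\<^sup>2 * E2 ?w) \<le> real \<delta> * K"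
        unfolding norm_mult using K(1)
        by (intro mult_mono K(2)[OF Im_upper_triangular[OF h(2-4) z y]]) auto
    qed
    finally have le: "norm (E2 z - of_nat \<delta> / (of_int D)\<^sup>2 * E2 ?w) \<le> K' + real \<delta> * K" .
    show ?thesis
      unfolding eq norm_mult[of "?j\<^sup>2"] norm_power
      by (subst mult.commute) (intro mult_right_mono le zero_le_power norm_ge_zero)
  qed
  then show "\<exists>B. \<forall>z. Im z \<ge> y \<longrightarrow> norm (L \<delta> (moebius g z)) \<le> B * norm (jfac g z) ^ 2" by blast
qed

section \<open>Reduction to the fundamental domain\<close>

text \<open>A bottom row with |c z + d| minimal maximizes the height. After a translation, an image
  lower than 1/2 would have norm below 1, as 1/4 + 1/4 < 1, and then the top row would be shorter
  than the bottom row.\<close>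

lemma fundamental_reduction:
  assumes z: "z \<in> uhp"
  obtains g where "g \<in> SL2" "Im (moebius g z) \<ge> 1 / 2" "\<bar>Re (moebius g z)\<bar> \<le> 1 / 2"
proof -
  obtain \<epsilon> where \<epsilon>: "\<epsilon> > 0" "\<And>t x :: real. t \<ge> 0 \<Longrightarrow> \<epsilon> * (t + \<bar>x\<bar>) \<le> norm (of_real t * z + of_real x)"
    using lattice_lower_bound[OF z] by metis
  have low: "\<epsilon> * (\<bar>of_int c\<bar> + \<bar>of_int d\<bar>) \<le> norm (of_int c * z + of_int d)" for c d :: int
  proof (cases "c \<ge> 0")
    case True
    then show ?thesis using \<epsilon>(2)[of "of_int c" "of_int d"] by simp
  next
    case False
    have "norm (of_int c * z + of_int d) = norm (- (of_int c * z + of_int d))" by (simp only: norm_minus_cancel)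
    then show ?thesis using False \<epsilon>(2)[of "of_int (- c)" "of_int (- d)"] by simp
  qed
  define n where "n = \<lceil>1 / \<epsilon>\<rceil>"
  define A where "A = {(c, d). (c, d) \<noteq> (0, 0) \<and> norm (of_int c * z + of_int d) \<le> 1}"
  have "A \<subseteq> {- n..n} \<times> {- n..n}"
  proof
    fix x assume "x \<in> A"
    then obtain c d where cd: "x = (c, d)" "norm (of_int c * z + of_int d) \<le> 1" by (auto simp: A_def)
    then have "\<epsilon> * (\<bar>of_int c\<bar> + \<bar>of_int d\<bar>) \<le> 1" using low[of c d] by simp
    then have "\<bar>of_int c\<bar> + \<bar>of_int d\<bar> \<le> 1 / \<epsilon>" using \<epsilon>(1) by (simp add: field_simps)
    also have "\<dots> \<le> of_int n" by (simp add: n_def)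
    finally have "\<bar>c\<bar> + \<bar>d\<bar> \<le> n" by (simp flip: of_int_abs of_int_add)
    then show "x \<in> {- n..n} \<times> {- n..n}" using cd by auto
  qed
  then have finA: "finite A" by (rule finite_subset) simp
  \<comment> \<open>So A is nonempty; pairs outside A have norm above 1, hence a minimum over the
    finite A is a minimum over all nonzero pairs.\<close>
  have "(0, 1) \<in> A" by (simp add: A_def)
  define N where "N = (\<lambda>(c, d). norm (of_int c * z + of_int d))"
  obtain x where x: "x \<in> A" "\<And>y. y \<in> A \<Longrightarrow> N x \<le> N y"
    using ex_is_arg_min_if_finite[OF finA, of N] \<open>(0, 1) \<in> A\<close> by (auto simp: is_arg_min_linorder)
  obtain c d where cd: "x = (c, d)" by (cases x)
  have min: "norm (of_int c * z + of_int d) \<le> norm (of_int c' * z + of_int d')" if "(c', d') \<noteq> (0, 0)" for c' d' :: int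
  proof (cases "(c', d') \<in> A")
    case True
    then show ?thesis using x(2)[OF True] by (simp add: N_def cd)
  next
    case False
    then show ?thesis using x(1) that by (auto simp: A_def cd)
  qed
  have nz: "(c, d) \<noteq> (0, 0)" using x(1) by (auto simp: A_def cd)
  have cdpos: "norm (of_int c * z + of_int d) > 0"
  proof -
    have "\<bar>of_int c\<bar> + \<bar>of_int d\<bar> > (0 :: real)" using nz by auto
    then show ?thesis using low[of c d] \<epsilon>(1) by (meson less_le_trans mult_pos_pos)
  qed
  \<comment> \<open>Dividing a minimal row by its gcd would make it shorter.\<close>
  have "coprime c d"
  proof (rule ccontr)
    assume "\<not> coprime c d"
    define e where "e = gcd c d"
    have e: "e > 1" using nz \<open>\<not> coprime c d\<close> unfolding e_def coprime_iff_gcd_eq_1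
      by (smt (verit) gcd_eq_0_iff gcd_ge_0_int prod.inject)
    have "gcd c d \<noteq> 0" using e unfolding e_def by linarith
    from gcd_coprime_exists[OF this] obtain c' d' where c': "c = c' * e" "d = d' * e"
      unfolding e_def by blast
    have "norm (of_int c * z + of_int d) = of_int e * norm (of_int c' * z + of_int d')"
    proof -
      have "of_int c * z + of_int d = of_int e * (of_int c' * z + of_int d')"
        unfolding c' by (simp add: algebra_simps)
      then show ?thesis using e by (simp only: norm_mult norm_of_int)
    qed
    moreover have "norm (of_int c * z + of_int d) \<le> norm (of_int c' * z + of_int d')"
      by (rule min) (use nz c' in auto)
    moreover have "norm (of_int c' * z + of_int d') > 0"
      using calculation(1) cdpos e by (simp add: zero_less_mult_iff)
    ultimately show False using e by (simp add: mult_le_cancel_right1)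
  qed
  then obtain u v where uv: "u * c + v * d = 1" using bezout_int[of c d] by (auto simp: coprime_iff_gcd_eq_1)
  define g0 where "g0 = (v, - u, c, d)"
  have g0: "g0 \<in> SL2" using uv by (simp add: g0_def SL2_def algebra_simps)
  define n where "n = round (Re (moebius g0 z))"
  define g where "g = mat_mult (1, - n, 0, 1) g0"
  have T: "(1, - n, 0, 1) \<in> SL2" by (simp add: SL2_def)
  have g: "g \<in> SL2" unfolding g_def by (rule SL2_mult[OF T g0])
  have w: "moebius g z = moebius g0 z - of_int n"
    unfolding g_def moebius_mult[OF SL2_det[OF g0] z] by simp
  have Re: "\<bar>Re (moebius g z)\<bar> \<le> 1 / 2"
    using of_int_round_abs_le[of "Re (moebius g0 z)"] by (simp add: w n_def abs_minus_commute)
  have "Im (moebius g z) \<ge> 1 / 2"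
  proof (rule ccontr)
    assume small: "\<not> Im (moebius g z) \<ge> 1 / 2"
    have Impos: "Im (moebius g z) > 0" using moebius_uhp[OF SL2_det[OF g] z] by simp
    define a b where "a = v - n * c" and "b = - u - n * d"
    have gab: "g = (a, b, c, d)" by (simp add: g_def g0_def a_def b_def)
    have "(norm (moebius g z))\<^sup>2 = (Re (moebius g z))\<^sup>2 + (Im (moebius g z))\<^sup>2" by (rule cmod_power2)
    also have "(Re (moebius g z))\<^sup>2 \<le> (1 / 2)\<^sup>2" using Re by (subst abs_le_square_iff[symmetric]) auto
    also have "(Im (moebius g z))\<^sup>2 \<le> (1 / 2)\<^sup>2" using Impos small by (intro power_mono) auto
    also have "(1 / 2)\<^sup>2 + (1 / 2)\<^sup>2 < (1 :: real)\<^sup>2" by (simp add: power2_eq_square)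
    finally have "norm (moebius g z) < 1" by (simp only: power2_less_imp_less)
    moreover have "norm (of_int a * z + of_int b) = norm (moebius g z) * norm (of_int c * z + of_int d)"
      using cdpos by (simp add: gab norm_divide)
    moreover have "norm (of_int c * z + of_int d) \<le> norm (of_int a * z + of_int b)"
      by (rule min) (use g in \<open>auto simp: gab SL2_def\<close>)
    ultimately show False using cdpos by (simp add: mult_le_cancel_right1)
  qed
  then show ?thesis using that g Re by blast
qed

text \<open>If G z0 is nonzero, the decay makes |G| smaller than |G z0| above some height Y. By
  \<open>fundamental_reduction\<close> a maximum of |G| over the compact rectangle S is then a
  maximum over the whole half plane, so G is constant, which contradicts the decay.\<close>

lemma SL2_invariant_zero:
  assumes G: "G holomorphic_on uhp"
    and inv: "\<And>g z. g \<in> SL2 \<Longrightarrow> z \<in> uhp \<Longrightarrow> norm (G (moebius g z)) = norm (G z)"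
    and bound: "\<And>z. Im z \<ge> 1 / 2 \<Longrightarrow> norm (G z) \<le> K * norm (nome z)"
    and z0: "z0 \<in> uhp"
  shows "G z0 = 0"
proof (rule ccontr)
  assume "G z0 \<noteq> 0"
  then have pos: "norm (G z0) > 0" by simp
  have "((\<lambda>y. K * exp (- (2 * pi * y))) \<longlongrightarrow> 0) at_top"
    by real_asymp
  then have "\<forall>\<^sub>F y in at_top. K * exp (- (2 * pi * y)) < norm (G z0)"
    using pos by (rule order_tendstoD)
  then obtain Y where Y: "\<And>y. y \<ge> Y \<Longrightarrow> K * exp (- (2 * pi * y)) < norm (G z0)"
    by (auto simp: eventually_at_top_linorder)
  define S where "S = cbox (Complex (- 1 / 2) (1 / 2)) (Complex (1 / 2) Y)"
  have S: "w \<in> S \<longleftrightarrow> \<bar>Re w\<bar> \<le> 1 / 2 \<and> 1 / 2 \<le> Im w \<and> Im w \<le> Y" for w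
    by (auto simp: S_def in_cbox_complex_iff)
  have small: "norm (G w) < norm (G z0)" if "Im w \<ge> 1 / 2" "Im w \<ge> Y" for w
    using bound[OF that(1)] Y[OF that(2)] by (simp add: norm_nome)
  have red: "\<exists>w. (w \<in> S \<or> norm (G w) < norm (G z0)) \<and> norm (G w) = norm (G z)" if z: "z \<in> uhp" for z
  proof -
    obtain g where g: "g \<in> SL2" "Im (moebius g z) \<ge> 1 / 2" "\<bar>Re (moebius g z)\<bar> \<le> 1 / 2"
      by (rule fundamental_reduction[OF z])
    have "moebius g z \<in> S \<or> norm (G (moebius g z)) < norm (G z0)"
      using g(2,3) small[of "moebius g z"] by (cases "Im (moebius g z) \<le> Y") (auto simp: S)
    then show ?thesis using inv[OF g(1) z] by blast
  qed
  obtain w0 where w0: "w0 \<in> S" "norm (G w0) = norm (G z0)" using red[OF z0] by auto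
  have Su: "S \<subseteq> uhp" by (auto simp: S)
  have "compact S" by (simp add: S_def)
  moreover have "continuous_on S (\<lambda>w. norm (G w))"
    by (intro continuous_intros holomorphic_on_imp_continuous_on holomorphic_on_subset[OF G Su])
  ultimately obtain \<xi> where \<xi>: "\<xi> \<in> S" "\<And>w. w \<in> S \<Longrightarrow> norm (G w) \<le> norm (G \<xi>)"
    using continuous_attains_sup[of S "\<lambda>w. norm (G w)"] w0(1) by blast
  have max: "norm (G z) \<le> norm (G \<xi>)" if z: "z \<in> uhp" for z
    using red[OF z] \<xi>(2) \<xi>(2)[OF w0(1)] w0(2) by fastforce
  have "G constant_on uhp"
    by (rule maximum_modulus_principle[OF G open_uhp connected_uhp open_uhp subset_refl _ max])
       (use \<xi>(1) Su in auto)
  then obtain c where c: "\<And>z. z \<in> uhp \<Longrightarrow> G z = c" by (auto simp: constant_on_def)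
  define w where "w = Complex 0 (max 1 Y)"
  have "norm (G w) < norm (G z0)" by (rule small) (auto simp: w_def)
  then show False using c[OF z0] c[of w] by (simp add: w_def)
qed

section \<open>Cosets of \<open>\<Gamma>\<^sub>0(N)\<close>\<close>

lemma Gamma0_mult: "g \<in> Gamma0 N \<Longrightarrow> h \<in> Gamma0 N \<Longrightarrow> mat_mult g h \<in> Gamma0 N"
  using SL2_mult[of g h] by (cases g; cases h) (simp add: Gamma0_def)

lemma Gamma0_adj: "g \<in> Gamma0 N \<Longrightarrow> mat_adj g \<in> Gamma0 N"
  by (cases g) (simp add: Gamma0_def SL2_def algebra_simps)

lemma one_Gamma0: "(1, 0, 0, 1) \<in> Gamma0 N"
  by (simp add: Gamma0_def SL2_def)

text \<open>Cosets are kept as sets of matrices, so right multiplication acts on them without a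
  choice of representatives.\<close>

definition coset :: "nat \<Rightarrow> mat2 \<Rightarrow> mat2 set" where
  "coset N g = (\<lambda>\<gamma>. mat_mult \<gamma> g) ` Gamma0 N"

definition cosets :: "nat \<Rightarrow> mat2 set set" where
  "cosets N = coset N ` SL2"

lemma coset_self: "g \<in> coset N g"
  using one_Gamma0 by (force simp: coset_def)

lemma coset_subset: "g \<in> SL2 \<Longrightarrow> coset N g \<subseteq> SL2"
  unfolding coset_def by (rule image_subsetI) (rule SL2_mult[OF Gamma0_SL2])

lemma coset_eqI:
  assumes "\<gamma> \<in> Gamma0 N" "g \<in> SL2"
  shows "coset N (mat_mult \<gamma> g) = coset N g"
proof -
  have "mat_mult \<delta> g \<in> coset N (mat_mult \<gamma> g)" if "\<delta> \<in> Gamma0 N" for \<delta>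
  proof -
    have "mat_mult \<delta> g = mat_mult (mat_mult \<delta> (mat_adj \<gamma>)) (mat_mult \<gamma> g)"
      using mat_adj_mult(1)[OF Gamma0_SL2[OF assms(1)]] by (metis mat_mult_assoc mat_mult_one(1))
    then show ?thesis using that assms(1) by (auto simp: coset_def intro!: Gamma0_mult Gamma0_adj)
  qed
  moreover have "mat_mult \<delta> (mat_mult \<gamma> g) \<in> coset N g" if "\<delta> \<in> Gamma0 N" for \<delta>
    using Gamma0_mult[OF that assms(1)] by (auto simp: coset_def mat_mult_assoc[symmetric])
  ultimately show ?thesis by (auto simp: coset_def)
qed

lemma coset_right:
  assumes "g \<in> SL2" "h \<in> SL2"
  shows "(\<lambda>x. mat_mult x h) ` coset N g = coset N (mat_mult g h)"
  by (force simp: coset_def mat_mult_assoc image_image)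

text \<open>Right multiplication permutes the cosets; this makes a product over all cosets invariant
  under the full modular group.\<close>

lemma cosets_right_bij:
  assumes h: "h \<in> SL2"
  shows "bij_betw (\<lambda>X. (\<lambda>x. mat_mult x h) ` X) (cosets N) (cosets N)"
proof (rule bij_betwI[where g = "\<lambda>X. (\<lambda>x. mat_mult x (mat_adj h)) ` X"])
  have closed: "(\<lambda>X. (\<lambda>x. mat_mult x k) ` X) \<in> cosets N \<rightarrow> cosets N" if k: "k \<in> SL2" for k
  proof (rule Pi_I)
    fix X assume "X \<in> cosets N"
    then obtain g where g: "g \<in> SL2" "X = coset N g" unfolding cosets_def by blast
    show "(\<lambda>x. mat_mult x k) ` X \<in> cosets N"
      unfolding g(2) coset_right[OF g(1) k] cosets_def by (rule imageI[OF SL2_mult[OF g(1) k]])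
  qed
  show "(\<lambda>X. (\<lambda>x. mat_mult x h) ` X) \<in> cosets N \<rightarrow> cosets N"
    by (rule closed[OF h])
  show "(\<lambda>X. (\<lambda>x. mat_mult x (mat_adj h)) ` X) \<in> cosets N \<rightarrow> cosets N"
    by (rule closed[OF SL2_adj[OF h]])
qed (simp_all add: image_image mat_mult_assoc mat_adj_mult[OF h])

text \<open>The point of the projective line over \<open>\<int>/p\<close> given by the bottom row,
  with \<open>p\<close> standing for the point at infinity.\<close>

definition bottom_label :: "nat \<Rightarrow> mat2 \<Rightarrow> nat" where
  "bottom_label p g = (case g of (a, b, c, d) \<Rightarrow>
     if int p dvd d then p else (SOME t. t < p \<and> int p dvd c - int t * d))"

text \<open>Bezout's x inverts d modulo p, so t is the residue of c / d.\<close>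

lemma bottom_label_finite:
  assumes "prime p" "\<not> int p dvd d"
  shows "bottom_label p (a, b, c, d) < p" "int p dvd c - int (bottom_label p (a, b, c, d)) * d"
proof -
  have "coprime d (int p)"
    using assms prime_imp_coprime[of "int p" d] by (simp add: coprime_commute)
  then obtain x v where xv: "x * d + v * int p = 1"
    using bezout_int[of d "int p"] by (auto simp: coprime_iff_gcd_eq_1)
  define t where "t = nat ((c * x) mod int p)"
  have p: "p > 0" using assms(1) prime_gt_0_nat by blast
  have t: "int t = (c * x) mod int p" "t < p"
    using p by (auto simp: t_def nat_less_iff)
  have "c - int t * d = c * (x * d + v * int p) - int t * d" by (simp add: xv)
  also have "\<dots> = int p * (c * v) + (c * x - (c * x) mod int p) * d" by (simp add: t algebra_simps)
  finally have "int p dvd c - int t * d"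
    by (simp add: minus_mod_eq_mult_div)
  then have "\<exists>t. t < p \<and> int p dvd c - int t * d" using t(2) by blast
  from someI_ex[OF this] assms(2)
  show "bottom_label p (a, b, c, d) < p" "int p dvd c - int (bottom_label p (a, b, c, d)) * d"
    by (simp_all add: bottom_label_def)
qed

lemma bottom_label_le: "prime p \<Longrightarrow> bottom_label p g \<le> p"
  using bottom_label_finite(1)[of p] by (cases g; cases "int p dvd snd (snd (snd g))")
    (auto simp: less_imp_le bottom_label_def)

text \<open>Equal labels are equal points of the projective line, so the bottom rows are
  proportional modulo p and their determinant vanishes there.\<close>

lemma bottom_label_eqD:
  assumes p: "prime p" and eq: "bottom_label p (a, b, c, d) = bottom_label p (a', b', c', d')"
  shows "int p dvd c * d' - d * c'"
proof -
  consider "int p dvd d" "int p dvd d'" | "\<not> int p dvd d" "\<not> int p dvd d'"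
    | "int p dvd d \<longleftrightarrow> \<not> int p dvd d'" by blast
  then show ?thesis
  proof cases
    case 2
    define t where "t = int (bottom_label p (a, b, c, d))"
    have "int p dvd c - t * d"
      unfolding t_def by (rule bottom_label_finite(2)[OF p 2(1)])
    moreover have "int p dvd c' - t * d'"
      unfolding t_def eq by (rule bottom_label_finite(2)[OF p 2(2)])
    ultimately have "int p dvd (c - t * d) * d' - d * (c' - t * d')" by simp
    then show ?thesis by (simp add: algebra_simps)
  next
    case 3
    then have False
      using bottom_label_finite(1)[OF p, of d a b c] bottom_label_finite(1)[OF p, of d' a' b' c'] eq
      by (auto simp: bottom_label_def)
    then show ?thesis ..
  qed simp
qed

lemma prod_primes_dvd:
  assumes "finite P" "\<And>p. p \<in> P \<Longrightarrow> prime (p :: nat)" "\<And>p. p \<in> P \<Longrightarrow> int p dvd x"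
  shows "int (\<Prod>P) dvd x"
  using assms
proof (induction P rule: finite_induct)
  case (insert p P)
  have "coprime p (\<Prod>P)"
  proof (rule prod_coprime_right)
    fix i assume "i \<in> P"
    then show "coprime p i" using insert.hyps(2) insert.prems(1) by (intro primes_coprime) auto
  qed
  then have "coprime (int p) (int (\<Prod>P))" by (simp only: coprime_int_iff)
  then have "int p * int (\<Prod>P) dvd x" using insert by (intro divides_mult) auto
  then show ?case using insert.hyps by simp
qed simp

text \<open>The number c d' - d c' is the lower left entry of g times the inverse of g'. If all
  labels agree, it is divisible by every p in P, hence by the product of these distinct primes, and
  the cosets coincide. So cosets embed into a product of projective lines with p + 1 points
  each.\<close>

lemma cosets_finite_card:
  assumes "finite P" "\<And>p. p \<in> P \<Longrightarrow> prime (p :: nat)"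
  shows "finite (cosets (\<Prod>P))" "card (cosets (\<Prod>P)) \<le> (\<Prod>p\<in>P. p + 1)"
proof -
  let ?N = "\<Prod>P" let ?E = "PiE P (\<lambda>p. {..p})"
  define rep where "rep X = (SOME g. g \<in> X)" for X :: "mat2 set"
  have rep: "rep X \<in> X" if X: "X \<in> cosets ?N" for X
  proof -
    obtain g where "X = coset ?N g" using X unfolding cosets_def by blast
    then have "g \<in> X" using coset_self by simp
    then show ?thesis unfolding rep_def by (rule someI)
  qed
  have repSL: "rep X \<in> SL2" "X = coset ?N (rep X)" if "X \<in> cosets ?N" for X
  proof -
    obtain g where g: "g \<in> SL2" "X = coset ?N g" using \<open>X \<in> cosets ?N\<close> by (auto simp: cosets_def)
    with rep[OF that] coset_subset[OF g(1)] show "rep X \<in> SL2" by blast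
    from rep[OF that] g obtain \<gamma> where "\<gamma> \<in> Gamma0 ?N" "rep X = mat_mult \<gamma> g" by (auto simp: coset_def)
    then show "X = coset ?N (rep X)" using coset_eqI g by simp
  qed
  define F where "F X = (\<lambda>p\<in>P. bottom_label p (rep X))" for X
  have img: "F ` cosets ?N \<subseteq> ?E"
    by (auto simp: F_def intro!: bottom_label_le assms(2))
  have inj: "inj_on F (cosets ?N)"
  proof (rule inj_onI)
    fix X Y assume X: "X \<in> cosets ?N" and Y: "Y \<in> cosets ?N" and eq: "F X = F Y"
    obtain a b c d where g: "rep X = (a, b, c, d)" by (cases "rep X")
    obtain a' b' c' d' where h: "rep Y = (a', b', c', d')" by (cases "rep Y")
    have "int p dvd c * d' - d * c'" if "p \<in> P" for p
    proof (rule bottom_label_eqD)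
      show "bottom_label p (a, b, c, d) = bottom_label p (a', b', c', d')"
        using fun_cong[OF eq, of p] that by (simp add: F_def g h)
    qed (use assms that in auto)
    then have "int ?N dvd c * d' - d * c'" using assms by (intro prod_primes_dvd)
    then have G: "mat_mult (rep X) (mat_adj (rep Y)) \<in> Gamma0 ?N"
      using SL2_mult[OF repSL(1)[OF X] SL2_adj[OF repSL(1)[OF Y]]]
      by (simp add: Gamma0_def g h)
    have "rep X = mat_mult (mat_mult (rep X) (mat_adj (rep Y))) (rep Y)"
      by (simp add: mat_mult_assoc mat_adj_mult repSL(1)[OF Y])
    then have "coset ?N (rep X) = coset ?N (rep Y)" using coset_eqI[OF G repSL(1)[OF Y]] by simp
    then show "X = Y" using repSL(2)[OF X] repSL(2)[OF Y] by simp
  qed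
  have finE: "finite ?E" by (intro finite_PiE assms) auto
  show "finite (cosets ?N)" by (rule inj_on_finite[OF inj img finE])
  have "card (cosets ?N) \<le> card ?E" by (rule card_inj_on_le[OF inj img finE])
  also have "card ?E = (\<Prod>p\<in>P. p + 1)" using assms(1) by (simp add: card_PiE)
  finally show "card (cosets ?N) \<le> (\<Prod>p\<in>P. p + 1)" .
qed

section \<open>Sturm's bound\<close>

text \<open>Factor by factor, |1 - q^n| \<ge> 1 - r^n with r = exp (-2 pi y), and the numbers 1 -
  r^n are the factors of the nonvanishing product at the point i y.\<close>

lemma Delta_lower_bound:
  assumes y: "y > 0"
  obtains c where "c > 0" "\<And>z. Im z \<ge> y \<Longrightarrow> c * norm (nome z) \<le> norm (Delta z)"
proof -
  define z0 where "z0 = Complex 0 y"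
  have z0: "z0 \<in> uhp" using y by (simp add: z0_def)
  let ?P = "\<lambda>z. \<Prod>n. 1 - nome z ^ Suc n"
  have lim: "(\<lambda>N. norm (\<Prod>n<N. 1 - nome w ^ Suc n)) \<longlonglongrightarrow> norm (?P w)" if "w \<in> uhp" for w
    using tendsto_uniform_limitI[OF eta_product_uniform(1)[OF that], of w] that by (intro tendsto_norm) auto
  define r where "r = exp (- (2 * pi * y))"
  have r: "0 \<le> r" "r \<le> 1" using y by (auto simp: r_def)
  have z0r: "nome z0 = of_real r"
  proof -
    have "2 * of_real pi * \<i> * z0 = of_real (- (2 * pi * y))"
      by (simp add: z0_def complex_eq_iff)
    then show ?thesis unfolding nome_def r_def by (simp only: exp_of_real)
  qed
  have le: "norm (?P z0) \<le> norm (?P z)" if z: "Im z \<ge> y" for z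
  proof (rule LIMSEQ_le[OF lim lim])
    have qr: "norm (nome z) \<le> r" using z by (simp add: norm_nome r_def)
    have "norm (\<Prod>n<N. 1 - nome z0 ^ Suc n) \<le> norm (\<Prod>n<N. 1 - nome z ^ Suc n)" for N
      unfolding prod_norm[symmetric]
    proof (intro prod_mono conjI norm_ge_zero)
      fix n
      have "norm (1 - nome z0 ^ Suc n) = \<bar>1 - r ^ Suc n\<bar>"
        unfolding z0r by (metis norm_of_real of_real_1 of_real_diff of_real_power)
      also have "\<dots> = 1 - r ^ Suc n" using r power_le_one[OF r, of "Suc n"] by simp
      also have "\<dots> \<le> 1 - norm (nome z ^ Suc n)"
        unfolding norm_power by (intro diff_left_mono power_mono qr) auto
      also have "\<dots> \<le> norm (1 - nome z ^ Suc n)"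
        using norm_triangle_ineq2[of 1 "nome z ^ Suc n"] by simp
      finally show "norm (1 - nome z0 ^ Suc n) \<le> norm (1 - nome z ^ Suc n)" .
    qed
    then show "\<exists>N. \<forall>n\<ge>N. norm (\<Prod>k<n. 1 - nome z0 ^ Suc k) \<le> norm (\<Prod>k<n. 1 - nome z ^ Suc k)" by blast
  qed (use z y z0 in auto)
  show ?thesis
  proof (rule that[of "norm (?P z0) ^ 24"])
    show "norm (?P z0) ^ 24 > 0" using eta_product_uniform(2)[OF z0] by simp
    show "norm (?P z0) ^ 24 * norm (nome z) \<le> norm (Delta z)" if "Im z \<ge> y" for z
      unfolding Delta_nome norm_mult norm_power
      using power_mono[OF le[OF that] norm_ge_zero, of 24] by (simp add: mult.commute mult_right_mono)
  qed
qed

lemma holomorphic_mult_eq_0: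
  assumes "f holomorphic_on uhp" "g holomorphic_on uhp" "\<And>z. z \<in> uhp \<Longrightarrow> f z * g z = 0"
    and "z0 \<in> uhp" "f z0 \<noteq> 0" "z \<in> uhp"
  shows "g z = 0"
proof -
  have "continuous_on uhp f" using assms(1) by (rule holomorphic_on_imp_continuous_on)
  then have "open (uhp \<inter> f -` (- {0}))"
    by (rule continuous_open_preimage[OF _ open_uhp]) auto
  moreover have "g w = 0" if "w \<in> uhp \<inter> f -` (- {0})" for w
    using assms(3)[of w] that by auto
  moreover have "uhp \<inter> f -` (- {0}) \<noteq> {}" using assms(4,5) by blast
  ultimately show ?thesis
    using analytic_continuation_open[of "uhp \<inter> f -` (- {0})" uhp g "\<lambda>_. 0" z]
      open_uhp connected_uhp assms(2,6) by (metis holomorphic_on_const inf_le1)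
qed

text \<open>Holomorphic functions on a connected open set form an integral domain.\<close>

lemma holomorphic_prod_eq_0:
  assumes "finite C" "\<And>X. X \<in> C \<Longrightarrow> f X holomorphic_on uhp"
    "\<And>z. z \<in> uhp \<Longrightarrow> (\<Prod>X\<in>C. f X z) = 0"
  shows "\<exists>X\<in>C. \<forall>z\<in>uhp. f X z = 0"
  using assms
proof (induction C rule: finite_induct)
  case empty
  have "\<i> \<in> uhp" by simp
  with empty(2) show ?case by fastforce
next
  case (insert X C)
  show ?case
  proof (cases "\<forall>z\<in>uhp. f X z = 0")
    case False
    then obtain z0 where z0: "z0 \<in> uhp" "f X z0 \<noteq> 0" by blast
    have "(\<Prod>X\<in>C. f X z) = 0" if "z \<in> uhp" for z
      by (rule holomorphic_mult_eq_0[where f = "f X", OF _ _ _ z0 that, where g = "\<lambda>z. \<Prod>X\<in>C. f X z"])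
         (use insert in \<open>auto intro!: holomorphic_intros\<close>)
    then show ?thesis using insert by auto
  qed auto
qed

text \<open>The norm G of \<phi> = f^12 / Delta^k is invariant under the full group. As |Delta| is
  at least a constant times |q| high up, every coset contributes at most |q|^(-k), and the identity
  coset at most |q|^(12 n - k). For 12 n > k * index, G decays and hence vanishes; then one factor
  vanishes identically, and f with it.\<close>

theorem sturm_bound:
  assumes P: "finite P" "\<And>p. p \<in> P \<Longrightarrow> prime (p :: nat)"
    and f: "mform k (\<Prod>P) f" and q: "qexp F f"
    and ord: "\<And>i. i < n \<Longrightarrow> fps_nth F i = 0" and n: "12 * n > k * (\<Prod>p\<in>P. p + 1)"
    and z: "z \<in> uhp"
  shows "f z = 0"
proof -
  let ?N = "\<Prod>P"
  let ?C = "cosets ?N"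
  note finC = cosets_finite_card(1)[OF P] and cardC = cosets_finite_card(2)[OF P]
  \<comment> \<open>The powers 12 and k equalize the weights of f and \<open>Delta\<close>, so
    \<phi> has weight 0.\<close>
  define \<phi> where "\<phi> w = f w ^ 12 / Delta w ^ k" for w
  define rep where "rep X = (SOME g. g \<in> X)" for X :: "mat2 set"
  define \<Phi> where "\<Phi> X w = \<phi> (moebius (rep X) w)" for X w
  have \<phi>_inv: "\<phi> (moebius \<gamma> w) = \<phi> w" if "\<gamma> \<in> Gamma0 ?N" "w \<in> uhp" for \<gamma> w
    using jfac_nonzero[OF SL2_det[OF Gamma0_SL2[OF that(1)]] that(2)]
    by (simp add: \<phi>_def mformD(2)[OF f that] Delta_SL2[OF Gamma0_SL2[OF that(1)] that(2)]
        power_mult_distrib flip: power_mult) (simp add: mult.commute)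
  have rep_coset: "rep (coset ?N g) \<in> coset ?N g" for g
    unfolding rep_def by (rule someI[of "\<lambda>h. h \<in> coset ?N g", OF coset_self])
  have repSL: "rep X \<in> SL2" "coset ?N (rep X) = X" if X: "X \<in> ?C" for X
  proof -
    obtain g where g: "g \<in> SL2" "X = coset ?N g" using X unfolding cosets_def by blast
    show "rep X \<in> SL2" using rep_coset[of g] coset_subset[OF g(1)] g(2) by blast
    obtain \<gamma> where "\<gamma> \<in> Gamma0 ?N" "rep X = mat_mult \<gamma> g" using rep_coset[of g] g(2) unfolding coset_def by blast
    then show "coset ?N (rep X) = X" using coset_eqI g by simp
  qed
  have \<Phi>_coset: "\<Phi> (coset ?N g) w = \<phi> (moebius g w)" if g: "g \<in> SL2" and w: "w \<in> uhp" for g w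
  proof -
    obtain \<gamma> where \<gamma>: "\<gamma> \<in> Gamma0 ?N" "rep (coset ?N g) = mat_mult \<gamma> g"
      using rep_coset[of g] unfolding coset_def by blast
    show ?thesis
      unfolding \<Phi>_def \<gamma>(2) moebius_mult[OF SL2_det[OF g] w]
      by (rule \<phi>_inv[OF \<gamma>(1) moebius_uhp[OF SL2_det[OF g] w]])
  qed
  define G where "G w = (\<Prod>X\<in>?C. \<Phi> X w)" for w
  have mob: "moebius g holomorphic_on uhp" if g: "g \<in> SL2" for g
    using jfac_nonzero[OF SL2_det[OF g]]
    by (cases g; auto intro!: holomorphic_intros simp: moebius.simps[abs_def])
  have \<Phi>_hol: "\<Phi> X holomorphic_on uhp" if X: "X \<in> ?C" for X
  proof -
    have "\<phi> holomorphic_on uhp"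
      unfolding \<phi>_def by (intro holomorphic_intros mformD(1)[OF f] Delta_holomorphic) (simp add: Delta_nonzero)
    then show ?thesis
      unfolding \<Phi>_def using moebius_uhp[OF SL2_det[OF repSL(1)[OF X]]]
      by (intro holomorphic_on_compose_gen[OF mob[OF repSL(1)[OF X]], unfolded o_def]) auto
  qed
  have G_hol: "G holomorphic_on uhp" unfolding G_def by (intro holomorphic_intros \<Phi>_hol)
  have G_inv: "G (moebius h w) = G w" if h: "h \<in> SL2" and w: "w \<in> uhp" for h w
  proof -
    have "\<Phi> X (moebius h w) = \<Phi> ((\<lambda>x. mat_mult x h) ` X) w" if X: "X \<in> ?C" for X
    proof -
      have "\<Phi> X (moebius h w) = \<phi> (moebius (mat_mult (rep X) h) w)"
        by (simp add: \<Phi>_def moebius_mult[OF SL2_det[OF h] w])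
      also have "\<dots> = \<Phi> (coset ?N (mat_mult (rep X) h)) w"
        by (rule \<Phi>_coset[OF SL2_mult[OF repSL(1)[OF X] h] w, symmetric])
      also have "coset ?N (mat_mult (rep X) h) = (\<lambda>x. mat_mult x h) ` X"
        using coset_right[OF repSL(1)[OF X] h, of ?N] repSL(2)[OF X] by simp
      finally show ?thesis .
    qed
    then have "G (moebius h w) = (\<Prod>X\<in>?C. \<Phi> ((\<lambda>x. mat_mult x h) ` X) w)" by (simp add: G_def)
    also have "\<dots> = G w"
      unfolding G_def by (rule prod.reindex_bij_betw[OF cosets_right_bij[OF h]])
    finally show ?thesis .
  qed
  obtain \<epsilon> where \<epsilon>: "\<epsilon> > 0" "\<And>w. Im w \<ge> 1 / 2 \<Longrightarrow> \<epsilon> * norm (nome w) \<le> norm (Delta w)"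
    using Delta_lower_bound[of "1 / 2"] by auto
  have Delta_pow: "1 / norm (Delta w) ^ k \<le> 1 / (\<epsilon> * norm (nome w)) ^ k" if "Im w \<ge> 1 / 2" for w
  proof -
    have a: "0 < \<epsilon> * norm (nome w)" using \<epsilon>(1) by simp
    note b = \<epsilon>(2)[OF that]
    show ?thesis
      by (intro divide_left_mono power_mono mult_pos_pos zero_less_power less_imp_le[OF a] a
          less_le_trans[OF a b] b zero_le_one)
  qed
  \<comment> \<open>Multiplication by |q|^k clears the pole that the k-th power of
    \<open>Delta\<close> can cause at infinity.\<close>
  have scale: "x * norm (nome w) ^ k \<le> b / \<epsilon> ^ k" if "x \<le> b * (1 / (\<epsilon> * norm (nome w)) ^ k)" for x b w
  proof -
    have "x * norm (nome w) ^ k \<le> b * (1 / (\<epsilon> * norm (nome w)) ^ k) * norm (nome w) ^ k"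
      by (rule mult_right_mono[OF that]) simp
    also have "\<dots> = b / \<epsilon> ^ k" by (simp add: power_mult_distrib)
    finally show ?thesis .
  qed
  have each: "\<exists>B. \<forall>w. Im w \<ge> 1 / 2 \<longrightarrow> norm (\<Phi> X w) * norm (nome w) ^ k \<le> B" if X: "X \<in> ?C" for X
  proof -
    note g = repSL(1)[OF X]
    obtain B where B: "B > 0" "\<And>w. Im w \<ge> 1 / 2 \<Longrightarrow> norm (f (moebius (rep X) w)) \<le> B * norm (jfac (rep X) w) ^ k"
      using mform_bound[OF f g, of "1 / 2"] by auto
    have "norm (\<Phi> X w) * norm (nome w) ^ k \<le> B ^ 12 / \<epsilon> ^ k" if w: "Im w \<ge> 1 / 2" for w
    proof -
      have wu: "w \<in> uhp" using w by simp
      let ?j = "norm (jfac (rep X) w)"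
      have j: "?j > 0" using jfac_nonzero[OF SL2_det[OF g] wu] by simp
      have "norm (\<Phi> X w) = norm (f (moebius (rep X) w)) ^ 12 / (?j ^ 12 * norm (Delta w)) ^ k"
        by (simp add: \<Phi>_def \<phi>_def Delta_SL2[OF g wu] norm_divide norm_power norm_mult)
      also have "\<dots> \<le> (B * ?j ^ k) ^ 12 / (?j ^ 12 * norm (Delta w)) ^ k"
        by (intro divide_right_mono power_mono B w) auto
      also have "\<dots> = B ^ 12 * (1 / norm (Delta w) ^ k)"
        using j by (simp add: power_mult_distrib mult.commute[of k] flip: power_mult)
      also have "\<dots> \<le> B ^ 12 * (1 / (\<epsilon> * norm (nome w)) ^ k)"
        using B(1) by (intro mult_left_mono Delta_pow w) auto
      finally show ?thesis by (rule scale)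
    qed
    then show ?thesis by blast
  qed
  then obtain B where B: "\<And>X w. X \<in> ?C \<Longrightarrow> Im w \<ge> 1 / 2 \<Longrightarrow> norm (\<Phi> X w) * norm (nome w) ^ k \<le> B X"
    by metis
  \<comment> \<open>Only at the identity coset is the order of vanishing known, from the given
    q-expansion; the other cosets enter through their boundedness.\<close>
  define X0 where "X0 = coset ?N (1, 0, 0, 1)"
  have oneSL: "(1, 0, 0, 1) \<in> SL2" by (simp add: SL2_def)
  have X0: "X0 \<in> ?C" using oneSL by (auto simp: X0_def cosets_def)
  obtain B0 where B0: "B0 > 0" "\<And>w. Im w \<ge> 1 / 2 \<Longrightarrow> norm (f w) \<le> B0 * norm (nome w) ^ n"
    using qexp_order_bound[where y = "1 / 2" and n = n, OF q ord] by auto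
  have first: "norm (\<Phi> X0 w) * norm (nome w) ^ k \<le> B0 ^ 12 / \<epsilon> ^ k * norm (nome w) ^ (12 * n)" if w: "Im w \<ge> 1 / 2" for w
  proof -
    have wu: "w \<in> uhp" using w by simp
    have "norm (\<Phi> X0 w) = norm (f w) ^ 12 * (1 / norm (Delta w) ^ k)"
      unfolding X0_def \<Phi>_coset[OF oneSL wu] by (simp add: \<phi>_def norm_divide norm_power)
    also have "\<dots> \<le> (B0 * norm (nome w) ^ n) ^ 12 * (1 / (\<epsilon> * norm (nome w)) ^ k)"
      by (intro mult_mono power_mono B0 Delta_pow w) auto
    finally have "norm (\<Phi> X0 w) * norm (nome w) ^ k \<le> (B0 * norm (nome w) ^ n) ^ 12 / \<epsilon> ^ k"
      by (rule scale)
    also have "(B0 * norm (nome w) ^ n) ^ 12 / \<epsilon> ^ k = B0 ^ 12 / \<epsilon> ^ k * norm (nome w) ^ (12 * n)"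
      by (simp add: power_mult_distrib power_mult[symmetric] mult.commute[of n])
    finally show ?thesis .
  qed
  define K where "K = B0 ^ 12 / \<epsilon> ^ k * (\<Prod>X\<in>?C - {X0}. B X)"
  have Bn: "B X \<ge> 0" if "X \<in> ?C" for X
    using B[OF that, of \<i>] by (auto intro: order.trans[rotated])
  have K0: "K \<ge> 0" unfolding K_def using B0(1) \<epsilon>(1) Bn by (intro mult_nonneg_nonneg prod_nonneg divide_nonneg_nonneg) auto
  have G_bound: "norm (G w) \<le> K * norm (nome w)" if w: "Im w \<ge> 1 / 2" for w
  proof -
    have wu: "w \<in> uhp" using w by simp
    let ?q = "norm (nome w)"
    have "norm (G w) * (?q ^ k) ^ card ?C = (\<Prod>X\<in>?C. norm (\<Phi> X w) * ?q ^ k)"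
      by (simp add: G_def prod.distrib prod_norm)
    also have "\<dots> = (norm (\<Phi> X0 w) * ?q ^ k) * (\<Prod>X\<in>?C - {X0}. norm (\<Phi> X w) * ?q ^ k)"
      by (rule prod.remove[OF finC X0])
    also have "\<dots> \<le> (B0 ^ 12 / \<epsilon> ^ k * ?q ^ (12 * n)) * (\<Prod>X\<in>?C - {X0}. B X)"
      using B0(1) \<epsilon>(1) by (intro mult_mono first w prod_mono conjI B prod_nonneg) auto
    also have "\<dots> = K * ?q ^ (12 * n)" by (simp add: K_def)
    finally have le: "norm (G w) * ?q ^ (k * card ?C) \<le> K * ?q ^ (12 * n)" by (simp add: power_mult)
    \<comment> \<open>Here the hypothesis on n enters: at least one positive power of |q| is left
      over.\<close>
    have lt: "k * card ?C < 12 * n" using n cardC by (meson le_less_trans mult_le_mono2)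
    then have "?q ^ (12 * n) = ?q ^ (12 * n - k * card ?C) * ?q ^ (k * card ?C)"
      by (simp flip: power_add)
    with le have "norm (G w) * ?q ^ (k * card ?C) \<le> (K * ?q ^ (12 * n - k * card ?C)) * ?q ^ (k * card ?C)"
      by (simp only: mult.assoc)
    then have "norm (G w) \<le> K * ?q ^ (12 * n - k * card ?C)"
      by (rule mult_right_le_imp_le) simp
    also have "\<dots> \<le> K * ?q ^ 1"
      using norm_nome_less_1[OF wu] lt by (intro mult_left_mono power_decreasing K0) auto
    finally show ?thesis by simp
  qed
  have G_inv': "norm (G (moebius h w)) = norm (G w)" if "h \<in> SL2" "w \<in> uhp" for h w
    by (simp only: G_inv[OF that])
  have G0: "(\<Prod>X\<in>?C. \<Phi> X w) = 0" if "w \<in> uhp" for w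
    using SL2_invariant_zero[OF G_hol G_inv' G_bound that] by (simp only: G_def)
  have "\<exists>X\<in>?C. \<forall>w\<in>uhp. \<Phi> X w = 0"
    by (rule holomorphic_prod_eq_0[OF finC \<Phi>_hol G0])
  then obtain X where X: "X \<in> ?C" "\<And>w. w \<in> uhp \<Longrightarrow> \<Phi> X w = 0"
    by (elim bexE) (use that in simp)
  note g = repSL(1)[OF X(1)]
  \<comment> \<open>The representative maps w back to z, so the vanishing of its factor everywhere
    gives the vanishing of \<phi> everywhere.\<close>
  define w where "w = moebius (mat_adj (rep X)) z"
  have w: "w \<in> uhp" unfolding w_def by (rule moebius_uhp[OF SL2_det[OF SL2_adj[OF g]] z])
  have "moebius (rep X) w = z"
    unfolding w_def moebius_mult[OF SL2_det[OF SL2_adj[OF g]] z, symmetric] mat_adj_mult(2)[OF g] by simp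
  then have "\<phi> z = 0" using X(2)[OF w] by (simp add: \<Phi>_def)
  then show ?thesis using Delta_nonzero[OF z] by (simp add: \<phi>_def)
qed

section \<open>Modularity of \<open>E4\<close>\<close>

text \<open>After division by the leading power, the cofactor vanishes at the points nome (m i), m >
  0, which tend to 0; by continuity its constant term, the leading coefficient, would be 0.\<close>

lemma qexp_zero:
  assumes q: "qexp F f" and z: "\<And>z. z \<in> uhp \<Longrightarrow> f z = 0"
  shows "F = 0"
proof (rule ccontr)
  assume "F \<noteq> 0"
  define n where "n = subdegree F"
  define G where "G = fps_shift n F"
  have FG: "F = G * fps_X ^ n"
    using subdegree_decompose[of F] by (simp add: G_def n_def)
  have G: "fps_conv_radius G \<ge> 1" using q by (simp add: G_def qexp_def)
  have zero: "eval_fps G (nome w) = 0" if w: "w \<in> uhp" for w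
  proof -
    have lt: "ereal (norm (nome w)) < fps_conv_radius G"
      by (rule ereal_less_if_less_1[OF norm_nome_less_1[OF w] G])
    have "f w = eval_fps G (nome w) * nome w ^ n"
      using q w lt by (simp add: qexp_def FG eval_fps_mult)
    then show ?thesis using z[OF w] by simp
  qed
  have "((\<lambda>m. nome (of_nat m * \<i>)) \<longlongrightarrow> 0) sequentially"
  proof -
    have "(\<lambda>m. nome \<i> ^ m) \<longlonglongrightarrow> 0"
      by (rule LIMSEQ_power_zero) (simp add: norm_nome)
    then show ?thesis by (simp add: nome_mult_nat)
  qed
  moreover have "isCont (eval_fps G) 0"
    using ereal_less_if_less_1[OF _ G, of 0] by (intro continuous_eval_fps) simp
  ultimately have "(\<lambda>m. eval_fps G (nome (of_nat m * \<i>))) \<longlonglongrightarrow> eval_fps G 0"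
    by (rule isCont_tendsto_compose[rotated])
  moreover have "(\<lambda>m. eval_fps G (nome (of_nat m * \<i>))) \<longlonglongrightarrow> 0"
    by (rule tendsto_eventually)
       (rule eventually_mono[OF eventually_gt_at_top[of 0]], rule zero, simp)
  ultimately have "eval_fps G 0 = 0" by (rule LIMSEQ_unique)
  then have "fps_nth F n = 0" by (simp add: eval_fps_at_0 G_def)
  then show False using \<open>F \<noteq> 0\<close> by (simp add: n_def)
qed

lemma E2_derivative_inversion:
  assumes z: "z \<in> uhp"
  shows "deriv E2 (- 1 / z) = z ^ 4 * deriv E2 z + 2 * z ^ 3 * E2 z + 6 / (of_real pi * \<i>) * z\<^sup>2"
proof -
  let ?\<kappa> = "6 / (of_real pi * \<i>) :: complex"
  have zz: "z \<noteq> 0" using z by auto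
  note hol = qexp_holomorphic[OF qexp_E2]
  have "((\<lambda>w. - 1 / w) has_field_derivative 1 / z\<^sup>2) (at z)"
    using zz by (auto intro!: derivative_eq_intros simp: power2_eq_square)
  then have "((\<lambda>w. E2 (- 1 / w)) has_field_derivative deriv E2 (- 1 / z) * (1 / z\<^sup>2)) (at z)"
    by (rule DERIV_chain2[where f = E2 and g = "\<lambda>w. - 1 / w", OF holomorphic_derivI[OF hol open_uhp inversion_uhp[OF z]]])
  moreover have "((\<lambda>w. w\<^sup>2 * E2 w + ?\<kappa> * w) has_field_derivative
      (of_nat 2 * (1 * z ^ (2 - Suc 0)) * E2 z + deriv E2 z * z\<^sup>2 + ?\<kappa> * 1)) (at z)"
    by (intro DERIV_add DERIV_mult DERIV_power DERIV_ident DERIV_cmult holomorphic_derivI[OF hol open_uhp z])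
  moreover have "\<forall>\<^sub>F w in nhds z. E2 (- 1 / w) = w\<^sup>2 * E2 w + ?\<kappa> * w"
    using eventually_nhds_in_open[OF open_uhp z] by eventually_elim (rule E2_inversion)
  ultimately have "deriv E2 (- 1 / z) * (1 / z\<^sup>2) =
      of_nat 2 * (1 * z ^ (2 - Suc 0)) * E2 z + deriv E2 z * z\<^sup>2 + ?\<kappa> * 1"
    by (rule DERIV_unique_ev)
  then have "deriv E2 (- 1 / z) = (2 * z * E2 z + deriv E2 z * z\<^sup>2 + ?\<kappa>) * z\<^sup>2"
    using zz by (simp add: nonzero_divide_eq_eq)
  also have "\<dots> = z ^ 4 * deriv E2 z + 2 * z ^ 3 * E2 z + ?\<kappa> * z\<^sup>2"
    by (simp add: algebra_simps power2_eq_square power3_eq_cube power4_eq_xxxx)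
  finally show ?thesis .
qed

text \<open>The lattice sum G and F = E2^2 - 12 q dE2/dq both have weight 4 and level 1, so \<zeta>
  F = G as soon as the constant terms agree. The next coefficient gives 240 \<zeta> = c, and this
  makes G a multiple of E4.\<close>

lemma mform_E4: "mform 4 1 E4"
proof -
  let ?\<kappa> = "6 / (of_real pi * \<i>) :: complex"
  define c where "c = (2 * of_real pi * \<i>) ^ 4 / (6 :: complex)"
  have c0: "c \<noteq> 0" by (simp add: c_def)
  obtain \<zeta> :: complex where \<zeta>: "(\<lambda>n. 1 / of_nat (Suc n) ^ 4) sums \<zeta>"
    using zeta_sums[of 4] by auto
  define G where "G z = \<zeta> + c * eval_fps (sigma_fps 3) (nome z)" for z
  have qs: "qexp (sigma_fps 3) (\<lambda>z. eval_fps (sigma_fps 3) (nome z))"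
    using fps_conv_radius_sigma by (simp add: qexp_def)
  have qG: "qexp (fps_const \<zeta> + fps_const c * sigma_fps 3) G"
    unfolding G_def by (intro qexp_add qexp_const qexp_cmult qs)
  have Ginv: "G (- 1 / z) = z ^ 4 * G z" if "z \<in> uhp" for z
    using sigma3_inversion[OF that \<zeta>] by (simp add: G_def c_def fact_numeral)
  have G: "mform 4 1 G" by (rule mform_level_1I[OF qG Ginv])
  define F where "F z = E2 z * E2 z - 12 * theta_op E2 z" for z
  define E where "E = (1 - fps_const 24 * sigma_fps 1 :: complex fps)"
  have qF: "qexp (E * E - fps_const 12 * (fps_X * fps_deriv E)) F"
    unfolding F_def E_def by (intro qexp_diff qexp_mult qexp_cmult qexp_theta qexp_E2)
  have F': "F z = E2 z * E2 z - ?\<kappa> * deriv E2 z" for z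
    by (simp add: F_def theta_op_def)
  have Finv: "F (- 1 / z) = z ^ 4 * F z" if z: "z \<in> uhp" for z
  proof -
    have "F (- 1 / z) = (z\<^sup>2 * E2 z + ?\<kappa> * z) * (z\<^sup>2 * E2 z + ?\<kappa> * z)
      - ?\<kappa> * (z ^ 4 * deriv E2 z + 2 * z ^ 3 * E2 z + ?\<kappa> * z\<^sup>2)"
      unfolding F' E2_inversion[OF z] E2_derivative_inversion[OF z] ..
    also have "\<dots> = z ^ 4 * (E2 z * E2 z - ?\<kappa> * deriv E2 z)"
      by (simp add: power2_eq_square power3_eq_cube power4_eq_xxxx algebra_simps)
    also have "\<dots> = z ^ 4 * F z" unfolding F' ..
    finally show ?thesis .
  qed
  have F: "mform 4 1 F" by (rule mform_level_1I[OF qF Finv])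
  have q: "qexp (fps_const \<zeta> * (E * E - fps_const 12 * (fps_X * fps_deriv E)) - (fps_const \<zeta> + fps_const c * sigma_fps 3))
     (\<lambda>z. \<zeta> * F z - G z)"
    by (intro qexp_diff qexp_cmult qF qG)
  have zero: "\<zeta> * F z - G z = 0" if z: "z \<in> uhp" for z
  \<comment> \<open>The empty set of primes stands for level 1 and index 1; as 12 > 4, a vanishing
    constant term suffices.\<close>
  proof (rule sturm_bound[where P = "{}" and n = 1 and k = 4, OF _ _ _ q _ _ z])
    show "mform 4 (\<Prod>{}) (\<lambda>z. \<zeta> * F z - G z)"
      using F G by (simp add: mform_diff mform_cmult)
  qed (auto simp: E_def sigma_fps_def)
  have s1: "divisor_sigma k (Suc 0) = 1" for k by (simp add: divisor_sigma_def)
  have "fps_nth (fps_const \<zeta> * (E * E - fps_const 12 * (fps_X * fps_deriv E)) - (fps_const \<zeta> + fps_const c * sigma_fps 3)) 1 = 0"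
    using qexp_zero[OF q zero] by simp
  \<comment> \<open>The coefficient of q in F is -48 + 288.\<close>
  then have "\<zeta> * 240 = c"
    by (simp add: E_def sigma_fps_def fps_mult_nth_1 s1)
  then have \<zeta>c: "\<zeta> = c / 240" by simp
  have "E4 z = 240 / c * G z" if "z \<in> uhp" for z
  proof -
    have "E4 z = 1 + 240 * eval_fps (sigma_fps 3) (nome z)"
      using sums_sigma[OF norm_nome_less_1[OF that], of 3] by (simp add: E4_def sums_iff)
    then show ?thesis using c0 by (simp add: G_def \<zeta>c field_simps)
  qed
  then show ?thesis by (rule mform_cong[OF mform_cmult[OF G]])
qed

section \<open>Eta quotients\<close>

text \<open>The logarithmic derivative of the eta quotient times 12 / (pi i).\<close>

definition eta_log :: "(nat \<times> int) list \<Rightarrow> complex \<Rightarrow> complex" where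
  "eta_log drs z = (\<Sum>(d, r)\<leftarrow>drs. of_int r * (of_nat d * E2 (of_nat d * z)))"

lemma eta_quotient_derivative:
  assumes z: "z \<in> uhp" and pos: "\<forall>(d, r)\<in>set drs. d > 0"
  shows "(eta_quotient drs has_field_derivative (of_real pi * \<i> / 12 * eta_log drs z * eta_quotient drs z)) (at z)"
    and "eta_quotient drs z \<noteq> 0"
  using pos
proof (induction drs)
  case Nil
  case 1
  show ?case by (simp add: eta_quotient_def[abs_def] eta_log_def)
  case 2
  show ?case by (simp add: eta_quotient_def)
next
  case (Cons x drs)
  obtain d r where x: "x = (d, r)" by (cases x)
  have *: "eta_quotient (x # drs) = (\<lambda>z. dedekind_eta (of_nat d * z) powi r * eta_quotient drs z)"
    by (rule ext) (simp add: eta_quotient_def x)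
  have log: "eta_log (x # drs) z = of_int r * (of_nat d * E2 (of_nat d * z)) + eta_log drs z"
    by (simp add: eta_log_def x)
  {
    assume pos: "\<forall>(d, r)\<in>set (x # drs). d > 0"
    then have dz: "of_nat d * z \<in> uhp" using z by (simp add: x)
    note nz = dedekind_eta_nonzero[OF dz]
    let ?e = "dedekind_eta (of_nat d * z)"
    have "((\<lambda>z. of_nat d * z) has_field_derivative of_nat d) (at z)"
      by (auto intro!: derivative_eq_intros)
    then have "((\<lambda>z. dedekind_eta (of_nat d * z)) has_field_derivative
        (of_real pi * \<i> / 12 * E2 (of_nat d * z) * ?e * of_nat d)) (at z)"
      by (rule DERIV_chain2[where f = dedekind_eta and g = "\<lambda>z. of_nat d * z", OF dedekind_eta_derivative[OF dz]])
    then have "((\<lambda>z. dedekind_eta (of_nat d * z) powi r) has_field_derivative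
        (of_int r * ?e powi (r - 1) * (of_real pi * \<i> / 12 * E2 (of_nat d * z) * ?e * of_nat d))) (at z)"
      by (rule DERIV_power_int) (use nz in simp)
    moreover have "of_int r * ?e powi (r - 1) * (of_real pi * \<i> / 12 * E2 (of_nat d * z) * ?e * of_nat d) =
        of_real pi * \<i> / 12 * (of_int r * (of_nat d * E2 (of_nat d * z))) * ?e powi r"
      using nz by (simp add: power_int_diff)
    ultimately have "((\<lambda>z. dedekind_eta (of_nat d * z) powi r) has_field_derivative
        of_real pi * \<i> / 12 * (of_int r * (of_nat d * E2 (of_nat d * z))) * ?e powi r) (at z)" by (simp only:)
    note d1 = DERIV_mult[OF this Cons.IH(1)]
    have "\<forall>(d, r)\<in>set drs. d > 0" using pos by simp
    from d1[OF this] show "(eta_quotient (x # drs) has_field_derivative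
       of_real pi * \<i> / 12 * eta_log (x # drs) z * eta_quotient (x # drs) z) (at z)"
      unfolding * log by (simp add: algebra_simps)
    show "eta_quotient (x # drs) z \<noteq> 0"
      using nz Cons.IH(2) pos unfolding * by simp
  }
qed

text \<open>With r = |q|, a finite product differs from 1 by at most the product of the 1 + r^n
  minus 1, hence by at most exp (r / (1 - r)) - 1, which tends to 0 with r.\<close>

lemma eta_product_limit:
  "((\<lambda>y. \<Prod>n. 1 - nome (Complex 0 y) ^ Suc n) \<longlongrightarrow> 1) at_top"
proof -
  have bound: "norm ((\<Prod>n. 1 - nome (Complex 0 y) ^ Suc n) - 1) \<le> exp (r / (1 - r)) - 1"
    if y: "y > 0" and r: "r = exp (- (2 * pi * y))" for y r
  proof (rule LIMSEQ_le_const2)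
    let ?q = "nome (Complex 0 y)"
    have zu: "Complex 0 y \<in> uhp" using y by simp
    have r01: "0 \<le> r" "r < 1" using y by (auto simp: r)
    show "(\<lambda>N. norm ((\<Prod>n<N. 1 - ?q ^ Suc n) - 1)) \<longlonglongrightarrow> norm ((\<Prod>n. 1 - ?q ^ Suc n) - 1)"
      using tendsto_uniform_limitI[OF eta_product_uniform(1)[OF zu], of "Complex 0 y"] y by (intro tendsto_intros) auto
    have "norm ((\<Prod>n<N. 1 - ?q ^ Suc n) - 1) \<le> exp (r / (1 - r)) - 1" for N
    proof -
      have nq: "norm ?q = r" by (simp add: norm_nome r)
      have "norm ((\<Prod>n<N. 1 + - (?q ^ Suc n)) - 1) \<le> (\<Prod>n<N. 1 + norm (- (?q ^ Suc n))) - 1"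
        by (rule norm_prod_minus1_le_prod_minus1)
      also have "(\<Prod>n<N. 1 + norm (- (?q ^ Suc n))) \<le> exp (\<Sum>n<N. r ^ Suc n)"
        unfolding exp_sum[OF finite_lessThan]
        by (intro prod_mono conjI) (simp_all add: norm_power nq add_nonneg_nonneg r01 exp_ge_add_one_self norm_mult)
      also have "(\<Sum>n<N. r ^ Suc n) \<le> r / (1 - r)"
      proof -
        have "(\<Sum>n<N. r ^ Suc n) \<le> (\<Sum>n. r ^ Suc n)"
          using r01 by (intro sum_le_suminf) (auto intro!: summable_mult summable_geometric)
        also have "\<dots> = r / (1 - r)"
          using r01 suminf_geometric[of r] suminf_mult[OF summable_geometric[of r], of r] by simp
        finally show ?thesis .
      qed
      finally show ?thesis by simp
    qed
    then show "\<exists>N. \<forall>n\<ge>N. norm ((\<Prod>k<n. 1 - ?q ^ Suc k) - 1) \<le> exp (r / (1 - r)) - 1" by blast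
  qed
  have "((\<lambda>y. exp (exp (- (2 * pi * y)) / (1 - exp (- (2 * pi * y)))) - 1) \<longlongrightarrow> 0) at_top"
    by real_asymp
  then have "((\<lambda>y. (\<Prod>n. 1 - nome (Complex 0 y) ^ Suc n) - 1) \<longlongrightarrow> 0) at_top"
    by (rule Lim_null_comparison[rotated])
       (rule eventually_mono[OF eventually_gt_at_top[of 0]], rule bound[OF _ refl])
  then show ?thesis by (simp add: LIM_zero_iff)
qed

text \<open>The exponential prefactors multiply to exp (2 pi i n z) = q^n exactly when the weighted
  exponent sum is 24 n; the remaining products tend to 1.\<close>

lemma eta_quotient_leading:
  assumes pos: "\<forall>(d, r)\<in>set drs. d > 0" and n: "(\<Sum>(d, r)\<leftarrow>drs. int d * r) = 24 * int n"
  shows "((\<lambda>y. eta_quotient drs (Complex 0 y) / nome (Complex 0 y) ^ n) \<longlongrightarrow> 1) at_top"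
proof -
  define P where "P z = (\<Prod>n. 1 - nome z ^ Suc n)" for z
  have fct: "eta_quotient drs z = exp (of_real pi * \<i> * z / 12 * of_int (\<Sum>(d, r)\<leftarrow>drs. int d * r)) *
      (\<Prod>(d, r)\<leftarrow>drs. P (of_nat d * z) powi r)" for z
  proof (induction drs)
    case (Cons x drs)
    obtain d r where x: "x = (d, r)" by (cases x)
    have "exp (of_real pi * \<i> * (of_nat d * z) / 12) powi r = exp (of_int r * (of_real pi * \<i> * (of_nat d * z) / 12))"
      by (rule exp_power_int)
    also have "\<dots> = exp (of_real pi * \<i> * z / 12 * of_int (int d * r))"
      by (rule arg_cong[of _ _ exp]) simp
    finally have "dedekind_eta (of_nat d * z) powi r =
        exp (of_real pi * \<i> * z / 12 * of_int (int d * r)) * P (of_nat d * z) powi r"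
      unfolding dedekind_eta_nome power_int_mult_distrib P_def by simp
    then show ?case using Cons
      by (simp add: eta_quotient_def x ring_distribs exp_add mult_ac)
  qed (simp add: eta_quotient_def)
  have ex: "exp (of_real pi * \<i> * z / 12 * of_int (\<Sum>(d, r)\<leftarrow>drs. int d * r)) = nome z ^ n" for z
  proof -
    have "of_real pi * \<i> * z / 12 * of_int (24 * int n) = of_nat n * (2 * of_real pi * \<i> * z)" by simp
    then show ?thesis unfolding n nome_def exp_of_nat_mult[symmetric] by (simp only:)
  qed
  have lim1: "((\<lambda>y. P (of_nat d * Complex 0 y)) \<longlongrightarrow> 1) at_top" if "d > 0" for d
  proof -
    have "filterlim (\<lambda>y. real d * y) at_top at_top"
      using that by real_asymp
    from filterlim_compose[OF eta_product_limit this]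
    have "((\<lambda>y. P (Complex 0 (real d * y))) \<longlongrightarrow> 1) at_top" by (simp add: P_def)
    moreover have "Complex 0 (real d * y) = of_nat d * Complex 0 y" for y
      by (simp add: complex_eq_iff)
    ultimately show ?thesis by simp
  qed
  have "((\<lambda>y. \<Prod>(d, r)\<leftarrow>drs. P (of_nat d * Complex 0 y) powi r) \<longlongrightarrow> 1) at_top"
    using pos
  proof (induction drs)
    case (Cons x drs)
    obtain d r where x: "x = (d, r)" by (cases x)
    have "((\<lambda>y. P (of_nat d * Complex 0 y) powi r) \<longlongrightarrow> 1 powi r) at_top"
      using Cons.prems by (intro tendsto_power_int lim1) (auto simp: x)
    from tendsto_mult[OF this Cons.IH] Cons.prems show ?case by (simp add: x)
  qed simp
  then show ?thesis unfolding fct ex by simp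
qed

lemma eta_log_weight:
  assumes "(\<Sum>(d, r)\<leftarrow>drs. r) = 8"
  shows "eta_log drs z = 8 * E2 z - (\<Sum>(d, r)\<leftarrow>drs. of_int r * L d z)"
proof -
  have "eta_log drs z = of_int (\<Sum>(d, r)\<leftarrow>drs. r) * E2 z - (\<Sum>(d, r)\<leftarrow>drs. of_int r * L d z)"
    by (induction drs) (auto simp: eta_log_def L_def algebra_simps)
  then show ?thesis by (simp add: assms)
qed

lemma qexp_leading_limit:
  assumes F: "qexp F f" and n: "\<And>i. i < n \<Longrightarrow> fps_nth F i = 0"
  shows "((\<lambda>y. f (Complex 0 y) / nome (Complex 0 y) ^ n) \<longlongrightarrow> fps_nth F n) at_top"
proof -
  define G where "G = fps_shift n F"
  have G: "fps_conv_radius G \<ge> 1" using F by (simp add: G_def qexp_def)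
  have FG: "F = G * fps_X ^ n"
    by (rule fps_ext) (auto simp: G_def fps_X_power_mult_right_nth n)
  have "((\<lambda>y. norm (nome (Complex 0 y))) \<longlongrightarrow> 0) at_top"
    unfolding norm_nome by (simp, real_asymp)
  then have "((\<lambda>y. nome (Complex 0 y)) \<longlongrightarrow> 0) at_top" by (rule tendsto_norm_zero_cancel)
  moreover have "isCont (eval_fps G) 0"
    using ereal_less_if_less_1[OF _ G, of 0] by (intro continuous_eval_fps) simp
  ultimately have "((\<lambda>y. eval_fps G (nome (Complex 0 y))) \<longlongrightarrow> eval_fps G 0) at_top"
    by (rule isCont_tendsto_compose[rotated])
  moreover have "eval_fps G (nome (Complex 0 y)) = f (Complex 0 y) / nome (Complex 0 y) ^ n" if "y > 0" for y
  proof -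
    have zu: "Complex 0 y \<in> uhp" using that by simp
    have lt: "ereal (norm (nome (Complex 0 y))) < fps_conv_radius G"
      by (rule ereal_less_if_less_1[OF norm_nome_less_1[OF zu] G])
    show ?thesis using F zu lt by (simp add: qexp_def FG eval_fps_mult)
  qed
  then have "\<forall>\<^sub>F y in at_top. eval_fps G (nome (Complex 0 y)) = f (Complex 0 y) / nome (Complex 0 y) ^ n"
    by (rule eventually_mono[OF eventually_gt_at_top[of 0]])
  ultimately have "((\<lambda>y. f (Complex 0 y) / nome (Complex 0 y) ^ n) \<longlongrightarrow> eval_fps G 0) at_top"
    by (subst (asm) tendsto_cong)
  then show ?thesis by (simp add: eval_fps_at_0 G_def)
qed

text \<open>Equality of logarithmic derivatives, cleared of denominators.\<close>

lemma eta_quotient_eqI: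
  assumes pos: "\<forall>(d, r)\<in>set drs. d > 0" and wt: "(\<Sum>(d, r)\<leftarrow>drs. r) = 8"
    and n: "(\<Sum>(d, r)\<leftarrow>drs. int d * r) = 24 * int n"
    and X: "qexp XF X" and Q: "qexp QF Q"
    and ode: "\<And>z. z \<in> uhp \<Longrightarrow> 24 * (serre (a + 4) Q z * X z - Q z * serre a X z)
        + Q z * X z * (\<Sum>(d, r)\<leftarrow>drs. of_int r * L d z) = 0"
    and lead: "\<And>i. i < n \<Longrightarrow> fps_nth QF i = 0" "fps_nth QF n = fps_nth XF 0" "fps_nth XF 0 \<noteq> 0"
    and z: "z \<in> uhp"
  shows "X z * eta_quotient drs z = Q z"
proof -
  let ?f = "eta_quotient drs" and ?p = "2 * of_real pi * \<i> :: complex"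
  note fD = eta_quotient_derivative[OF _ pos]
  note Xh = qexp_holomorphic[OF X] and Qh = qexp_holomorphic[OF Q]
  have fh: "?f holomorphic_on uhp"
    using fD(1) by (auto simp: holomorphic_on_def field_differentiable_def intro: has_field_derivative_at_within)
  \<comment> \<open>X may have zeros, so the quotient R is formed only on a ball free of them; the
    product form of the equation extends to the half plane afterwards.\<close>
  have X0: "\<exists>w\<in>uhp. X w \<noteq> 0"
    using qexp_zero[OF X] lead(3) by fastforce
  then obtain w0 where w0: "w0 \<in> uhp" "X w0 \<noteq> 0" by blast
  have "open (uhp \<inter> X -` (- {0}))"
    by (rule continuous_open_preimage[OF holomorphic_on_imp_continuous_on[OF Xh] open_uhp]) auto
  then obtain \<epsilon> where \<epsilon>: "\<epsilon> > 0" "ball w0 \<epsilon> \<subseteq> uhp \<inter> X -` (- {0})"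
    using w0 openE[of "uhp \<inter> X -` (- {0})" w0] by blast
  define R where "R w = Q w / (X w * ?f w)" for w
  have "(R has_field_derivative 0) (at w within ball w0 \<epsilon>)" if w: "w \<in> ball w0 \<epsilon>" for w
  proof -
    have wu: "w \<in> uhp" and Xw: "X w \<noteq> 0" using \<epsilon>(2) w by auto
    \<comment> \<open>Since (a + 4)/12 - a/12 = 8/24, the E2 terms of \<open>deriv Q\<close> and
      \<open>deriv X\<close> cancel against the 8 E2 of \<open>eta_log_weight\<close>.\<close>
    have dQ: "deriv Q w = ?p * (serre (a + 4) Q w + of_nat (a + 4) / 12 * E2 w * Q w)"
      by (simp add: serre_def theta_op_def)
    have dX: "deriv X w = ?p * (serre a X w + of_nat a / 12 * E2 w * X w)"
      by (simp add: serre_def theta_op_def)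
    let ?S = "\<Sum>(d, r)\<leftarrow>drs. of_int r * L d w"
    have df: "(?f has_field_derivative (?p / 24 * (8 * E2 w - ?S) * ?f w)) (at w)"
      using fD(1)[OF wu] unfolding eta_log_weight[OF wt] by (simp add: mult_ac)
    have "(R has_field_derivative
       (deriv Q w * (X w * ?f w) - Q w * (deriv X w * ?f w + ?p / 24 * (8 * E2 w - ?S) * ?f w * X w))
        / ((X w * ?f w) * (X w * ?f w))) (at w)"
      unfolding R_def using Xw fD(2)[OF wu]
      by (intro DERIV_divide DERIV_mult holomorphic_derivI[OF Qh open_uhp wu]
          holomorphic_derivI[OF Xh open_uhp wu] df) auto
    also have "deriv Q w * (X w * ?f w) - Q w * (deriv X w * ?f w + ?p / 24 * (8 * E2 w - ?S) * ?f w * X w)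
       = ?p * ?f w / 24 * (24 * (serre (a + 4) Q w * X w - Q w * serre a X w) + Q w * X w * ?S)"
      unfolding dQ dX by (simp add: field_simps)
    finally have "(R has_field_derivative 0) (at w)" unfolding ode[OF wu] by simp
    then show ?thesis by (rule has_field_derivative_at_within)
  qed
  from has_field_derivative_zero_constant[OF convex_ball this] obtain c where c: "\<And>w. w \<in> ball w0 \<epsilon> \<Longrightarrow> R w = c"
    by metis
  have eq: "Q w = c * (X w * ?f w)" if w: "w \<in> uhp" for w
  proof (rule analytic_continuation_open[of "ball w0 \<epsilon>" uhp Q "\<lambda>w. c * (X w * ?f w)" w])
    show "Q w = c * (X w * ?f w)" if "w \<in> ball w0 \<epsilon>" for w
    proof -
      have "w \<in> uhp" "X w \<noteq> 0" using \<epsilon>(2) that by auto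
      then show ?thesis using c[OF that] fD(2)[of w] by (simp add: R_def field_simps)
    qed
  qed (use \<epsilon> w open_uhp connected_uhp in \<open>auto intro!: holomorphic_intros Qh Xh fh\<close>)
  \<comment> \<open>The leading coefficients, read off along the imaginary axis, determine
    c.\<close>
  have "((\<lambda>y. c * (X (Complex 0 y) / nome (Complex 0 y) ^ 0 * (?f (Complex 0 y) / nome (Complex 0 y) ^ n)))
      \<longlongrightarrow> c * (fps_nth XF 0 * 1)) at_top"
    by (intro tendsto_intros qexp_leading_limit[OF X] eta_quotient_leading[OF pos n]) auto
  moreover have "\<forall>\<^sub>F y in at_top. c * (X (Complex 0 y) / nome (Complex 0 y) ^ 0 * (?f (Complex 0 y) / nome (Complex 0 y) ^ n))
      = Q (Complex 0 y) / nome (Complex 0 y) ^ n"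
    using eventually_gt_at_top[of 0] by eventually_elim (simp add: eq)
  ultimately have "((\<lambda>y. Q (Complex 0 y) / nome (Complex 0 y) ^ n) \<longlongrightarrow> c * (fps_nth XF 0 * 1)) at_top"
    by (rule Lim_transform_eventually)
  with qexp_leading_limit[OF Q lead(1)] have "fps_nth QF n = c * (fps_nth XF 0 * 1)"
    by (intro tendsto_unique[OF trivial_limit_at_top_linorder])
  then have "c = 1" using lead(2,3) by simp
  then show ?thesis using eq[OF z] by simp
qed

section \<open>Truncated \<open>q\<close>-expansions\<close>

text \<open>Only integral coefficients occur, so all computations run on integer lists of one fixed
  length n.\<close>

definition approx :: "nat \<Rightarrow> int list \<Rightarrow> complex fps \<Rightarrow> bool" where
  "approx n xs F \<longleftrightarrow> length xs = n \<and> (\<forall>i<n. fps_nth F i = of_int (xs ! i))"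

definition padd :: "int list \<Rightarrow> int list \<Rightarrow> int list" where
  "padd xs ys = map2 (+) xs ys"

definition pscale :: "int \<Rightarrow> int list \<Rightarrow> int list" where
  "pscale c xs = map (\<lambda>x. c * x) xs"

text \<open>Truncated product. Behind the head x the other factor is shifted by one place, so its
  last entry passes the truncation and is dropped; zero entries save a scaling and an
  addition.\<close>

fun pmul :: "int list \<Rightarrow> int list \<Rightarrow> int list" where
  "pmul [] ys = []"
| "pmul (x # xs) ys = (if x = 0 then 0 # pmul xs (butlast ys)
     else padd (pscale x ys) (0 # pmul xs (butlast ys)))"

fun ptheta :: "int \<Rightarrow> int list \<Rightarrow> int list" where
  "ptheta k [] = []"
| "ptheta k (x # xs) = k * x # ptheta (k + 1) xs"

fun pdilate :: "nat \<Rightarrow> int list \<Rightarrow> int list" where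
  "pdilate d [] = []"
| "pdilate d (x # xs) = x # replicate (d - 1) 0 @ pdilate d xs"

lemma approx_add: "approx n xs F \<Longrightarrow> approx n ys G \<Longrightarrow> approx n (padd xs ys) (F + G)"
  by (auto simp: approx_def padd_def)

lemma approx_scale: "approx n xs F \<Longrightarrow> approx n (pscale c xs) (fps_const (of_int c) * F)"
  by (auto simp: approx_def pscale_def)

lemma approx_Cons:
  "approx (Suc n) (x # xs) F \<longleftrightarrow> fps_nth F 0 = of_int x \<and> approx n xs (fps_shift 1 F)"
  by (auto simp: approx_def nth_Cons' less_Suc_eq_0_disj split: if_splits)

lemma approx_butlast: "approx (Suc n) ys G \<Longrightarrow> approx n (butlast ys) G"
  by (auto simp: approx_def nth_butlast)

lemma approx_mult: "approx n xs F \<Longrightarrow> approx n ys G \<Longrightarrow> approx n (pmul xs ys) (F * G)"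
proof (induction xs arbitrary: n ys F G)
  case (Cons x xs)
  obtain m where m: "n = Suc m" using Cons.prems(1) by (cases n) (auto simp: approx_def)
  from Cons.prems(1) have F: "fps_nth F 0 = of_int x" "approx m xs (fps_shift 1 F)"
    by (simp_all add: m approx_Cons)
  have "F = fps_const (of_int x) + fps_X * fps_shift 1 F"
    by (rule fps_ext) (simp add: F(1))
  then have FG: "F * G = fps_const (of_int x) * G + fps_X * (fps_shift 1 F * G)"
    by (metis distrib_right mult.assoc)
  have "approx m (pmul xs (butlast ys)) (fps_shift 1 F * G)"
    by (rule Cons.IH[OF F(2) approx_butlast[OF Cons.prems(2)[unfolded m]]])
  then have t: "approx n (0 # pmul xs (butlast ys)) (fps_X * (fps_shift 1 F * G))"
    unfolding m approx_Cons
  proof (intro conjI)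
    have "fps_shift 1 (fps_X * (fps_shift 1 F * G)) = fps_shift 1 F * G"
      by (rule fps_ext) simp
    then show "approx m (pmul xs (butlast ys)) (fps_shift 1 (fps_X * (fps_shift 1 F * G)))"
      using \<open>approx m (pmul xs (butlast ys)) (fps_shift 1 F * G)\<close> by simp
  qed simp
  show ?case
  proof (cases "x = 0")
    case True
    then show ?thesis using t unfolding FG by simp
  next
    case False
    then show ?thesis
      using approx_add[OF approx_scale[OF Cons.prems(2), of x] t] unfolding FG by simp
  qed
qed (auto simp: approx_def)

lemma ptheta_nth: "i < length xs \<Longrightarrow> ptheta k xs ! i = (k + int i) * xs ! i" "length (ptheta k xs) = length xs"
  by (induction xs arbitrary: k i) (auto simp: nth_Cons' algebra_simps of_nat_diff)

lemma approx_theta: "approx n xs F \<Longrightarrow> approx n (ptheta 0 xs) (fps_X * fps_deriv F)"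
  by (auto simp: approx_def ptheta_nth)

lemma pdilate_nth:
  assumes "d > 0"
  shows "length (pdilate d xs) = d * length xs"
    and "i < d * length xs \<Longrightarrow> pdilate d xs ! i = (if d dvd i then xs ! (i div d) else 0)"
proof -
  show len: "length (pdilate d xs) = d * length xs" for xs
    using assms by (induction xs) auto
  show "i < d * length xs \<Longrightarrow> pdilate d xs ! i = (if d dvd i then xs ! (i div d) else 0)"
  proof (induction xs arbitrary: i)
    case (Cons x xs)
    consider "i = 0" | "0 < i" "i < d" | "i \<ge> d" by linarith
    then show ?case
    proof cases
      case 3
      then have "i - Suc 0 - (d - Suc 0) = i - d" "\<not> i - Suc 0 < d - Suc 0" "i \<noteq> 0"
        using assms by auto
      then have "pdilate d (x # xs) ! i = pdilate d xs ! (i - d)"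
        by (simp add: nth_append nth_Cons' del: diff_diff_left)
      also have "\<dots> = (if d dvd i - d then xs ! ((i - d) div d) else 0)"
        using Cons.prems 3 by (intro Cons.IH) auto
      also have "\<dots> = (if d dvd i then (x # xs) ! (i div d) else 0)"
        using 3 assms by (auto simp: dvd_minus_self le_div_geq)
      finally show ?thesis .
    qed (auto simp: nth_append nth_Cons' dest: dvd_imp_le)
  qed simp
qed

lemma approx_dilate:
  assumes "approx n xs F" "d > 0"
  shows "approx n (take n (pdilate d xs)) (fps_dilate d F)"
proof -
  have "n \<le> d * n" using assms(2) by simp
  moreover have "i div d < n" if "i < n" for i
    using that div_le_dividend[of i d] by linarith
  moreover have "i < d * n" if "i < n" for i
    using that \<open>n \<le> d * n\<close> by linarith
  ultimately show ?thesis
    using assms by (auto simp: approx_def pdilate_nth fps_dilate_def)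
qed

section \<open>Coefficient tables of E2 and E4\<close>

definition E2_table :: "int list" where 
  "E2_table = [1, - 24, - 72, - 96, - 168, - 144, - 288, - 192, - 360, - 312, - 432, - 288, -
    672, - 336, - 576, - 576, - 744, - 432, - 936, - 480, - 1008, - 768, - 864, - 576, -
    1440, - 744, - 1008, - 960, - 1344, - 720, - 1728, - 768, - 1512, - 1152, - 1296, -
    1152, - 2184, - 912, - 1440, - 1344, - 2160, - 1008, - 2304]"

definition E4_table :: "int list" where 
  "E4_table = [1, 240, 2160, 6720, 17520, 30240, 60480, 82560, 140400, 181680, 272160, 319680,
    490560, 527520, 743040, 846720, 1123440, 1179360, 1635120, 1646400, 2207520, 2311680,
    2877120, 2920320, 3931200, 3780240, 4747680, 4905600, 6026880, 5853600, 7620480,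
    7150080, 8987760, 8951040, 10614240, 10402560, 13262640, 12156960, 14817600, 14770560,
    17690400, 16541280, 20805120]"

text \<open>An executable divisor sum against which the tables are checked by evaluation.\<close>

definition int_sigma :: "nat \<Rightarrow> int \<Rightarrow> int" where
  "int_sigma k n = sum_list (map (\<lambda>d. d ^ k) (filter (\<lambda>d. n mod d = 0) [1..n]))"

lemma int_sigma: "n > 0 \<Longrightarrow> int_sigma k (int n) = int (divisor_sigma k n)"
proof -
  assume n: "n > 0"
  have "int_sigma k (int n) = (\<Sum>d | 1 \<le> d \<and> d \<le> int n \<and> int n mod d = 0. d ^ k)"
    unfolding int_sigma_def
    by (subst sum_list_distinct_conv_sum_set) (auto intro!: sum.cong)
  also have "\<dots> = (\<Sum>d | d dvd n. int d ^ k)"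
    by (rule sum.reindex_bij_witness[where i = int and j = nat])
       (use n in \<open>auto simp: mod_eq_0_iff_dvd dvd_imp_le Suc_le_eq nat_dvd_iff intro: Nat.gr0I\<close>)
  finally show ?thesis by (simp add: divisor_sigma_def)
qed

lemma E2_table_nth: "i < 43 \<Longrightarrow> E2_table ! i = (if i = 0 then 1 else - 24 * int (divisor_sigma 1 i))"
  and E4_table_nth: "i < 43 \<Longrightarrow> E4_table ! i = (if i = 0 then 1 else 240 * int (divisor_sigma 3 i))"
proof -
  have nth: "(c # map (\<lambda>n. a * int_sigma k n) [1..42]) ! i = (if i = 0 then c else a * int (divisor_sigma k i))"
    if "i < 43" for a c k i
  proof (cases i)
    case (Suc j)
    then have "[1..42] ! j = int i" using that by (simp add: nth_upto)
    then show ?thesis using that Suc int_sigma[of i k] by simp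
  qed simp
  have E2: "E2_table = 1 # map (\<lambda>n. - 24 * int_sigma 1 n) [1..42]"
    by code_simp
  show "E2_table ! i = (if i = 0 then 1 else - 24 * int (divisor_sigma 1 i))" if "i < 43"
    unfolding E2 by (rule nth[OF that])
  have E4: "E4_table = 1 # map (\<lambda>n. 240 * int_sigma 3 n) [1..42]"
    by code_simp
  show "E4_table ! i = (if i = 0 then 1 else 240 * int (divisor_sigma 3 i))" if "i < 43"
    unfolding E4 by (rule nth[OF that])
qed

lemma approx_E2: "n \<le> 43 \<Longrightarrow> approx n (take n E2_table) (1 - fps_const 24 * sigma_fps 1)"
  and approx_E4: "n \<le> 43 \<Longrightarrow> approx n (take n E4_table) (1 + fps_const 240 * sigma_fps 3)"
  by (auto simp: approx_def E2_table_nth E4_table_nth sigma_fps_def) (simp_all add: E2_table_def E4_table_def)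

section \<open>Polynomials in \<open>L\<close> and \<open>E4\<close>\<close>

text \<open>Reified polynomials in L_d (z) and E4 (d z): one structural induction gives modularity,
  q-expansion and truncated coefficients of every explicit form below.\<close>

datatype mfexp = One | GL nat | GE nat | Scale int mfexp | Add mfexp mfexp | Mul mfexp mfexp

fun mf_val :: "mfexp \<Rightarrow> complex \<Rightarrow> complex" where
  "mf_val One z = 1"
| "mf_val (GL d) z = L d z"
| "mf_val (GE d) z = E4 (of_nat d * z)"
| "mf_val (Scale c e) z = of_int c * mf_val e z"
| "mf_val (Add e f) z = mf_val e z + mf_val f z"
| "mf_val (Mul e f) z = mf_val e z * mf_val f z"

text \<open>A sum takes the weight of its left summand; \<open>mf_ok\<close> demands that both
  summands have the same weight.\<close>

fun mf_weight :: "mfexp \<Rightarrow> nat" where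
  "mf_weight One = 0"
| "mf_weight (GL d) = 2"
| "mf_weight (GE d) = 4"
| "mf_weight (Scale c e) = mf_weight e"
| "mf_weight (Add e f) = mf_weight e"
| "mf_weight (Mul e f) = mf_weight e + mf_weight f"

fun mf_ok :: "nat \<Rightarrow> mfexp \<Rightarrow> bool" where
  "mf_ok N One \<longleftrightarrow> True"
| "mf_ok N (GL d) \<longleftrightarrow> d > 0 \<and> d dvd N"
| "mf_ok N (GE d) \<longleftrightarrow> d > 0 \<and> d dvd N"
| "mf_ok N (Scale c e) \<longleftrightarrow> mf_ok N e"
| "mf_ok N (Add e f) \<longleftrightarrow> mf_ok N e \<and> mf_ok N f \<and> mf_weight e = mf_weight f"
| "mf_ok N (Mul e f) \<longleftrightarrow> mf_ok N e \<and> mf_ok N f"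

abbreviation E2_fps :: "complex fps" where "E2_fps \<equiv> 1 - fps_const 24 * sigma_fps 1"
abbreviation E4_fps :: "complex fps" where "E4_fps \<equiv> 1 + fps_const 240 * sigma_fps 3"

text \<open>The difference is written as a sum with factor -d so that \<open>approx_add\<close> and
  \<open>approx_scale\<close> apply.\<close>

definition L_fps :: "nat \<Rightarrow> complex fps" where
  "L_fps d = E2_fps + fps_const (of_int (- int d)) * fps_dilate d E2_fps"

definition L_ser :: "nat \<Rightarrow> nat \<Rightarrow> int list" where
  "L_ser n d = padd (take n E2_table) (pscale (- int d) (take n (pdilate d (take n E2_table))))"

fun mf_fps :: "mfexp \<Rightarrow> complex fps" where
  "mf_fps One = 1"
| "mf_fps (GL d) = L_fps d"
| "mf_fps (GE d) = fps_dilate d E4_fps"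
| "mf_fps (Scale c e) = fps_const (of_int c) * mf_fps e"
| "mf_fps (Add e f) = mf_fps e + mf_fps f"
| "mf_fps (Mul e f) = mf_fps e * mf_fps f"

fun mf_ser :: "nat \<Rightarrow> mfexp \<Rightarrow> int list" where
  "mf_ser n One = take n (1 # replicate n 0)"
| "mf_ser n (GL d) = L_ser n d"
| "mf_ser n (GE d) = take n (pdilate d (take n E4_table))"
| "mf_ser n (Scale c e) = pscale c (mf_ser n e)"
| "mf_ser n (Add e f) = padd (mf_ser n e) (mf_ser n f)"
| "mf_ser n (Mul e f) = pmul (mf_ser n e) (mf_ser n f)"

lemma approx_one: "approx n (take n (1 # replicate n 0)) 1"
  by (auto simp: approx_def nth_Cons')

lemma approx_L: "n \<le> 43 \<Longrightarrow> d > 0 \<Longrightarrow> approx n (L_ser n d) (L_fps d)"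
  unfolding L_fps_def L_ser_def by (intro approx_add approx_scale approx_dilate approx_E2)

lemma qexp_L_fps: "d > 0 \<Longrightarrow> qexp (L_fps d) (L d)"
  using qexp_L[of d] by (simp add: L_fps_def fps_const_neg[symmetric] del: fps_const_neg)

lemma mf_correct:
  assumes "mf_ok N e"
  shows "mform (mf_weight e) N (mf_val e)" "qexp (mf_fps e) (mf_val e)"
    "n \<le> 43 \<Longrightarrow> approx n (mf_ser n e) (mf_fps e)"
proof -
  have "mform (mf_weight e) N (mf_val e) \<and> qexp (mf_fps e) (mf_val e)"
    using assms
  proof (induction e)
    case One
    then show ?case using mform_const[of N 1] qexp_const[of 1] by (simp add: mf_val.simps[abs_def])
  next
    case (GL d)
    then show ?case using mform_level[OF mform_L, of d N] qexp_L_fps[of d]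
      by (simp add: mf_val.simps[abs_def])
  next
    case (GE d)
    then show ?case using mform_level[OF mform_dilate[OF mform_E4], of d N] qexp_dilate[OF qexp_E4, of d]
      by (simp add: mf_val.simps[abs_def])
  next
    case (Scale c e)
    then show ?case using mform_cmult qexp_cmult by (simp add: mf_val.simps[abs_def])
  next
    case (Add e f)
    then show ?case using mform_add qexp_add by (simp add: mf_val.simps[abs_def])
  next
    case (Mul e f)
    then show ?case using mform_mult qexp_mult by (simp add: mf_val.simps[abs_def])
  qed
  then show "mform (mf_weight e) N (mf_val e)" "qexp (mf_fps e) (mf_val e)" by blast+
  show "approx n (mf_ser n e) (mf_fps e)" if "n \<le> 43"
    using assms by (induction e)
      (auto intro!: approx_one approx_L approx_dilate approx_E4 approx_scale approx_add approx_mult simp: that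
        simp del: take_replicate replicate.simps take.simps take_Suc_Cons)
qed

lemma approx_zero:
  "approx n xs F \<Longrightarrow> list_all (\<lambda>x. x = 0) xs \<Longrightarrow> i < n \<Longrightarrow> fps_nth F i = 0"
  by (auto simp: approx_def list_all_length)

text \<open>The numbers 72, 24 and 36 are the indices of \<open>\<Gamma>\<^sub>0(30)\<close>, \<open>\<Gamma>\<^sub>0(14)\<close> and \<open>\<Gamma>\<^sub>0(22)\<close> in the
  modular group; 43 is the length of the coefficient tables.\<close>

definition sturm_ok :: "nat \<Rightarrow> nat \<Rightarrow> nat \<Rightarrow> bool" where
  "sturm_ok N k n \<longleftrightarrow> n \<le> 43 \<and>
     (N = 30 \<and> 12 * n > k * 72 \<or> N = 14 \<and> 12 * n > k * 24 \<or> N = 22 \<and> 12 * n > k * 36)"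

lemma sturm_levels:
  assumes ok: "sturm_ok N k n" and f: "mform k N f" and q: "qexp F f"
    and a: "approx n xs F" "list_all (\<lambda>x. x = 0) xs" and z: "z \<in> uhp"
  shows "f z = 0"
proof -
  obtain P where P: "finite P" "\<forall>p\<in>P. prime (p :: nat)" "N = \<Prod>P" "12 * n > k * (\<Prod>p\<in>P. p + 1)"
  proof -
    have "prime (2::nat)" "prime (3::nat)" "prime (5::nat)" "prime (7::nat)" "prime (11::nat)"
      by simp_all
    then show ?thesis
      \<comment> \<open>The indices are the products of the p + 1: 3 * 4 * 6 = 72, 3 * 8 = 24 and 3
        * 12 = 36.\<close>
      using ok that[of "{2, 3, 5}"] that[of "{2, 7}"] that[of "{2, 11}"]
      by (auto simp: sturm_ok_def)
  qed
  show ?thesis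
    by (rule sturm_bound[OF P(1) _ f[unfolded P(3)] q approx_zero[OF a] P(4) z]) (use P(2) in auto)
qed

lemma mf_zero:
  assumes "mf_ok N e" "sturm_ok N (mf_weight e) n" "list_all (\<lambda>x. x = 0) (mf_ser n e)" "z \<in> uhp"
  shows "mf_val e z = 0"
proof -
  have "n \<le> 43" using assms(2) by (simp add: sturm_ok_def)
  then show ?thesis
    using sturm_levels[OF assms(2) mf_correct(1,2)[OF assms(1)] mf_correct(3)[OF assms(1)]] assms(3,4) by blast
qed

section \<open>Certificates for eta quotients\<close>

fun eta_expo :: "(nat \<times> int) list \<Rightarrow> mfexp" where
  "eta_expo [] = Scale 0 (GL 1)"
| "eta_expo ((d, r) # drs) = Add (Scale r (GL d)) (eta_expo drs)"

lemma eta_expo_val: "mf_val (eta_expo drs) z = (\<Sum>(d, r)\<leftarrow>drs. of_int r * L d z)"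
  by (induction drs rule: eta_expo.induct) auto

text \<open>The base case \<open>Scale 0 (GL 1)\<close> is the zero form written in weight 2, which
  makes the weights in the recursive sums agree.\<close>

lemma eta_expo_weight: "mf_weight (eta_expo drs) = 2"
  by (induction drs rule: eta_expo.induct) auto

lemma eta_expo_ok: "\<forall>(d, r)\<in>set drs. d > 0 \<and> d dvd N \<Longrightarrow> mf_ok N (eta_expo drs)"
  by (induction drs rule: eta_expo.induct) (auto simp: eta_expo_weight)

text \<open>The expansion of the Wronskian-type form in \<open>eta_quotient_eqI\<close>; the contributions of
  \<open>E2\<close> to the Serre derivatives are collected in the last factor.\<close>

definition ode_ser :: "nat \<Rightarrow> int list \<Rightarrow> int list \<Rightarrow> (nat \<times> int) list \<Rightarrow> int list" where
  "ode_ser n x q drs =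
     padd (pscale 24 (padd (pmul x (ptheta 0 q)) (pscale (- 1) (pmul (ptheta 0 x) q))))
       (pmul (pmul x q) (padd (mf_ser n (eta_expo drs)) (pscale (- 8) (take n E2_table))))"

text \<open>A decidable condition for D X f = Q, with f the eta quotient of \<open>drs\<close>, m
  its leading exponent and D a scalar that clears denominators. The weight in the Sturm bound is (a
  + 4) + 2 + a for \<open>X\<close> of weight a.\<close>

definition eta_cert :: "nat \<Rightarrow> nat \<Rightarrow> nat \<Rightarrow> int \<Rightarrow> mfexp \<Rightarrow> mfexp \<Rightarrow> (nat \<times> int) list \<Rightarrow> bool" where
  "eta_cert N n m D X Q drs \<longleftrightarrow> mf_ok N X \<and> mf_ok N Q \<and> mf_weight Q = mf_weight X + 4 \<and>
     list_all (\<lambda>(d, r). d > 0 \<and> d dvd N) drs \<and> sum_list (map (\<lambda>(d, r). r) drs) = 8 \<and>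
     sum_list (map (\<lambda>(d, r). int d * r) drs) = 24 * int m \<and> m < n \<and>
     sturm_ok N (2 * mf_weight X + 6) n \<and> D \<noteq> 0 \<and>
     (let x = mf_ser n X; q = mf_ser n Q in hd x \<noteq> 0 \<and>
       list_all (\<lambda>x. x = 0) (take m q) \<and> q ! m = D * hd x \<and>
       list_all (\<lambda>x. x = 0) (ode_ser n x q drs))"

text \<open>The Wronskian-type form W vanishes by Sturm's bound, and then
  \<open>eta_quotient_eqI\<close> applies with D X in place of \<open>X\<close>.\<close>

lemma eta_cert_correct:
  assumes c: "eta_cert N n m D X Q drs" and z: "z \<in> uhp"
  shows "of_int D * (mf_val X z * eta_quotient drs z) = mf_val Q z"
proof -
  define a where "a = mf_weight X"
  have ok: "mf_ok N X" "mf_ok N Q" "mf_weight Q = a + 4"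
    and drs: "\<forall>(d, r)\<in>set drs. d > 0 \<and> d dvd N" and st: "sturm_ok N (2 * a + 6) n"
    and D: "D \<noteq> 0" and mn: "m < n"
    and lead: "hd (mf_ser n X) \<noteq> 0" "list_all (\<lambda>x. x = 0) (take m (mf_ser n Q))"
      "mf_ser n Q ! m = D * hd (mf_ser n X)"
    and wser: "list_all (\<lambda>x. x = 0) (ode_ser n (mf_ser n X) (mf_ser n Q) drs)"
    and wt: "(\<Sum>(d, r)\<leftarrow>drs. r) = 8" and sm: "(\<Sum>(d, r)\<leftarrow>drs. int d * r) = 24 * int m"
    using c by (auto simp: eta_cert_def a_def Let_def list_all_iff case_prod_beta)
  have n: "n \<le> 43" using st by (simp add: sturm_ok_def)
  note X = mf_correct[OF ok(1)] and Q = mf_correct[OF ok(2)]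
  note S = mf_correct[OF eta_expo_ok[OF drs]]
  have pos: "\<forall>(d, r)\<in>set drs. d > 0" using drs by auto
  let ?x = "mf_ser n X" and ?q = "mf_ser n Q" and ?XF = "mf_fps X" and ?QF = "mf_fps Q"
  have hdx: "fps_nth ?XF 0 = of_int (hd ?x)"
    using X(3)[OF n] mn by (cases ?x) (auto simp: approx_def)
  define W where "W z = 24 * (serre (a + 4) (mf_val Q) z * mf_val X z - mf_val Q z * serre a (mf_val X) z)
      + mf_val Q z * mf_val X z * mf_val (eta_expo drs) z" for z
  define WF where "WF = fps_const (of_int 24) * (?XF * (fps_X * fps_deriv ?QF) + fps_const (of_int (- 1)) * ((fps_X * fps_deriv ?XF) * ?QF))
      + (?XF * ?QF) * (mf_fps (eta_expo drs) + fps_const (of_int (- 8)) * E2_fps)"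
  have "mform (2 * a + 6) N W"
  proof -
    have s1: "mform (2 * a + 6) N (\<lambda>z. serre (a + 4) (mf_val Q) z * mf_val X z)"
      using mform_mult[OF mform_serre[OF Q(1)] X(1)] by (simp add: ok(3) a_def[symmetric] algebra_simps)
    have s2: "mform (2 * a + 6) N (\<lambda>z. mf_val Q z * serre a (mf_val X) z)"
      using mform_mult[OF Q(1) mform_serre[OF X(1)]] by (simp add: ok(3) a_def[symmetric] algebra_simps)
    have s3: "mform (2 * a + 6) N (\<lambda>z. mf_val Q z * mf_val X z * mf_val (eta_expo drs) z)"
      using mform_mult[OF mform_mult[OF Q(1) X(1)] S(1)]
      by (simp add: ok(3) a_def[symmetric] eta_expo_weight algebra_simps)
    show ?thesis unfolding W_def by (intro mform_add mform_cmult mform_diff s1 s2 s3)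
  qed
  moreover have "qexp WF W"
  proof (rule qexp_cong)
    show "qexp WF (\<lambda>z. of_int 24 * (mf_val X z * theta_op (mf_val Q) z + of_int (- 1) * (theta_op (mf_val X) z * mf_val Q z))
        + (mf_val X z * mf_val Q z) * (mf_val (eta_expo drs) z + of_int (- 8) * E2 z))"
      unfolding WF_def by (intro qexp_add qexp_mult qexp_cmult qexp_theta X(2) Q(2) S(2) qexp_E2)
    \<comment> \<open>The corrections in the two Serre derivatives combine to -24 * ((a + 4)/12 -
      a/12) E2 = -8 E2, which joins the last factor.\<close>
    show "W z = of_int 24 * (mf_val X z * theta_op (mf_val Q) z + of_int (- 1) * (theta_op (mf_val X) z * mf_val Q z))
        + (mf_val X z * mf_val Q z) * (mf_val (eta_expo drs) z + of_int (- 8) * E2 z)" for z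
      by (simp add: W_def serre_def algebra_simps)
  qed
  moreover have "approx n (ode_ser n (mf_ser n X) (mf_ser n Q) drs) WF"
    unfolding ode_ser_def WF_def
    by (intro approx_add approx_scale approx_mult approx_theta X(3) Q(3) S(3) approx_E2 n)
  ultimately have W0: "W z = 0" if "z \<in> uhp" for z
    using sturm_levels[OF st] wser that by blast
  have q': "qexp (fps_const (of_int D) * ?XF) (\<lambda>z. of_int D * mf_val X z)" by (intro qexp_cmult X(2))
  have "of_int D * mf_val X z * eta_quotient drs z = mf_val Q z"
  proof (rule eta_quotient_eqI[OF pos wt sm q' Q(2) _ _ _ _ z])
    fix z assume z: "z \<in> uhp"
    \<comment> \<open>Linearity of the Serre derivative moves D out, so the differential equation
      for D X is D times that for \<open>X\<close>.\<close>
    have "serre a (\<lambda>z. of_int D * mf_val X z) z = of_int D * serre a (mf_val X) z"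
    proof -
      have "((\<lambda>z. of_int D * mf_val X z) has_field_derivative of_int D * deriv (mf_val X) z) (at z)"
        by (intro DERIV_cmult holomorphic_derivI[OF qexp_holomorphic[OF X(2)] open_uhp z])
      then show ?thesis by (simp add: serre_def theta_op_def DERIV_imp_deriv algebra_simps)
    qed
    then have "24 * (serre (a + 4) (mf_val Q) z * (of_int D * mf_val X z) - mf_val Q z * serre a (\<lambda>z. of_int D * mf_val X z) z)
        + mf_val Q z * (of_int D * mf_val X z) * (\<Sum>(d, r)\<leftarrow>drs. of_int r * L d z) = of_int D * W z"
      by (simp add: W_def eta_expo_val[symmetric] algebra_simps)
    then show "24 * (serre (a + 4) (mf_val Q) z * (of_int D * mf_val X z) - mf_val Q z * serre a (\<lambda>z. of_int D * mf_val X z) z)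
        + mf_val Q z * (of_int D * mf_val X z) * (\<Sum>(d, r)\<leftarrow>drs. of_int r * L d z) = 0"
      using W0[OF z] by simp
  next
    fix i assume i: "i < m"
    then show "fps_nth ?QF i = 0"
      using Q(3)[OF n] lead(2) mn by (auto simp: approx_def list_all_length)
  next
    show "fps_nth ?QF m = fps_nth (fps_const (of_int D) * ?XF) 0"
      using Q(3)[OF n] lead(3) mn hdx by (auto simp: approx_def)
    show "fps_nth (fps_const (of_int D) * ?XF) 0 \<noteq> 0"
      using D lead(1) hdx by simp
  qed
  then show ?thesis by (simp add: mult.assoc)
qed

section \<open>Explicit Eisenstein polynomials\<close>

fun lin :: "(int \<times> mfexp) list \<Rightarrow> mfexp" where
  "lin [] = One"
| "lin [(c, e)] = Scale c e"
| "lin ((c, e) # xs) = Add (Scale c e) (lin xs)"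

text \<open>The coefficients of the following forms were found by linear algebra on \<open>q\<close>-expansions. At
  level 22 products of Eisenstein series do not span the forms of weight 4, so the eta quotients
  are multiplied by \<open>L\<^sub>2 L\<^sub>2\<^sub>2\<close> first.\<close>

definition denominator_22 :: mfexp where "denominator_22 = Mul (GL 2) (GL 22)"

text \<open>Products are collected by a common factor, in the manner of Horner, to keep the number
  of truncated multiplications small.\<close>

definition form_30_1 :: mfexp where
  "form_30_1 = lin [(1, Mul (GL 2) (lin [(32, GL 5), (- 160, GL 6), (48, GL 10),
    (- 16, GL 15), (16, GL 30)])), (1, Mul (GL 3) (lin [(- 60, GL 3), (16, GL
    5), (120, GL 6), (- 8, GL 10), (- 48, GL 15)])), (1, Mul (GL 5) (lin [(25,
    GL 5), (- 16, GL 6), (- 40, GL 10), (40, GL 30)])), (1, Mul (GL 6) (lin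
    [(16, GL 10), (48, GL 15), (- 48, GL 30)]))]"

definition form_14_1 :: mfexp where
  "form_14_1 = lin [(1, Mul (GL 2) (lin [(700, GL 2), (- 200, GL 7), (760, GL
    14)])), (1, Mul (GL 7) (lin [(875, GL 7), (- 1960, GL 14)])), (700, Mul (GL
    14) (GL 14)), (- 126, GE 1), (- 6174, GE 7)]"

definition form_14_2 :: mfexp where
  "form_14_2 = lin [(1, Mul (GL 2) (lin [(- 35, GL 2), (10, GL 7), (- 38, GL 14)])),
    (1, Mul (GL 7) (lin [(- 35, GL 7), (98, GL 14)])), (- 35, Mul (GL 14) (GL 14))]"

text \<open>The weight is 8: weight 4 of the eta quotient plus weight 4 of
  \<open>denominator_22\<close>.\<close>

definition form_22_1 :: mfexp where
  "form_22_1 = lin [(1, Mul (GL 2) (lin [(1, Mul (GL 2) (lin [(1, Mul (GL 2) (lin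
    [(14171300, GL 2), (10908253, GL 11), (25090380, GL 22)])), (1, Mul (GL 11)
    (lin [(- 4769265, GL 11), (5503635, GL 22)])), (13662540, Mul (GL 22) (GL 22)),
    (- 11895840, GE 1), (- 409217160, GE 11)])), (1, Mul (GL 11) (lin [(1, Mul (GL
    11) (lin [(38099380, GL 11), (- 46381170, GL 22)])), (- 36156945, Mul (GL 22) (GL
    22)), (- 483330, GE 1), (- 868325766, GE 11)])), (1, Mul (GL 22) (lin
    [(23407780, Mul (GL 22) (GL 22)), (- 3527160, GE 1), (- 859613040, GE 11)]))])),
    (1, Mul (GL 11) (lin [(1, Mul (GL 11) (lin [(1, Mul (GL 11) (lin [(- 41072482, GL
    11), (78731796, GL 22)])), (- 35104641, Mul (GL 22) (GL 22)), (1532649, GE 1),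
    (1252200807, GE 11)])), (1, Mul (GL 22) (lin [(2180057, Mul (GL 22) (GL 22)),
    (276576, GE 1)]))]))]"

definition form_22_2 :: mfexp where
  "form_22_2 = lin [(1, Mul (GL 2) (lin [(1, Mul (GL 2) (lin [(1, Mul (GL 2) (lin
    [(- 3373700, GL 2), (- 2631097, GL 11), (- 2601900, GL 22)])), (1, Mul (GL 11)
    (lin [(- 445515, GL 11), (782145, GL 22)])), (- 2501100, Mul (GL 22) (GL 22)),
    (2871000, GE 1), (116886000, GE 11)])), (1, Mul (GL 11) (lin [(1, Mul (GL 11)
    (lin [(- 9807820, GL 11), (15774594, GL 22)])), (804045, Mul (GL 22) (GL 22)),
    (494130, GE 1), (254425974, GE 11)])), (1, Mul (GL 22) (lin [(- 2863300, Mul (GL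
    22) (GL 22)), (- 856800, GE 1), (77464200, GE 11)]))])), (1, Mul (GL 11) (lin
    [(1, Mul (GL 11) (lin [(1, Mul (GL 11) (lin [(6686218, GL 11), (- 12816804, GL
    22)])), (5714709, Mul (GL 22) (GL 22)), (- 249501, GE 1), (- 203846643, GE
    11)])), (1, Mul (GL 22) (lin [(- 354893, Mul (GL 22) (GL 22)), (- 45024, GE
    1)]))]))]"

definition form_22_3 :: mfexp where
  "form_22_3 = lin [(1, Mul (GL 2) (lin [(1, Mul (GL 2) (lin [(1, Mul (GL 2) (lin [(2750,
    GL 2), (2205, GL 11), (- 1050, GL 22)])), (1, Mul (GL 11) (lin [(3150, GL
    11), (- 5334, GL 22)])), (3570, Mul (GL 22) (GL 22)), (- 2409, GE 1),
    (- 129591, GE 11)])), (1, Mul (GL 11) (lin [(1, Mul (GL 11) (lin [(9295, GL 11),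
    (- 17490, GL 22)])), (5709, Mul (GL 22) (GL 22)), (- 1071, GE 1), (- 291489,
    GE 11)])), (1, Mul (GL 22) (lin [(330, Mul (GL 22) (GL 22)), (2919, GE 1),
    (67881, GE 11)]))]))]"

definition form_22_4 :: mfexp where
  "form_22_4 = lin [(1, Mul (GL 2) (lin [(1, Mul (GL 2) (lin [(1, Mul (GL 2) (lin
    [(1080200, GL 2), (792127, GL 11), (2706984, GL 22)])), (1, Mul (GL 11) (lin
    [(- 2181585, GL 11), (3946635, GL 22)])), (- 1270248, Mul (GL 22) (GL 22)),
    (- 861894, GE 1), (- 8807106, GE 11)])), (1, Mul (GL 11) (lin [(1, Mul (GL 11)
    (lin [(2055790, GL 11), (- 1958550, GL 22)])), (- 3510375, Mul (GL 22) (GL 22)),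
    (399084, GE 1), (- 11324148, GE 11)])), (1, Mul (GL 22) (lin [(1817464, Mul (GL
    22) (GL 22)), (- 1577646, GE 1), (- 134076954, GE 11)]))])), (1, Mul (GL 11)
    (lin [(1, Mul (GL 11) (lin [(1, Mul (GL 11) (lin [(- 6686218, GL 11), (12816804,
    GL 22)])), (- 5714709, Mul (GL 22) (GL 22)), (249501, GE 1), (203846643, GE
    11)])), (1, Mul (GL 22) (lin [(354893, Mul (GL 22) (GL 22)), (45024, GE 1)]))]))]"

definition form_30_2 :: mfexp where
  "form_30_2 = lin [(1, Mul (GL 2) (lin [(- 5, GL 3), (8, GL 6)])), (- 3, Mul (GL 3)
    (GL 6))]"

definition form_30_3 :: mfexp where
  "form_30_3 = lin [(1, Mul (GL 2) (lin [(- 12, GL 3), (- 25, GL 5), (32, GL 6),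
    (24, GL 10), (8, GL 15), (- 8, GL 30)])), (1, Mul (GL 3) (lin [(12, GL 3),
    (- 8, GL 5), (- 24, GL 6), (4, GL 10), (24, GL 15)])), (1, Mul (GL 5) (lin
    [(- 5, GL 5), (8, GL 6), (5, GL 10), (- 20, GL 30)])), (1, Mul (GL 6) (lin
    [(- 8, GL 10), (- 24, GL 15), (24, GL 30)]))]"

definition form_30_4 :: mfexp where
  "form_30_4 = lin [(1, Mul (GL 2) (lin [(60, GL 3), (- 101, GL 5), (160, GL 6),
    (- 24, GL 10), (- 8, GL 15), (8, GL 30)])), (1, Mul (GL 3) (lin [(60, GL
    3), (8, GL 5), (- 120, GL 6), (- 4, GL 10), (- 24, GL 15)])), (1, Mul
    (GL 5) (lin [(- 25, GL 5), (- 8, GL 6), (25, GL 10), (20, GL 30)])), (1,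
    Mul (GL 6) (lin [(8, GL 10), (24, GL 15), (- 24, GL 30)]))]"

definition form_14_3 :: mfexp where
  "form_14_3 = lin [(1, Mul (GL 2) (lin [(- 14, GL 2), (11, GL 7), (- 32, GL 14)])),
    (1, Mul (GL 7) (lin [(- 119, GL 7), (259, GL 14)])), (- 98, Mul (GL 14) (GL
    14)), (- 21, GE 1), (1029, GE 7)]"

definition form_14_4 :: mfexp where
  "form_14_4 = lin [(1, Mul (GL 2) (lin [(- 98, GL 2), (- 31, GL 7), (- 32, GL
    14)])), (1, Mul (GL 7) (lin [(7, GL 7), (49, GL 14)])), (- 14, Mul (GL 14) (GL
    14)), (21, GE 1), (- 1029, GE 7)]"

definition form_30_5 :: mfexp where
  "form_30_5 = lin [(1, Mul (GL 2) (lin [(- 480, GL 2), (- 120, GL 3), (- 150, GL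
    5), (80, GL 6), (- 156, GL 10), (34, GL 15), (12, GL 30)])), (1, Mul (GL
    3) (lin [(210, GL 3), (405, GL 5), (- 60, GL 6), (- 162, GL 10), (342, GL
    15), (- 30, GL 30)])), (1, Mul (GL 5) (lin [(- 134, GL 6), (120, GL 10),
    (- 175, GL 15), (- 120, GL 30)])), (1, Mul (GL 6) (lin [(108, GL 10),
    (- 126, GL 15), (132, GL 30)]))]"

definition form_30_6 :: mfexp where
  "form_30_6 = lin [(1, Mul (GL 2) (lin [(- 180, GL 2), (- 45, GL 3), (90, GL 5),
    (10, GL 6), (- 81, GL 10), (50, GL 15), (- 159, GL 30)])), (1, Mul (GL 3)
    (lin [(75, GL 3), (- 78, GL 5), (- 15, GL 6), (- 5, GL 10), (84, GL 15),
    (189, GL 30)])), (1, Mul (GL 5) (lin [(- 15, GL 5), (14, GL 6), (60, GL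
    10), (- 50, GL 15), (- 60, GL 30)])), (1, Mul (GL 6) (lin [(21, GL 10),
    (- 42, GL 15), (27, GL 30)])), (- 10, Mul (GL 10) (GL 30))]"

definition form_30_7 :: mfexp where
  "form_30_7 = lin [(1, Mul (GL 2) (lin [(- 20, GL 2), (50, GL 3), (35, GL 5),
    (- 50, GL 6), (- 96, GL 10), (- 26, GL 15), (42, GL 30)])), (1, Mul (GL 3)
    (lin [(30, GL 3), (14, GL 5), (- 12, GL 10), (42, GL 15), (6, GL 30)])),
    (1, Mul (GL 5) (lin [(- 15, GL 5), (- 11, GL 6), (35, GL 10), (- 55, GL
    30)])), (1, Mul (GL 6) (lin [(22, GL 10), (- 18, GL 15), (12, GL 30)])),
    (10, Mul (GL 10) (GL 30))]"

definition form_30_8 :: mfexp where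
  "form_30_8 = lin [(1, Mul (GL 2) (lin [(180, GL 2), (- 90, GL 3), (15, GL 5),
    (220, GL 6), (234, GL 10), (8, GL 15), (- 42, GL 30)])), (1, Mul (GL 3)
    (lin [(- 150, GL 3), (- 60, GL 5), (30, GL 6), (- 26, GL 10), (72, GL
    15), (- 66, GL 30)])), (1, Mul (GL 5) (lin [(165, GL 5), (8, GL 6),
    (- 285, GL 10), (- 200, GL 15), (390, GL 30)])), (1, Mul (GL 6) (lin [(- 6,
    GL 10), (72, GL 15), (- 354, GL 30)])), (80, Mul (GL 10) (GL 30))]"

definition form_30_9 :: mfexp where
  "form_30_9 = lin [(1, Mul (GL 2) (lin [(20, GL 2), (40, GL 3), (64, GL 5),
    (- 150, GL 6), (- 33, GL 10), (- 29, GL 15), (33, GL 30)])), (1, Mul (GL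
    3) (lin [(- 15, GL 3), (- 2, GL 5), (60, GL 6), (- 3, GL 10), (- 18, GL
    15), (3, GL 30)])), (1, Mul (GL 5) (lin [(- 15, GL 5), (- 8, GL 6), (25,
    GL 10), (40, GL 15), (- 65, GL 30)])), (1, Mul (GL 6) (lin [(5, GL 10),
    (- 3, GL 15), (51, GL 30)])), (- 10, Mul (GL 10) (GL 30))]"

definition form_30_10 :: mfexp where
  "form_30_10 = lin [(1, Mul (GL 2) (lin [(- 160, GL 2), (140, GL 3), (172, GL 5),
    (- 710, GL 6), (- 96, GL 10), (- 48, GL 15), (62, GL 30)])), (1, Mul (GL
    3) (lin [(- 120, GL 3), (120, GL 5), (450, GL 6), (- 80, GL 10), (- 96, GL
    15), (66, GL 30)])), (1, Mul (GL 5) (lin [(60, GL 5), (- 105, GL 6),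
    (- 50, GL 10), (- 40, GL 15), (95, GL 30)])), (1, Mul (GL 6) (lin [(158, GL
    10), (144, GL 15), (- 192, GL 30)])), (10, Mul (GL 10) (GL 30))]"

definition form_30_11 :: mfexp where
  "form_30_11 = lin [(1, Mul (GL 2) (lin [(900, GL 2), (1350, GL 3), (54, GL 5),
    (- 760, GL 6), (- 594, GL 10), (- 290, GL 15), (510, GL 30)])), (1, Mul
    (GL 3) (lin [(- 300, GL 3), (- 840, GL 5), (330, GL 6), (200, GL 10),
    (- 1254, GL 15), (324, GL 30)])), (1, Mul (GL 5) (lin [(- 75, GL 5), (565,
    GL 6), (- 150, GL 10), (470, GL 15), (375, GL 30)])), (1, Mul (GL 6) (lin
    [(- 30, GL 10), (654, GL 15), (- 1134, GL 30)])), (220, Mul (GL 10) (GL 30))]"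

definition form_30_12 :: mfexp where
  "form_30_12 = lin [(1, Mul (GL 2) (lin [(180, GL 2), (180, GL 3), (- 114, GL 5),
    (- 185, GL 6), (360, GL 10), (- 22, GL 15), (21, GL 30)])), (1, Mul (GL 3)
    (lin [(- 60, GL 3), (156, GL 5), (120, GL 6), (- 122, GL 10), (- 228, GL
    15), (174, GL 30)])), (1, Mul (GL 5) (lin [(120, GL 5), (- 40, GL 6),
    (- 270, GL 10), (- 20, GL 15), (120, GL 30)])), (1, Mul (GL 6) (lin [(- 15,
    GL 10), (150, GL 15), (- 420, GL 30)])), (155, Mul (GL 10) (GL 30))]"

definition form_30_13 :: mfexp where
  "form_30_13 = lin [(1, Mul (GL 2) (lin [(900, GL 2), (- 111, GL 5), (1090, GL 6),
    (666, GL 10), (- 70, GL 15), (120, GL 30)])), (1, Mul (GL 3) (lin [(300, GL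
    3), (- 330, GL 5), (- 870, GL 6), (790, GL 10), (- 234, GL 15), (204, GL
    30)])), (1, Mul (GL 5) (lin [(75, GL 5), (425, GL 6), (- 375, GL 10),
    (220, GL 15), (- 375, GL 30)])), (1, Mul (GL 6) (lin [(- 1140, GL 10),
    (- 126, GL 15), (- 354, GL 30)])), (470, Mul (GL 10) (GL 30))]"

definition form_30_14 :: mfexp where
  "form_30_14 = lin [(1, Mul (GL 2) (lin [(- 780, GL 2), (360, GL 3), (485, GL 5),
    (- 2460, GL 6), (- 336, GL 10), (- 172, GL 15), (108, GL 30)])), (1, Mul
    (GL 3) (lin [(- 420, GL 3), (408, GL 5), (1560, GL 6), (- 320, GL 10),
    (- 460, GL 15), (152, GL 30)])), (1, Mul (GL 5) (lin [(75, GL 5), (- 412, GL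
    6), (65, GL 10), (270, GL 30)])), (1, Mul (GL 6) (lin [(768, GL 10), (404,
    GL 15), (- 220, GL 30)])), (- 200, Mul (GL 10) (GL 30))]"

definition form_30_15 :: mfexp where
  "form_30_15 = lin [(1, Mul (GL 2) (lin [(- 180, GL 2), (315, GL 3), (279, GL 5),
    (- 1400, GL 6), (162, GL 10), (- 169, GL 15), (138, GL 30)])), (1, Mul (GL
    3) (lin [(- 240, GL 3), (228, GL 5), (885, GL 6), (- 38, GL 10), (- 258,
    GL 15), (198, GL 30)])), (1, Mul (GL 5) (lin [(210, GL 5), (- 133, GL 6),
    (- 300, GL 10), (- 110, GL 15), (210, GL 30)])), (1, Mul (GL 6) (lin [(30,
    GL 10), (417, GL 15), (- 594, GL 30)])), (140, Mul (GL 10) (GL 30))]"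

definition form_30_16 :: mfexp where
  "form_30_16 = lin [(1, Mul (GL 2) (lin [(- 1800, GL 2), (1350, GL 3), (1497, GL
    5), (- 6455, GL 6), (- 1422, GL 10), (- 610, GL 15), (525, GL 30)])),
    (1, Mul (GL 3) (lin [(- 1050, GL 3), (1200, GL 5), (3990, GL 6), (- 740, GL
    10), (- 2532, GL 15), (912, GL 30)])), (1, Mul (GL 5) (lin [(75, GL 5),
    (- 1240, GL 6), (225, GL 10), (460, GL 15), (750, GL 30)])), (1, Mul (GL
    6) (lin [(1965, GL 10), (1842, GL 15), (- 1302, GL 30)])), (- 415, Mul (GL 10)
    (GL 30))]"

definition form_30_17 :: mfexp where
  "form_30_17 = lin [(1, Mul (GL 2) (lin [(360, GL 2), (- 1620, GL 3), (- 1458, GL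
    5), (5695, GL 6), (162, GL 10), (530, GL 15), (- 789, GL 30)])), (1, Mul
    (GL 3) (lin [(930, GL 3), (- 924, GL 5), (- 3480, GL 6), (226, GL 10),
    (1308, GL 15), (- 990, GL 30)])), (1, Mul (GL 5) (lin [(- 780, GL 5), (602,
    GL 6), (1140, GL 10), (280, GL 15), (- 780, GL 30)])), (1, Mul (GL 6) (lin
    [(- 285, GL 10), (- 1698, GL 15), (2826, GL 30)])), (- 745, Mul (GL 10) (GL
    30))]"

definition form_30_18 :: mfexp where
  "form_30_18 = lin [(1, Mul (GL 2) (lin [(1800, GL 2), (- 2700, GL 3), (- 3222, GL
    5), (11230, GL 6), (2187, GL 10), (710, GL 15), (- 1365, GL 30)])), (1,
    Mul (GL 3) (lin [(1875, GL 3), (- 2040, GL 5), (- 6990, GL 6), (1450, GL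
    10), (1632, GL 15), (- 1332, GL 30)])), (1, Mul (GL 5) (lin [(- 1050, GL 5),
    (1880, GL 6), (1050, GL 10), (640, GL 15), (- 1500, GL 30)])), (1, Mul (GL
    6) (lin [(- 2625, GL 10), (- 2382, GL 15), (3987, GL 30)])), (- 610, Mul (GL
    10) (GL 30))]"

definition form_30_19 :: mfexp where
  "form_30_19 = lin [(1, Mul (GL 2) (lin [(- 30, GL 3), (- 33, GL 5), (68, GL 10),
    (12, GL 15), (- 12, GL 30)])), (1, Mul (GL 3) (lin [(- 12, GL 5), (6, GL
    10), (36, GL 15)])), (1, Mul (GL 5) (lin [(12, GL 6), (- 5, GL 10), (- 30,
    GL 30)])), (1, Mul (GL 6) (lin [(- 12, GL 10), (- 36, GL 15), (36, GL 30)]))]"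

definition form_30_20 :: mfexp where
  "form_30_20 = lin [(1, Mul (GL 2) (lin [(- 30, GL 3), (21, GL 5), (4, GL 10),
    (12, GL 15), (- 12, GL 30)])), (1, Mul (GL 3) (lin [(- 12, GL 5), (6, GL
    10), (36, GL 15)])), (1, Mul (GL 5) (lin [(12, GL 6), (5, GL 10), (- 30,
    GL 30)])), (1, Mul (GL 6) (lin [(- 12, GL 10), (- 36, GL 15), (36, GL 30)]))]"

section \<open>Eta quotients as Eisenstein polynomials\<close>

lemma form_30_1_eq:
  assumes "z \<in> uhp"
  shows "2880 * eta_quotient [(1, 4), (5, 4)] z
    = mf_val form_30_1 z"
proof -
  \<comment> \<open>For \<open>X\<close> = 1 the Wronskian-type form has weight 6, and 37 is the
    least n with 12 n > 6 * 72. The leading exponent is (1 * 4 + 5 * 4) / 24 = 1.\<close>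
  have "eta_cert 30 37 1 2880 One form_30_1
      [(1, 4), (5, 4)]"
    by code_simp
  from eta_cert_correct[OF this assms] show ?thesis by simp
qed

lemma form_14_1_eq:
  assumes "z \<in> uhp"
  shows "20160 * eta_quotient [(1, 5), (2, -1), (7, 5), (14, -1)] z
    = mf_val form_14_1 z"
proof -
  \<comment> \<open>At level 14, 13 is the least n with 12 n > 6 * 24.\<close>
  have "eta_cert 14 13 1 20160 One form_14_1
      [(1, 5), (2, -1), (7, 5), (14, -1)]"
    by code_simp
  from eta_cert_correct[OF this assms] show ?thesis by simp
qed

lemma form_14_2_eq:
  assumes "z \<in> uhp"
  shows "4032 * eta_quotient [(1, 2), (2, 2), (7, 2), (14, 2)] z
    = mf_val form_14_2 z"
proof -
  have "eta_cert 14 13 2 4032 One form_14_2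
      [(1, 2), (2, 2), (7, 2), (14, 2)]"
    by code_simp
  from eta_cert_correct[OF this assms] show ?thesis by simp
qed

lemma form_22_1_eq:
  assumes "z \<in> uhp"
  shows "634106880 * (mf_val denominator_22 z * eta_quotient [(1, 6), (2, -2), (11, 6), (22, -2)] z)
    = mf_val form_22_1 z"
proof -
  \<comment> \<open>With \<open>X\<close> of weight 4 the Wronskian-type form has weight 14, and 43
    is the least n with 12 n > 14 * 36; this determines the length of the tables.\<close>
  have "eta_cert 22 43 1 634106880 denominator_22 form_22_1
      [(1, 6), (2, -2), (11, 6), (22, -2)]"
    by code_simp
  from eta_cert_correct[OF this assms] show ?thesis by simp
qed

lemma form_22_2_eq:
  assumes "z \<in> uhp"
  shows "295916544 * (mf_val denominator_22 z * eta_quotient [(1, 4), (11, 4)] z)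
    = mf_val form_22_2 z"
proof -
  have "eta_cert 22 43 2 295916544 denominator_22 form_22_2
      [(1, 4), (11, 4)]"
    by code_simp
  from eta_cert_correct[OF this assms] show ?thesis by simp
qed

lemma form_22_3_eq:
  assumes "z \<in> uhp"
  shows "1064448 * (mf_val denominator_22 z * eta_quotient [(1, 2), (2, 2), (11, 2), (22, 2)] z)
    = mf_val form_22_3 z"
proof -
  have "eta_cert 22 43 3 1064448 denominator_22 form_22_3
      [(1, 2), (2, 2), (11, 2), (22, 2)]"
    by code_simp
  from eta_cert_correct[OF this assms] show ?thesis by simp
qed

lemma form_22_4_eq:
  assumes "z \<in> uhp"
  shows "1183666176 * (mf_val denominator_22 z * eta_quotient [(2, 4), (22, 4)] z)
    = mf_val form_22_4 z"
proof -
  have "eta_cert 22 43 4 1183666176 denominator_22 form_22_4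
      [(2, 4), (22, 4)]"
    by code_simp
  from eta_cert_correct[OF this assms] show ?thesis by simp
qed

lemma form_30_2_eq:
  assumes "z \<in> uhp"
  shows "288 * eta_quotient [(1, 2), (2, 2), (3, 2), (6, 2)] z
    = mf_val form_30_2 z"
proof -
  have "eta_cert 30 37 1 288 One form_30_2
      [(1, 2), (2, 2), (3, 2), (6, 2)]"
    by code_simp
  from eta_cert_correct[OF this assms] show ?thesis by simp
qed

lemma form_30_3_eq:
  assumes "z \<in> uhp"
  shows "2304 * eta_quotient [(1, -2), (2, 8), (5, 2)] z
    = mf_val form_30_3 z"
proof -
  have "eta_cert 30 37 1 2304 One form_30_3
      [(1, -2), (2, 8), (5, 2)]"
    by code_simp
  from eta_cert_correct[OF this assms] show ?thesis by simp
qed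

lemma form_30_4_eq:
  assumes "z \<in> uhp"
  shows "57600 * eta_quotient [(1, 2), (5, -2), (10, 8)] z
    = mf_val form_30_4 z"
proof -
  have "eta_cert 30 37 3 57600 One form_30_4
      [(1, 2), (5, -2), (10, 8)]"
    by code_simp
  from eta_cert_correct[OF this assms] show ?thesis by simp
qed

lemma form_14_3_eq:
  assumes "z \<in> uhp"
  shows "8064 * eta_quotient [(1, -2), (2, 6), (7, 6), (14, -2)] z
    = mf_val form_14_3 z"
proof -
  have "eta_cert 14 13 1 8064 One form_14_3
      [(1, -2), (2, 6), (7, 6), (14, -2)]"
    by code_simp
  from eta_cert_correct[OF this assms] show ?thesis by simp
qed

lemma form_14_4_eq:
  assumes "z \<in> uhp"
  shows "8064 * eta_quotient [(1, 6), (2, -2), (7, -2), (14, 6)] z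
    = mf_val form_14_4 z"
proof -
  have "eta_cert 14 13 3 8064 One form_14_4
      [(1, 6), (2, -2), (7, -2), (14, 6)]"
    by code_simp
  from eta_cert_correct[OF this assms] show ?thesis by simp
qed

lemma form_30_5_eq:
  assumes "z \<in> uhp"
  shows "4320 * eta_quotient [(1, 11), (2, -5), (3, -5), (5, -5), (6, 3), (10, 3), (15, 11), (30, -5)] z
    = mf_val form_30_5 z"
proof -
  have "eta_cert 30 37 1 4320 One form_30_5
      [(1, 11), (2, -5), (3, -5), (5, -5), (6, 3), (10, 3), (15, 11), (30, -5)]"
    by code_simp
  from eta_cert_correct[OF this assms] show ?thesis by simp
qed

lemma form_30_6_eq:
  assumes "z \<in> uhp"
  shows "155520 * eta_quotient [(1, 2), (2, -3), (3, -4), (5, -3), (6, 9), (10, 4), (15, 7), (30, -4)] z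
    = mf_val form_30_6 z"
proof -
  have "eta_cert 30 37 2 155520 One form_30_6
      [(1, 2), (2, -3), (3, -4), (5, -3), (6, 9), (10, 4), (15, 7), (30, -4)]"
    by code_simp
  from eta_cert_correct[OF this assms] show ?thesis by simp
qed

lemma form_30_7_eq:
  assumes "z \<in> uhp"
  shows "17280 * eta_quotient [(1, 4), (2, -3), (3, -2), (5, 2), (6, 5), (10, 1), (15, 0), (30, 1)] z
    = mf_val form_30_7 z"
proof -
  have "eta_cert 30 37 3 17280 One form_30_7
      [(1, 4), (2, -3), (3, -2), (5, 2), (6, 5), (10, 1), (15, 0), (30, 1)]"
    by code_simp
  from eta_cert_correct[OF this assms] show ?thesis by simp
qed

lemma form_30_8_eq:
  assumes "z \<in> uhp"
  shows "311040 * eta_quotient [(1, 1), (2, -2), (3, -3), (5, 2), (6, 8), (10, -1), (15, 2), (30, 1)] z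
    = mf_val form_30_8 z"
proof -
  have "eta_cert 30 37 4 311040 One form_30_8
      [(1, 1), (2, -2), (3, -3), (5, 2), (6, 8), (10, -1), (15, 2), (30, 1)]"
    by code_simp
  from eta_cert_correct[OF this assms] show ?thesis by simp
qed

lemma form_30_9_eq:
  assumes "z \<in> uhp"
  shows "86400 * eta_quotient [(1, 2), (2, -2), (3, 0), (5, -2), (6, 2), (10, 6), (15, 0), (30, 2)] z
    = mf_val form_30_9 z"
proof -
  have "eta_cert 30 37 5 86400 One form_30_9
      [(1, 2), (2, -2), (3, 0), (5, -2), (6, 2), (10, 6), (15, 0), (30, 2)]"
    by code_simp
  from eta_cert_correct[OF this assms] show ?thesis by simp
qed

lemma form_30_10_eq:
  assumes "z \<in> uhp"
  shows "17280 * eta_quotient [(1, 1), (2, 2), (3, 4), (5, 3), (6, -3), (10, -2), (15, -4), (30, 7)] z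
    = mf_val form_30_10 z"
proof -
  have "eta_cert 30 37 6 17280 One form_30_10
      [(1, 1), (2, 2), (3, 4), (5, 3), (6, -3), (10, -2), (15, -4), (30, 7)]"
    by code_simp
  from eta_cert_correct[OF this assms] show ?thesis by simp
qed

lemma form_30_11_eq:
  assumes "z \<in> uhp"
  shows "3888000 * eta_quotient [(1, 1), (2, 0), (3, -1), (5, -3), (6, 0), (10, 2), (15, 7), (30, 2)] z
    = mf_val form_30_11 z"
proof -
  have "eta_cert 30 37 7 3888000 One form_30_11
      [(1, 1), (2, 0), (3, -1), (5, -3), (6, 0), (10, 2), (15, 7), (30, 2)]"
    by code_simp
  from eta_cert_correct[OF this assms] show ?thesis by simp
qed

lemma form_30_12_eq:
  assumes "z \<in> uhp"
  shows "1555200 * eta_quotient [(1, 1), (2, -1), (3, -2), (5, 1), (6, 4), (10, -1), (15, 0), (30, 6)] z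
    = mf_val form_30_12 z"
proof -
  have "eta_cert 30 37 8 1555200 One form_30_12
      [(1, 1), (2, -1), (3, -2), (5, 1), (6, 4), (10, -1), (15, 0), (30, 6)]"
    by code_simp
  from eta_cert_correct[OF this assms] show ?thesis by simp
qed

lemma form_30_13_eq:
  assumes "z \<in> uhp"
  shows "3888000 * eta_quotient [(1, 0), (2, 1), (3, 0), (5, 2), (6, -1), (10, -3), (15, 2), (30, 7)] z
    = mf_val form_30_13 z"
proof -
  have "eta_cert 30 37 9 3888000 One form_30_13
      [(1, 0), (2, 1), (3, 0), (5, 2), (6, -1), (10, -3), (15, 2), (30, 7)]"
    by code_simp
  from eta_cert_correct[OF this assms] show ?thesis by simp
qed

lemma form_30_14_eq:
  assumes "z \<in> uhp"
  shows "518400 * eta_quotient [(1, -2), (2, 3), (3, 5), (5, 3), (6, -4), (10, -4), (15, -4), (30, 11)] z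
    = mf_val form_30_14 z"
proof -
  have "eta_cert 30 37 10 518400 One form_30_14
      [(1, -2), (2, 3), (3, 5), (5, 3), (6, -4), (10, -4), (15, -4), (30, 11)]"
    by code_simp
  from eta_cert_correct[OF this assms] show ?thesis by simp
qed

lemma form_30_15_eq:
  assumes "z \<in> uhp"
  shows "777600 * eta_quotient [(1, 1), (2, 0), (3, 1), (5, 3), (6, 0), (10, -4), (15, -5), (30, 12)] z
    = mf_val form_30_15 z"
proof -
  have "eta_cert 30 37 11 777600 One form_30_15
      [(1, 1), (2, 0), (3, 1), (5, 3), (6, 0), (10, -4), (15, -5), (30, 12)]"
    by code_simp
  from eta_cert_correct[OF this assms] show ?thesis by simp
qed

lemma form_30_16_eq:
  assumes "z \<in> uhp"
  shows "7776000 * eta_quotient [(1, 0), (2, 1), (3, 1), (5, 2), (6, -2), (10, -3), (15, -3), (30, 12)] z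
    = mf_val form_30_16 z"
proof -
  have "eta_cert 30 37 12 7776000 One form_30_16
      [(1, 0), (2, 1), (3, 1), (5, 2), (6, -2), (10, -3), (15, -3), (30, 12)]"
    by code_simp
  from eta_cert_correct[OF this assms] show ?thesis by simp
qed

lemma form_30_17_eq:
  assumes "z \<in> uhp"
  shows "3110400 * eta_quotient [(1, -1), (2, 3), (3, 1), (5, 3), (6, -1), (10, -5), (15, -7), (30, 15)] z
    = mf_val form_30_17 z"
proof -
  have "eta_cert 30 37 13 3110400 One form_30_17
      [(1, -1), (2, 3), (3, 1), (5, 3), (6, -1), (10, -5), (15, -7), (30, 15)]"
    by code_simp
  from eta_cert_correct[OF this assms] show ?thesis by simp
qed

lemma form_30_18_eq:
  assumes "z \<in> uhp"
  shows "7776000 * eta_quotient [(1, 0), (2, 1), (3, 2), (5, 2), (6, -3), (10, -3), (15, -8), (30, 17)] z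
    = mf_val form_30_18 z"
proof -
  have "eta_cert 30 37 15 7776000 One form_30_18
      [(1, 0), (2, 1), (3, 2), (5, 2), (6, -3), (10, -3), (15, -8), (30, 17)]"
    by code_simp
  from eta_cert_correct[OF this assms] show ?thesis by simp
qed

lemma form_30_19_eq:
  assumes "z \<in> uhp"
  shows "5760 * eta_quotient [(1, -1), (2, 5), (5, 5), (10, -1)] z
    = mf_val form_30_19 z"
proof -
  have "eta_cert 30 37 1 5760 One form_30_19
      [(1, -1), (2, 5), (5, 5), (10, -1)]"
    by code_simp
  from eta_cert_correct[OF this assms] show ?thesis by simp
qed

lemma form_30_20_eq:
  assumes "z \<in> uhp"
  shows "5760 * eta_quotient [(1, 5), (2, -1), (5, -1), (10, 5)] z
    = mf_val form_30_20 z"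
proof -
  have "eta_cert 30 37 2 5760 One form_30_20
      [(1, 5), (2, -1), (5, -1), (10, 5)]"
    by code_simp
  from eta_cert_correct[OF this assms] show ?thesis by simp
qed

section \<open>The cusp forms as Eisenstein polynomials\<close>

lemma of_nat_sq_plus_1_nonzero: "(of_nat m)\<^sup>2 + 1 \<noteq> (0 :: complex)"
proof -
  have "(of_nat m)\<^sup>2 + 1 = (of_nat (m\<^sup>2 + 1) :: complex)" by simp
  then show ?thesis by (simp only: of_nat_eq_0_iff)
qed

text \<open>Here and in the next two definitions the defining identity is multiplied by its
  denominator, p^2 + 1 or (p^2 + 1)(q^2 + 1), which makes all coefficients integral.\<close>

definition C_1p_form :: "nat \<Rightarrow> mfexp" where
  "C_1p_form m = (let p = int m in
     lin [(p\<^sup>2 + 1, Mul (GL m) (GL m)), (- (p - 1)\<^sup>2, GE 1), (- (p\<^sup>2 * (p - 1)\<^sup>2), GE m)])"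

definition C_pp_form :: "nat \<Rightarrow> nat \<Rightarrow> mfexp" where
  "C_pp_form m n = (let p = int m; q = int n in
     lin [((p\<^sup>2 + 1) * (q\<^sup>2 + 1), Mul (GL m) (GL n)), (- (p\<^sup>2 - p + 1) * (q\<^sup>2 - q + 1), GE 1),
       (p ^ 3 * (q\<^sup>2 - q + 1), GE m), (q ^ 3 * (p\<^sup>2 - p + 1), GE n), (- (p ^ 3 * q ^ 3), GE (m * n))])"

definition C_1pp_form :: "nat \<Rightarrow> nat \<Rightarrow> mfexp" where
  "C_1pp_form m n = (let p = int m; q = int n; D = (p\<^sup>2 + 1) * (q\<^sup>2 + 1) in
     lin [(D, Mul (GL (m * n)) (GL (m * n))), (2 * p * q - D, GE 1),
       (2 * p ^ 3 * q, GE m), (2 * p * q ^ 3, GE n), (2 * p ^ 3 * q ^ 3 - D * p\<^sup>2 * q\<^sup>2, GE (m * n))])"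

lemma C_1p_form: "mf_val (C_1p_form m) z = ((of_nat m)\<^sup>2 + 1) * C_1p m z"
proof -
  define P where "P = (of_nat m)\<^sup>2 + (1 :: complex)"
  have P: "P \<noteq> 0" using of_nat_sq_plus_1_nonzero by (simp add: P_def)
  have "P * C_1p m z = P * (L m z)\<^sup>2 - (of_nat m - 1)\<^sup>2 * E4 z - (of_nat m)\<^sup>2 * (of_nat m - 1)\<^sup>2 * E4 (of_nat m * z)"
    unfolding C_1p_def Let_def P_def[symmetric] using P by (simp add: field_simps)
  also have "\<dots> = mf_val (C_1p_form m) z"
    by (simp add: C_1p_form_def Let_def P_def power2_eq_square)
  finally show ?thesis by (simp add: P_def)
qed

lemma C_pp_form:
  "mf_val (C_pp_form m n) z = ((of_nat m)\<^sup>2 + 1) * ((of_nat n)\<^sup>2 + 1) * C_pp m n z"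
proof -
  define p q where "p = (of_nat m :: complex)" and "q = (of_nat n :: complex)"
  define D where "D = (p\<^sup>2 + 1) * (q\<^sup>2 + 1)"
  have D: "D \<noteq> 0" using of_nat_sq_plus_1_nonzero by (simp add: D_def p_def q_def)
  have d: "D * (a / D * x) = a * x" for a x using D by simp
  have "mf_val (C_pp_form m n) z = D * (L m z * L n z) + (- (p\<^sup>2 - p + 1) * (q\<^sup>2 - q + 1) * E4 z
      + (p ^ 3 * (q\<^sup>2 - q + 1) * E4 (p * z) + (q ^ 3 * (p\<^sup>2 - p + 1) * E4 (q * z)
      + - (p ^ 3 * q ^ 3) * E4 (p * q * z))))"
    by (simp only: C_pp_form_def Let_def lin.simps mf_val.simps D_def p_def q_def of_int_add of_int_mult
        of_int_power of_int_diff of_int_minus of_int_1 of_int_of_nat_eq of_nat_1 of_nat_mult mult_1)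
  also have "\<dots> = D * (L m z * L n z) - ((p\<^sup>2 - p + 1) * (q\<^sup>2 - q + 1) * E4 z
      - p ^ 3 * (q\<^sup>2 - q + 1) * E4 (p * z) - q ^ 3 * (p\<^sup>2 - p + 1) * E4 (q * z) + p ^ 3 * q ^ 3 * E4 (p * q * z))"
    by algebra
  also have "\<dots> = D * C_pp m n z"
    unfolding C_pp_def Let_def p_def[symmetric] q_def[symmetric] D_def[symmetric]
    by (simp only: right_diff_distrib distrib_left d)
  finally show ?thesis by (simp only: D_def p_def q_def)
qed

lemma C_1pp_form:
  "mf_val (C_1pp_form m n) z = ((of_nat m)\<^sup>2 + 1) * ((of_nat n)\<^sup>2 + 1) * C_1pp m n z"
proof -
  define p q where "p = (of_nat m :: complex)" and "q = (of_nat n :: complex)"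
  define D where "D = (p\<^sup>2 + 1) * (q\<^sup>2 + 1)"
  have D: "D \<noteq> 0" using of_nat_sq_plus_1_nonzero by (simp add: D_def p_def q_def)
  have d: "D * (a / D * x) = a * x" "D * ((b - a / D) * x) = (D * b - a) * x" for a b x
    using D by (simp_all add: field_simps)
  have "mf_val (C_1pp_form m n) z = D * (L (m * n) z * L (m * n) z) + ((2 * p * q - D) * E4 z
      + (2 * p ^ 3 * q * E4 (p * z) + (2 * p * q ^ 3 * E4 (q * z)
      + (2 * p ^ 3 * q ^ 3 - D * p\<^sup>2 * q\<^sup>2) * E4 (p * q * z))))"
    by (simp only: C_1pp_form_def Let_def lin.simps mf_val.simps D_def p_def q_def of_int_add of_int_mult
        of_int_power of_int_diff of_int_minus of_int_1 of_int_of_nat_eq of_nat_1 of_nat_mult mult_1 of_int_numeral)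
  also have "\<dots> = D * (L (m * n) z)\<^sup>2 - ((D * 1 - 2 * p * q) * E4 z
      - 2 * p ^ 3 * q * E4 (p * z) - 2 * p * q ^ 3 * E4 (q * z)
      + (D * (p\<^sup>2 * q\<^sup>2) - 2 * p ^ 3 * q ^ 3) * E4 (p * q * z))"
    by algebra
  also have "\<dots> = D * C_1pp m n z"
    unfolding C_1pp_def Let_def p_def[symmetric] q_def[symmetric] D_def[symmetric]
    by (simp only: right_diff_distrib[of D "(L (m * n) z)\<^sup>2"] right_diff_distrib[of D "_ * E4 _"]
        right_diff_distrib[of D "_ * E4 _ - _ * E4 _"] distrib_left d)
  finally show ?thesis by (simp only: D_def p_def q_def)
qed

lemma C_1p_holomorphic: "m > 0 \<Longrightarrow> C_1p m holomorphic_on uhp"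
proof -
  assume m: "m > 0"
  have "mf_ok m (C_1p_form m)" using m by (simp add: C_1p_form_def Let_def)
  note h = qexp_holomorphic[OF mf_correct(2)[OF this]]
  have "(\<lambda>z. mf_val (C_1p_form m) z / ((of_nat m)\<^sup>2 + 1)) holomorphic_on uhp"
    using of_nat_sq_plus_1_nonzero[of m] by (intro holomorphic_intros h) auto
  then show ?thesis
    unfolding C_1p_form using of_nat_sq_plus_1_nonzero[of m] by simp
qed

lemma eta_quotient_holomorphic:
  "\<forall>(d, r)\<in>set drs. d > 0 \<Longrightarrow> eta_quotient drs holomorphic_on uhp"
  using eta_quotient_derivative(1)[of _ drs]
  by (auto simp: holomorphic_on_def field_differentiable_def intro: has_field_derivative_at_within)

text \<open>L_2 L_22 has constant term (1 - 2)(1 - 22) = 21, so it is not identically zero and can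
  be cancelled among holomorphic functions even at its zeros.\<close>

lemma denominator_22_mult_eq_0:
  assumes h: "h holomorphic_on uhp" and 0: "\<And>z. z \<in> uhp \<Longrightarrow> mf_val denominator_22 z * h z = 0" and z: "z \<in> uhp"
  shows "h z = 0"
proof -
  have "mf_ok 22 denominator_22" by code_simp
  note X = mf_correct[OF this]
  have "hd (mf_ser 1 denominator_22) \<noteq> 0" "length (mf_ser 1 denominator_22) = 1" by code_simp+
  then have "fps_nth (mf_fps denominator_22) 0 \<noteq> 0"
    using X(3)[of 1] by (cases "mf_ser 1 denominator_22") (auto simp: approx_def)
  then obtain z0 where "z0 \<in> uhp" "mf_val denominator_22 z0 \<noteq> 0"
    using qexp_zero[OF X(2)] by fastforce
  then show ?thesis
    by (intro holomorphic_mult_eq_0[OF qexp_holomorphic[OF X(2)] h 0 _ _ z])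
qed

definition zero_cert :: "nat \<Rightarrow> nat \<Rightarrow> mfexp \<Rightarrow> bool" where
  "zero_cert N n e \<longleftrightarrow> mf_ok N e \<and> sturm_ok N (mf_weight e) n \<and> list_all (\<lambda>x. x = 0) (mf_ser n e)"

lemma zero_cert_correct: "zero_cert N n e \<Longrightarrow> z \<in> uhp \<Longrightarrow> mf_val e z = 0"
  using mf_zero[of N e n z] by (simp add: zero_cert_def)

section \<open>The identities for the individual cusp forms\<close>

lemmas C_form_vals = C_1p_form C_pp_form C_1pp_form of_nat_numeral

lemma C_1p_2_eq:
  assumes "z \<in> uhp"
  shows "C_1p 2 z = 0"
proof -
  \<comment> \<open>In weight 4 at level 30, 25 is the least n with 12 n > 4 * 72.\<close>
  have "zero_cert 30 25
    (lin [(1, C_1p_form 2)])"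
    by code_simp
  note zero = zero_cert_correct[OF this assms, unfolded lin.simps mf_val.simps of_int_minus of_int_numeral of_int_1 C_form_vals]
  show ?thesis
    using zero by algebra
qed

lemma C_1p_3_eq:
  assumes "z \<in> uhp"
  shows "C_1p 3 z = 0"
proof -
  have "zero_cert 30 25
    (lin [(1, C_1p_form 3)])"
    by code_simp
  note zero = zero_cert_correct[OF this assms, unfolded lin.simps mf_val.simps of_int_minus of_int_numeral of_int_1 C_form_vals]
  show ?thesis
    using zero by algebra
qed

lemma C_1p_5_eq:
  assumes "z \<in> uhp"
  shows "C_1p 5 z =
         (576/13) * eta_quotient [(1, 4), (5, 4)] z"
proof -
  \<comment> \<open>\<open>C_1p_form 5\<close> is 26 C_(1,5) and \<open>form_30_1\<close> is 2880
    times the eta quotient, so the relation reads 130 C = 5760 eta, and 5760 / 130 = 576 / 13. The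
    multipliers in the other relations arise in the same way.\<close>
  have "zero_cert 30 25
    (lin [(5, C_1p_form 5), (- 2, form_30_1)])"
    by code_simp
  note zero = zero_cert_correct[OF this assms, unfolded lin.simps mf_val.simps of_int_minus of_int_numeral of_int_1 C_form_vals
      form_30_1_eq[OF assms, symmetric]]
  show ?thesis
    using zero by algebra
qed

lemma C_1p_7_eq:
  assumes "z \<in> uhp"
  shows "C_1p 7 z =
         (576/5) * eta_quotient [(1, 5), (2, -1), (7, 5), (14, -1)] z
       + (2304/5) * eta_quotient [(1, 2), (2, 2), (7, 2), (14, 2)] z"
proof -
  \<comment> \<open>At level 14, 9 is the least n with 12 n > 4 * 24.\<close>
  have "zero_cert 14 9
    (lin [(7, C_1p_form 7), (- 2, form_14_1), (- 40, form_14_2)])"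
    by code_simp
  note zero = zero_cert_correct[OF this assms, unfolded lin.simps mf_val.simps of_int_minus of_int_numeral of_int_1 C_form_vals
      form_14_1_eq[OF assms, symmetric] form_14_2_eq[OF assms, symmetric]]
  show ?thesis
    using zero by algebra
qed

lemma C_1p_11_eq:
  assumes "z \<in> uhp"
  shows "C_1p 11 z =
         (17280/61) * eta_quotient [(1, 6), (2, -2), (11, 6), (22, -2)] z
       + (118656/61) * eta_quotient [(1, 4), (11, 4)] z
       + (276480/61) * eta_quotient [(1, 2), (2, 2), (11, 2), (22, 2)] z
       + (276480/61) * eta_quotient [(2, 4), (22, 4)] z"
proof -
  \<comment> \<open>The claim with denominators cleared: 15669192 = 128436 * (11^2 + 1), and the
    other coefficients are 7, 103, 66720 and 60 times the scalars of the four eta quotient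
    equations.\<close>
  define h where "h z = 15669192 * C_1p 11 z - (
    4438748160 * eta_quotient [(1, 6), (2, -2), (11, 6), (22, -2)] z + 30479404032
    * eta_quotient [(1, 4), (11, 4)] z + 71019970560 * eta_quotient [(1, 2), (2,
    2), (11, 2), (22, 2)] z + 71019970560 * eta_quotient [(2, 4), (22, 4)] z)" for z
  \<comment> \<open>The relation is certified after multiplication by \<open>denominator_22\<close>,
    in weight 8, where 25 is the least n with 12 n > 8 * 36; the factor is cancelled
    afterwards.\<close>
  have "zero_cert 22 25
    (lin [(128436, Mul denominator_22 (C_1p_form 11)), (- 7, form_22_1), (- 103,
    form_22_2), (- 66720, form_22_3), (- 60, form_22_4)])"
    by code_simp
  note zero = zero_cert_correct[OF this, unfolded lin.simps mf_val.simps of_int_minus of_int_numeral of_int_1 C_form_vals]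
  have "mf_val denominator_22 z * h z = 0" if "z \<in> uhp" for z
    using zero[OF that, unfolded form_22_1_eq[OF that, symmetric] form_22_2_eq[OF that, symmetric] form_22_3_eq[OF that,
      symmetric] form_22_4_eq[OF that, symmetric]]
    unfolding h_def by algebra
  moreover have "h holomorphic_on uhp"
    unfolding h_def
    by (intro holomorphic_intros C_1p_holomorphic eta_quotient_holomorphic) auto
  ultimately have "h z = 0"
    using denominator_22_mult_eq_0 assms by blast
  then show ?thesis
    unfolding h_def by algebra
qed

lemma C_pp_2_3_eq:
  assumes "z \<in> uhp"
  shows "C_pp 2 3 z =
       - (144/5) * eta_quotient [(1, 2), (2, 2), (3, 2), (6, 2)] z"
proof -
  have "zero_cert 30 25
    (lin [(1, C_pp_form 2 3), (5, form_30_2)])"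
    by code_simp
  note zero = zero_cert_correct[OF this assms, unfolded lin.simps mf_val.simps of_int_minus of_int_numeral of_int_1 C_form_vals
      form_30_2_eq[OF assms, symmetric]]
  show ?thesis
    using zero by algebra
qed

lemma C_pp_2_5_eq:
  assumes "z \<in> uhp"
  shows "C_pp 2 5 z =
         (48/13) * eta_quotient [(1, -2), (2, 8), (5, 2)] z
       - (6000/13) * eta_quotient [(1, 2), (5, -2), (10, 8)] z"
proof -
  have "zero_cert 30 25
    (lin [(24, C_pp_form 2 5), (- 5, form_30_3), (25, form_30_4)])"
    by code_simp
  note zero = zero_cert_correct[OF this assms, unfolded lin.simps mf_val.simps of_int_minus of_int_numeral of_int_1 C_form_vals
      form_30_3_eq[OF assms, symmetric] form_30_4_eq[OF assms, symmetric]]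
  show ?thesis
    using zero by algebra
qed

lemma C_pp_2_7_eq:
  assumes "z \<in> uhp"
  shows "C_pp 2 7 z =
         (288/5) * eta_quotient [(1, 5), (2, -1), (7, 5), (14, -1)] z
       - (336/25) * eta_quotient [(1, -2), (2, 6), (7, 6), (14, -2)] z
       + (8064/25) * eta_quotient [(1, 2), (2, 2), (7, 2), (14, 2)] z
       - (5136/25) * eta_quotient [(1, 6), (2, -2), (7, -2), (14, 6)] z"
proof -
  have "zero_cert 14 9
    (lin [(84, C_pp_form 2 7), (- 60, form_14_1), (35, form_14_3), (- 1680,
    form_14_2), (535, form_14_4)])"
    by code_simp
  note zero = zero_cert_correct[OF this assms, unfolded lin.simps mf_val.simps of_int_minus of_int_numeral of_int_1 C_form_vals
      form_14_1_eq[OF assms, symmetric] form_14_3_eq[OF assms, symmetric] form_14_2_eq[OF assms,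
      symmetric] form_14_4_eq[OF assms, symmetric]]
  show ?thesis
    using zero by algebra
qed

lemma C_pp_3_5_eq:
  assumes "z \<in> uhp"
  shows "C_pp 3 5 z =
         (108/13) * eta_quotient [(1, 11), (2, -5), (3, -5), (5, -5), (6, 3), (10, 3), (15, 11), (30, -5)] z
       - (1584/13) * eta_quotient [(1, 2), (2, -3), (3, -4), (5, -3), (6, 9), (10, 4), (15, 7), (30, -4)] z
       - (2376/13) * eta_quotient [(1, 4), (2, -3), (3, -2), (5, 2), (6, 5), (10, 1), (15, 0), (30, 1)] z
       - (5832/13) * eta_quotient [(1, 1), (2, -2), (3, -3), (5, 2), (6, 8), (10, -1), (15, 2), (30, 1)] z
       + (11448/13) * eta_quotient [(1, 2), (2, -2), (3, 0), (5, -2), (6, 2), (10, 6), (15, 0), (30, 2)] z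
       + (33264/13) * eta_quotient [(1, 1), (2, 2), (3, 4), (5, 3), (6, -3), (10, -2), (15, -4), (30, 7)] z
       + (10080/13) * eta_quotient [(1, 1), (2, 0), (3, -1), (5, -3), (6, 0), (10, 2), (15, 7), (30, 2)] z
       + (83520/13) * eta_quotient [(1, 1), (2, -1), (3, -2), (5, 1), (6, 4), (10, -1), (15, 0), (30, 6)] z
       + (145584/13) * eta_quotient [(1, 0), (2, 1), (3, 0), (5, 2), (6, -1), (10, -3), (15, 2), (30, 7)] z
       - (117720/13) * eta_quotient [(1, -2), (2, 3), (3, 5), (5, 3), (6, -4), (10, -4), (15, -4), (30, 11)] z
       - 1944 * eta_quotient [(1, 1), (2, 0), (3, 1), (5, 3), (6, 0), (10, -4), (15, -5), (30, 12)] z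
       + (158688/13) * eta_quotient [(1, 0), (2, 1), (3, 1), (5, 2), (6, -2), (10, -3), (15, -3), (30, 12)] z
       + (216000/13) * eta_quotient [(1, -1), (2, 3), (3, 1), (5, 3), (6, -1), (10, -5), (15, -7), (30, 15)] z
       + (316224/13) * eta_quotient [(1, 0), (2, 1), (3, 2), (5, 2), (6, -3), (10, -3), (15, -8), (30, 17)] z"
proof -
  \<comment> \<open>A form of level 15 is expressed by eta quotients of level 30. Their leading
    exponents are 1 to 13 and 15, pairwise distinct, so the quotients are linearly independent and
    the coefficients are forced.\<close>
  have "zero_cert 30 25
    (lin [(5400, C_pp_form 3 5), (- 2700, form_30_5), (1100, form_30_6), (14850,
    form_30_7), (2025, form_30_8), (- 14310, form_30_9), (- 207900, form_30_10),
    (- 280, form_30_11), (- 5800, form_30_12), (- 4044, form_30_13), (24525,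
    form_30_14), (3510, form_30_15), (- 2204, form_30_16), (- 7500, form_30_17),
    (- 4392, form_30_18)])"
    by code_simp
  note zero = zero_cert_correct[OF this assms, unfolded lin.simps mf_val.simps of_int_minus of_int_numeral of_int_1 C_form_vals
      form_30_5_eq[OF assms, symmetric] form_30_6_eq[OF assms, symmetric] form_30_7_eq[OF assms,
      symmetric] form_30_8_eq[OF assms, symmetric] form_30_9_eq[OF assms, symmetric]
      form_30_10_eq[OF assms, symmetric] form_30_11_eq[OF assms, symmetric] form_30_12_eq[OF
      assms, symmetric] form_30_13_eq[OF assms, symmetric] form_30_14_eq[OF assms,
      symmetric] form_30_15_eq[OF assms, symmetric] form_30_16_eq[OF assms, symmetric]
      form_30_17_eq[OF assms, symmetric] form_30_18_eq[OF assms, symmetric]]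
  show ?thesis
    using zero by algebra
qed

lemma C_1pp_2_3_eq:
  assumes "z \<in> uhp"
  shows "C_1pp 2 3 z =
         (288/5) * eta_quotient [(1, 2), (2, 2), (3, 2), (6, 2)] z"
proof -
  have "zero_cert 30 25
    (lin [(1, C_1pp_form 2 3), (- 10, form_30_2)])"
    by code_simp
  note zero = zero_cert_correct[OF this assms, unfolded lin.simps mf_val.simps of_int_minus of_int_numeral of_int_1 C_form_vals
      form_30_2_eq[OF assms, symmetric]]
  show ?thesis
    using zero by algebra
qed

lemma C_1pp_2_5_eq:
  assumes "z \<in> uhp"
  shows "C_1pp 2 5 z =
         (2976/13) * eta_quotient [(1, -1), (2, 5), (5, 5), (10, -1)] z
       - (480/13) * eta_quotient [(1, 5), (2, -1), (5, -1), (10, 5)] z"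
proof -
  have "zero_cert 30 25
    (lin [(6, C_1pp_form 2 5), (- 31, form_30_19), (5, form_30_20)])"
    by code_simp
  note zero = zero_cert_correct[OF this assms, unfolded lin.simps mf_val.simps of_int_minus of_int_numeral of_int_1 C_form_vals
      form_30_19_eq[OF assms, symmetric] form_30_20_eq[OF assms, symmetric]]
  show ?thesis
    using zero by algebra
qed

lemma C_1pp_2_7_eq:
  assumes "z \<in> uhp"
  shows "C_1pp 2 7 z =
         (10272/25) * eta_quotient [(1, -2), (2, 6), (7, 6), (14, -2)] z
       - (4608/25) * eta_quotient [(1, 2), (2, 2), (7, 2), (14, 2)] z
       + (672/25) * eta_quotient [(1, 6), (2, -2), (7, -2), (14, 6)] z"
proof -
  have "zero_cert 14 9
    (lin [(42, C_1pp_form 2 7), (- 535, form_14_3), (480, form_14_2), (- 35,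
    form_14_4)])"
    by code_simp
  note zero = zero_cert_correct[OF this assms, unfolded lin.simps mf_val.simps of_int_minus of_int_numeral of_int_1 C_form_vals
      form_14_3_eq[OF assms, symmetric] form_14_2_eq[OF assms, symmetric] form_14_4_eq[OF assms,
      symmetric]]
  show ?thesis
    using zero by algebra
qed

lemma C_1pp_3_5_eq:
  assumes "z \<in> uhp"
  shows "C_1pp 3 5 z =
         (5976/13) * eta_quotient [(1, 11), (2, -5), (3, -5), (5, -5), (6, 3), (10, 3), (15, 11), (30, -5)] z
       + (74592/13) * eta_quotient [(1, 2), (2, -3), (3, -4), (5, -3), (6, 9), (10, 4), (15, 7), (30, -4)] z
       - (137808/13) * eta_quotient [(1, 4), (2, -3), (3, -2), (5, 2), (6, 5), (10, 1), (15, 0), (30, 1)] z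
       - (85968/13) * eta_quotient [(1, 1), (2, -2), (3, -3), (5, 2), (6, 8), (10, -1), (15, 2), (30, 1)] z
       + (153072/13) * eta_quotient [(1, 2), (2, -2), (3, 0), (5, -2), (6, 2), (10, 6), (15, 0), (30, 2)] z
       - (617184/13) * eta_quotient [(1, 1), (2, 2), (3, 4), (5, 3), (6, -3), (10, -2), (15, -4), (30, 7)] z
       + (1513728/13) * eta_quotient [(1, 1), (2, 0), (3, -1), (5, -3), (6, 0), (10, 2), (15, 7), (30, 2)] z
       - (2807424/13) * eta_quotient [(1, 1), (2, -1), (3, -2), (5, 1), (6, 4), (10, -1), (15, 0), (30, 6)] z
       - (943200/13) * eta_quotient [(1, 0), (2, 1), (3, 0), (5, 2), (6, -1), (10, -3), (15, 2), (30, 7)] z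
       + 135504 * eta_quotient [(1, -2), (2, 3), (3, 5), (5, 3), (6, -4), (10, -4), (15, -4), (30, 11)] z
       + (3255696/13) * eta_quotient [(1, 1), (2, 0), (3, 1), (5, 3), (6, 0), (10, -4), (15, -5), (30, 12)] z
       - (3409344/13) * eta_quotient [(1, 0), (2, 1), (3, 1), (5, 2), (6, -2), (10, -3), (15, -3), (30, 12)] z
       + (586368/13) * eta_quotient [(1, -1), (2, 3), (3, 1), (5, 3), (6, -1), (10, -5), (15, -7), (30, 15)] z
       - (10461312/13) * eta_quotient [(1, 0), (2, 1), (3, 2), (5, 2), (6, -3), (10, -3), (15, -8), (30, 17)] z"
proof -
  have "zero_cert 30 25
    (lin [(2700, C_1pp_form 3 5), (- 74700, form_30_5), (- 25900, form_30_6), (430650,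
    form_30_7), (14925, form_30_8), (- 95670, form_30_9), (1928700, form_30_10),
    (- 21024, form_30_11), (97480, form_30_12), (13100, form_30_13), (- 183495,
    form_30_14), (- 226090, form_30_15), (23676, form_30_16), (- 10180,
    form_30_17), (72648, form_30_18)])"
    by code_simp
  note zero = zero_cert_correct[OF this assms, unfolded lin.simps mf_val.simps of_int_minus of_int_numeral of_int_1 C_form_vals
      form_30_5_eq[OF assms, symmetric] form_30_6_eq[OF assms, symmetric] form_30_7_eq[OF assms,
      symmetric] form_30_8_eq[OF assms, symmetric] form_30_9_eq[OF assms, symmetric]
      form_30_10_eq[OF assms, symmetric] form_30_11_eq[OF assms, symmetric] form_30_12_eq[OF
      assms, symmetric] form_30_13_eq[OF assms, symmetric] form_30_14_eq[OF assms,
      symmetric] form_30_15_eq[OF assms, symmetric] form_30_16_eq[OF assms, symmetric]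
      form_30_17_eq[OF assms, symmetric] form_30_18_eq[OF assms, symmetric]]
  show ?thesis
    using zero by algebra
qed

theorem theorem5p1:
  fixes z :: complex
  assumes "Im z > 0"
  shows
    "C_1p 2 z = 0
   \<and> C_1p 3 z = 0
   \<and> C_1p 5 z =
         (576/13) * eta_quotient [(1, 4), (5, 4)] z
   \<and> C_1p 7 z =
         (576/5) * eta_quotient [(1, 5), (2, -1), (7, 5), (14, -1)] z
       + (2304/5) * eta_quotient [(1, 2), (2, 2), (7, 2), (14, 2)] z
   \<and> C_1p 11 z =
         (17280/61) * eta_quotient [(1, 6), (2, -2), (11, 6), (22, -2)] z
       + (118656/61) * eta_quotient [(1, 4), (11, 4)] z
       + (276480/61) * eta_quotient [(1, 2), (2, 2), (11, 2), (22, 2)] z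
       + (276480/61) * eta_quotient [(2, 4), (22, 4)] z
   \<and> C_pp 2 3 z =
       - (144/5) * eta_quotient [(1, 2), (2, 2), (3, 2), (6, 2)] z
   \<and> C_pp 2 5 z =
         (48/13) * eta_quotient [(1, -2), (2, 8), (5, 2)] z
       - (6000/13) * eta_quotient [(1, 2), (5, -2), (10, 8)] z
   \<and> C_pp 2 7 z =
         (288/5) * eta_quotient [(1, 5), (2, -1), (7, 5), (14, -1)] z
       - (336/25) * eta_quotient [(1, -2), (2, 6), (7, 6), (14, -2)] z
       + (8064/25) * eta_quotient [(1, 2), (2, 2), (7, 2), (14, 2)] z
       - (5136/25) * eta_quotient [(1, 6), (2, -2), (7, -2), (14, 6)] z
   \<and> C_pp 3 5 z =
         (108/13) * eta_quotient [(1, 11), (2, -5), (3, -5), (5, -5), (6, 3), (10, 3), (15, 11), (30, -5)] z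
       - (1584/13) * eta_quotient [(1, 2), (2, -3), (3, -4), (5, -3), (6, 9), (10, 4), (15, 7), (30, -4)] z
       - (2376/13) * eta_quotient [(1, 4), (2, -3), (3, -2), (5, 2), (6, 5), (10, 1), (15, 0), (30, 1)] z
       - (5832/13) * eta_quotient [(1, 1), (2, -2), (3, -3), (5, 2), (6, 8), (10, -1), (15, 2), (30, 1)] z
       + (11448/13) * eta_quotient [(1, 2), (2, -2), (3, 0), (5, -2), (6, 2), (10, 6), (15, 0), (30, 2)] z
       + (33264/13) * eta_quotient [(1, 1), (2, 2), (3, 4), (5, 3), (6, -3), (10, -2), (15, -4), (30, 7)] z
       + (10080/13) * eta_quotient [(1, 1), (2, 0), (3, -1), (5, -3), (6, 0), (10, 2), (15, 7), (30, 2)] z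
       + (83520/13) * eta_quotient [(1, 1), (2, -1), (3, -2), (5, 1), (6, 4), (10, -1), (15, 0), (30, 6)] z
       + (145584/13) * eta_quotient [(1, 0), (2, 1), (3, 0), (5, 2), (6, -1), (10, -3), (15, 2), (30, 7)] z
       - (117720/13) * eta_quotient [(1, -2), (2, 3), (3, 5), (5, 3), (6, -4), (10, -4), (15, -4), (30, 11)] z
       - 1944 * eta_quotient [(1, 1), (2, 0), (3, 1), (5, 3), (6, 0), (10, -4), (15, -5), (30, 12)] z
       + (158688/13) * eta_quotient [(1, 0), (2, 1), (3, 1), (5, 2), (6, -2), (10, -3), (15, -3), (30, 12)] z
       + (216000/13) * eta_quotient [(1, -1), (2, 3), (3, 1), (5, 3), (6, -1), (10, -5), (15, -7), (30, 15)] z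
       + (316224/13) * eta_quotient [(1, 0), (2, 1), (3, 2), (5, 2), (6, -3), (10, -3), (15, -8), (30, 17)] z
   \<and> C_1pp 2 3 z =
         (288/5) * eta_quotient [(1, 2), (2, 2), (3, 2), (6, 2)] z
   \<and> C_1pp 2 5 z =
         (2976/13) * eta_quotient [(1, -1), (2, 5), (5, 5), (10, -1)] z
       - (480/13) * eta_quotient [(1, 5), (2, -1), (5, -1), (10, 5)] z
   \<and> C_1pp 2 7 z =
         (10272/25) * eta_quotient [(1, -2), (2, 6), (7, 6), (14, -2)] z
       - (4608/25) * eta_quotient [(1, 2), (2, 2), (7, 2), (14, 2)] z
       + (672/25) * eta_quotient [(1, 6), (2, -2), (7, -2), (14, 6)] z
   \<and> C_1pp 3 5 z =
         (5976/13) * eta_quotient [(1, 11), (2, -5), (3, -5), (5, -5), (6, 3), (10, 3), (15, 11), (30, -5)] z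
       + (74592/13) * eta_quotient [(1, 2), (2, -3), (3, -4), (5, -3), (6, 9), (10, 4), (15, 7), (30, -4)] z
       - (137808/13) * eta_quotient [(1, 4), (2, -3), (3, -2), (5, 2), (6, 5), (10, 1), (15, 0), (30, 1)] z
       - (85968/13) * eta_quotient [(1, 1), (2, -2), (3, -3), (5, 2), (6, 8), (10, -1), (15, 2), (30, 1)] z
       + (153072/13) * eta_quotient [(1, 2), (2, -2), (3, 0), (5, -2), (6, 2), (10, 6), (15, 0), (30, 2)] z
       - (617184/13) * eta_quotient [(1, 1), (2, 2), (3, 4), (5, 3), (6, -3), (10, -2), (15, -4), (30, 7)] z
       + (1513728/13) * eta_quotient [(1, 1), (2, 0), (3, -1), (5, -3), (6, 0), (10, 2), (15, 7), (30, 2)] z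
       - (2807424/13) * eta_quotient [(1, 1), (2, -1), (3, -2), (5, 1), (6, 4), (10, -1), (15, 0), (30, 6)] z
       - (943200/13) * eta_quotient [(1, 0), (2, 1), (3, 0), (5, 2), (6, -1), (10, -3), (15, 2), (30, 7)] z
       + 135504 * eta_quotient [(1, -2), (2, 3), (3, 5), (5, 3), (6, -4), (10, -4), (15, -4), (30, 11)] z
       + (3255696/13) * eta_quotient [(1, 1), (2, 0), (3, 1), (5, 3), (6, 0), (10, -4), (15, -5), (30, 12)] z
       - (3409344/13) * eta_quotient [(1, 0), (2, 1), (3, 1), (5, 2), (6, -2), (10, -3), (15, -3), (30, 12)] z
       + (586368/13) * eta_quotient [(1, -1), (2, 3), (3, 1), (5, 3), (6, -1), (10, -5), (15, -7), (30, 15)] z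
       - (10461312/13) * eta_quotient [(1, 0), (2, 1), (3, 2), (5, 2), (6, -3), (10, -3), (15, -8), (30, 17)] z"
proof -
  have z: "z \<in> uhp" using assms by simp
  show ?thesis
    using C_1p_2_eq[OF z] C_1p_3_eq[OF z] C_1p_5_eq[OF z] C_1p_7_eq[OF z] C_1p_11_eq[OF z]
      C_pp_2_3_eq[OF z] C_pp_2_5_eq[OF z] C_pp_2_7_eq[OF z] C_pp_3_5_eq[OF z]
      C_1pp_2_3_eq[OF z] C_1pp_2_5_eq[OF z] C_1pp_2_7_eq[OF z] C_1pp_3_5_eq[OF z]
    by (intro conjI)
qed

end
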